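(* With the functionals $J$, $J^*$, $J_1^*$, $J_3^*$, the spaces $U$, $Y^*$, the sets $B^*$, $A^*$ and the constant $K>0$ defined in the context, denote $v_0^*=(N_0,Q_0,\tilde M_0)$ and $u_0=((u_0)_1,(u_0)_2,w_0)$, and suppose $(v_0^*,z_0^*,u_0)\in B^*\times Y^*\times U$ is such that $$\delta J_3^*(v_0^*,z_0^*,u_0)=\mathbf{0}.$$ Then $\delta J(u_0)=\mathbf{0}$, $v_0^*=(N_0,Q_0,\tilde M_0)\in A^*$, and $$J(u_0)=\inf_{u\in U}\left\{J(u)+\frac K2\int_\Omega|\nabla w-\nabla w_0|^2\,dx\right\}=J^*(v_0^*,z_0^* )=\sup_{v^*\in A^*}J^*(v^*,z_0^* )=J_1^*(v_0^*,z_0^* ),$$ where $u=(u_1,u_2,w)$ in the infimum.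
   Context: Greek indices range over $\{1,2\}$, repeated indices are summed, a comma denotes (distributional) partial differentiation, and $\delta$ denotes the first variation (Gâteaux derivative with respect to all arguments). $\Omega\subset\mathbb{R}^2$ is open, bounded, connected with Lipschitzian boundary. The tensors are $H_{\alpha\beta\lambda\mu}=h\left(\frac{4\lambda^h\mu^h}{\lambda^h+2\mu^h}\delta_{\alpha\beta}\delta_{\lambda\mu}+2\mu^h(\delta_{\alpha\lambda}\delta_{\beta\mu}+\delta_{\alpha\mu}\delta_{\beta\lambda})\right)$ and $h_{\alpha\beta\lambda\mu}=\frac{h^2}{3}H_{\alpha\beta\lambda\mu}$, with thickness $h>0$ and Lamé constants $\lambda^h,\mu^h>0$; they are symmetric positive definite, and $\{\overline H_{\alpha\beta\lambda\mu}\}=\{H_{\alpha\beta\lambda\mu}\}^{-1}$, $\{\overline h_{\alpha\beta\lambda\mu}\}=\{h_{\alpha\beta\lambda\mu}\}^{-1}$ (inverses as operators on symmetric $2\times2$ matrices). Primal problem: $U=W_0^{1,2}(\Omega;\mathbb{R}^2)\times W_0^{2,2}(\Omega)$, $u=(u_1,u_2,w)$, $P,P_1,P_2\in L^2(\Omega)$, $\kappa_{\alpha\beta}(u)=-w_{,\alpha\beta}$, $\gamma_{\alpha\beta}(u)=\frac12(u_{\alpha,\beta}+u_{\beta,\alpha})+\frac12w_{,\alpha}w_{,\beta}$, and $$J(u)=\frac12\int_\Omega h_{\alpha\beta\lambda\mu}\kappa_{\alpha\beta}(u)\kappa_{\lambda\mu}(u)\,dx+\frac12\int_\Omega H_{\alpha\beta\lambda\mu}\gamma_{\alpha\beta}(u)\gamma_{\lambda\mu}(u)\,dx-\langle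 w,P\rangle_{L^2}-\langle u_\alpha,P_\alpha\rangle_{L^2}.$$ Dual quantities: $K>0$ is a constant; $Y^*=W_0^{2,2}(\Omega)$, $Y_1^*=Y_3^*=L^2(\Omega;\mathbb{R}^{2\times2})$ (fields of symmetric matrices), $Y_2^*=L^2(\Omega;\mathbb{R}^2)$; $$B^*=\{v^*=(N,Q,\tilde M)\in Y_1^*\times Y_2^*\times Y_3^*:\{N_{\alpha\beta}+K\delta_{\alpha\beta}\}\text{ is positive definite in }\Omega\},$$ and $\{\overline{N^K_{\alpha\beta}}\}=\{N_{\alpha\beta}+K\delta_{\alpha\beta}\}^{-1}$. Set $$G_1^*(\tilde M,z^* )=\frac12\int_\Omega\overline h_{\alpha\beta\lambda\mu}(\tilde M_{\alpha\beta}+z^*\delta_{\alpha\beta})(\tilde M_{\lambda\mu}+z^*\delta_{\lambda\mu})\,dx,$$ $$G_2^*(N,Q)=\frac12\int_\Omega\overline{N^K_{\alpha\beta}}Q_\alpha Q_\beta\,dx+\frac12\int_\Omega\overline H_{\alpha\beta\lambda\mu}N_{\alpha\beta}N_{\lambda\mu}\,dx,\qquad F^*(z^* )=\frac1{2K}\int_\Omega|\nabla z^*|^2\,dx.$$ For $v^*=(N,Q,\tilde M)\in B^*$, $z^*\in Y^*$, $u\in U$: $$J^*(v^*,z^* )=-G_1^*(\tilde M,z^* )-G_2^*(N,Q)+F^*(z^* ),$$ $$J_1^*(v^*,z^* )=J^*(v^*,z^* )+\frac12\int_\Omega C_0[L(v^*,z^* )]\,L(v^*,z^* )\,dx,$$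 $$L(v^*,z^* )=\big(\overline h_{11\lambda\mu}(\tilde M_{\lambda\mu}+z^*\delta_{\lambda\mu})\big)_{,22}-\big(\overline h_{22\lambda\mu}(\tilde M_{\lambda\mu}+z^*\delta_{\lambda\mu})\big)_{,11},$$ $$J_3^*(v^*,z^*,u)=J^*(v^*,z^* )+\langle w,\tilde M_{\alpha\beta,\alpha\beta}-Q_{\alpha,\alpha}-P\rangle_{L^2}-\langle u_\alpha,N_{\alpha\beta,\beta}+P_\alpha\rangle_{L^2},$$ with derivatives and pairings of non-smooth fields understood in the distributional (duality) sense. Here $C_0=(1-\varepsilon_3)\big(\overline h_{2222}D_{1111}-2\overline h_{1122}D_{11}D_{22}+\overline h_{1111}D_{2222}\big)^{-1}$, where $D_{\alpha\beta\lambda\mu}[w]=w_{,\alpha\beta\lambda\mu}$, $D_{\alpha\beta}[w]=w_{,\alpha\beta}$, and the inverse maps $y$ to the $w\in W_0^{2,2}(\Omega)$ with $(\overline h_{2222}D_{1111}-2\overline h_{1122}D_{11}D_{22}+\overline h_{1111}D_{2222})[w]=y$. The constant $0<\varepsilon_3<1$ is fixed, sufficiently close to $1$ so that $J_1^*$ is concave in $v^*=(N,Q,\tilde M)$ on $B^*$. Finally $A^*=A_1\cap A_2$, where $A_1=\{(N,Q,\tilde M)\in B^*:N_{\alpha\beta,\beta}+P_\alpha=0\text{ in }\Omega,\ \alpha=1,2\}$ and $A_2=\{(N,Q,\tilde M)\in B^*:\tilde M_{\alpha\beta,\alpha\beta}-Q_{\alpha,\alpha}-P=0\text{ in }\Omega\}$.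 *)

theory Defs
  imports "HOL-Analysis.Analysis" "HOL-Library.Function_Algebras"
begin

section \<open>Pointwise vector space structure on fields\<close>

instantiation "fun" :: (type, real_vector) real_vector
begin

definition scaleR_fun_def: "c *\<^sub>R f = (\<lambda>x. c *\<^sub>R f x)"

instance
  by standard (simp_all add: scaleR_fun_def fun_eq_iff algebra_simps)

end

section \<open>First variation and concavity of extended-valued functionals\<close>

text \<open>
  The functional \<open>f\<close> is considered on its effective domain, the part of \<open>D\<close> where it is finite.
  A direction \<open>\<eta>\<close> is admissible at \<open>x\<close> if the line through \<open>x\<close> in direction \<open>\<eta>\<close> stays in the
  effective domain near \<open>x\<close>; \<open>d \<eta>\<close> is the two-sided Gateaux derivative in direction \<open>\<eta>\<close>.
  If \<open>D\<close> is a linear subspace and \<open>f\<close> is finite on \<open>D\<close>, the admissible directions are exactly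
  the elements of \<open>D\<close>.
\<close>

definition has_first_variation ::
    "'a::real_vector set \<Rightarrow> ('a \<Rightarrow> ereal) \<Rightarrow> 'a \<Rightarrow> ('a \<Rightarrow> real) \<Rightarrow> bool" where
  "has_first_variation D f x d \<longleftrightarrow>
     (let E = {y \<in> D. \<bar>f y\<bar> \<noteq> \<infinity>} in
      x \<in> E \<and>
      (\<forall>\<eta>. (\<exists>e>0. \<forall>t. \<bar>t\<bar> < e \<longrightarrow> x + t *\<^sub>R \<eta> \<in> E) \<longrightarrow>
           ((\<lambda>t. real_of_ereal (f (x + t *\<^sub>R \<eta>))) has_real_derivative d \<eta>) (at 0)))"

definition ext_concave_on :: "'a::real_vector set \<Rightarrow> ('a \<Rightarrow> ereal) \<Rightarrow> bool" where
  "ext_concave_on B f \<longleftrightarrow> convex B \<and>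
     (\<forall>x\<in>B. \<forall>y\<in>B. \<forall>t. 0 < t \<and> t < 1 \<longrightarrow>
        ereal (1 - t) * f x + ereal t * f y \<le> f ((1 - t) *\<^sub>R x + t *\<^sub>R y))"

section \<open>Lipschitz boundary\<close>

text \<open>Near each boundary point, after a rigid motion, \<open>\<Omega>\<close> is the region strictly above the graph
  of a Lipschitz function of one variable.\<close>

definition lipschitz_boundary :: "(real^2) set \<Rightarrow> bool" where
  "lipschitz_boundary \<Omega> \<longleftrightarrow>
     (\<forall>p\<in>frontier \<Omega>. \<exists>T g C r. orthogonal_transformation T \<and> C-lipschitz_on UNIV g \<and> r > 0 \<and>
        (\<forall>x\<in>ball p r. x \<in> \<Omega> \<longleftrightarrow> (g :: real \<Rightarrow> real) (T (x - p) $ 1) < (T (x - p) :: real^2) $ 2))"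

section \<open>Test functions, weak derivatives and Sobolev spaces\<close>

text \<open>Elements of Lebesgue and Sobolev spaces are represented by functions on the whole plane, of
  which only the values almost everywhere in \<open>\<Omega>\<close> are relevant.\<close>

definition L2 :: "(real^2) set \<Rightarrow> (real^2 \<Rightarrow> 'b::euclidean_space) set" where
  "L2 \<Omega> = {f. f \<in> borel_measurable (lebesgue_on \<Omega>) \<and>
              integrable (lebesgue_on \<Omega>) (\<lambda>x. (norm (f x))\<^sup>2)}"

definition L2_lim :: "(real^2) set \<Rightarrow> (nat \<Rightarrow> real^2 \<Rightarrow> real) \<Rightarrow> (real^2 \<Rightarrow> real) \<Rightarrow> bool" where
  "L2_lim \<Omega> F f \<longleftrightarrow> (\<lambda>n. \<integral>x. (F n x - f x)\<^sup>2 \<partial>lebesgue_on \<Omega>) \<longlonglongrightarrow> 0"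

definition pd :: "2 \<Rightarrow> (real^2 \<Rightarrow> real) \<Rightarrow> real^2 \<Rightarrow> real" where
  "pd \<alpha> f x = frechet_derivative f (at x) (axis \<alpha> 1)"

primrec Ck :: "nat \<Rightarrow> (real^2 \<Rightarrow> real) \<Rightarrow> bool" where
  "Ck 0 f \<longleftrightarrow> continuous_on UNIV f"
| "Ck (Suc k) f \<longleftrightarrow> (\<forall>x. f differentiable (at x)) \<and> (\<forall>\<alpha>. Ck k (pd \<alpha> f))"

definition test_fun :: "(real^2) set \<Rightarrow> (real^2 \<Rightarrow> real) set" where
  "test_fun \<Omega> = {\<phi>. (\<forall>k. Ck k \<phi>) \<and> (\<exists>S. compact S \<and> S \<subseteq> \<Omega> \<and> (\<forall>x. x \<notin> S \<longrightarrow> \<phi> x = 0))}"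

definition has_weak_pd :: "(real^2) set \<Rightarrow> 2 \<Rightarrow> (real^2 \<Rightarrow> real) \<Rightarrow> (real^2 \<Rightarrow> real) \<Rightarrow> bool" where
  "has_weak_pd \<Omega> \<alpha> f g \<longleftrightarrow> g \<in> L2 \<Omega> \<and>
     (\<forall>\<phi>\<in>test_fun \<Omega>. (\<integral>x. f x * pd \<alpha> \<phi> x \<partial>lebesgue_on \<Omega>) = - (\<integral>x. g x * \<phi> x \<partial>lebesgue_on \<Omega>))"

text \<open>The weak derivative is unique up to null sets; the choice of a representative is immaterial.\<close>

definition wpd :: "(real^2) set \<Rightarrow> 2 \<Rightarrow> (real^2 \<Rightarrow> real) \<Rightarrow> real^2 \<Rightarrow> real" where
  "wpd \<Omega> \<alpha> f = (SOME g. has_weak_pd \<Omega> \<alpha> f g)"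

definition wpd2 :: "(real^2) set \<Rightarrow> 2 \<Rightarrow> 2 \<Rightarrow> (real^2 \<Rightarrow> real) \<Rightarrow> real^2 \<Rightarrow> real" where
  "wpd2 \<Omega> \<alpha> \<beta> f = wpd \<Omega> \<beta> (wpd \<Omega> \<alpha> f)"

definition W12 :: "(real^2) set \<Rightarrow> (real^2 \<Rightarrow> real) set" where
  "W12 \<Omega> = {f \<in> L2 \<Omega>. \<forall>\<alpha>. \<exists>g. has_weak_pd \<Omega> \<alpha> f g}"

definition W22 :: "(real^2) set \<Rightarrow> (real^2 \<Rightarrow> real) set" where
  "W22 \<Omega> = {f \<in> W12 \<Omega>. \<forall>\<alpha>. wpd \<Omega> \<alpha> f \<in> W12 \<Omega>}"

definition W12_0 :: "(real^2) set \<Rightarrow> (real^2 \<Rightarrow> real) set" where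
  "W12_0 \<Omega> = {f \<in> W12 \<Omega>. \<exists>\<phi>. (\<forall>n. \<phi> n \<in> test_fun \<Omega>) \<and> L2_lim \<Omega> \<phi> f \<and>
     (\<forall>\<alpha>. L2_lim \<Omega> (\<lambda>n. pd \<alpha> (\<phi> n)) (wpd \<Omega> \<alpha> f))}"

definition W22_0 :: "(real^2) set \<Rightarrow> (real^2 \<Rightarrow> real) set" where
  "W22_0 \<Omega> = {f \<in> W22 \<Omega>. \<exists>\<phi>. (\<forall>n. \<phi> n \<in> test_fun \<Omega>) \<and> L2_lim \<Omega> \<phi> f \<and>
     (\<forall>\<alpha>. L2_lim \<Omega> (\<lambda>n. pd \<alpha> (\<phi> n)) (wpd \<Omega> \<alpha> f)) \<and>
     (\<forall>\<alpha> \<beta>. L2_lim \<Omega> (\<lambda>n. pd \<beta> (pd \<alpha> (\<phi> n))) (wpd2 \<Omega> \<alpha> \<beta> f))}"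

definition grad2 :: "(real^2) set \<Rightarrow> (real^2 \<Rightarrow> real) \<Rightarrow> real^2 \<Rightarrow> real^2" where
  "grad2 \<Omega> f x = (\<chi> \<alpha>. wpd \<Omega> \<alpha> f x)"

section \<open>Elasticity tensors\<close>

type_synonym tensor4 = "2 \<Rightarrow> 2 \<Rightarrow> 2 \<Rightarrow> 2 \<Rightarrow> real"

definition kd :: "2 \<Rightarrow> 2 \<Rightarrow> real" where
  "kd \<alpha> \<beta> = (if \<alpha> = \<beta> then 1 else 0)"

text \<open>Throughout, \<open>h\<close> is the plate thickness and \<open>la\<close>, \<open>mu\<close> are the Lame constants.\<close>

definition H_tensor :: "real \<Rightarrow> real \<Rightarrow> real \<Rightarrow> tensor4" where
  "H_tensor h la mu \<alpha> \<beta> l m =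
     h * (4 * la * mu / (la + 2 * mu) * kd \<alpha> \<beta> * kd l m
          + 2 * mu * (kd \<alpha> l * kd \<beta> m + kd \<alpha> m * kd \<beta> l))"

definition h_tensor :: "real \<Rightarrow> real \<Rightarrow> real \<Rightarrow> tensor4" where
  "h_tensor h la mu \<alpha> \<beta> l m = h\<^sup>2 / 3 * H_tensor h la mu \<alpha> \<beta> l m"

definition tensor_apply :: "tensor4 \<Rightarrow> real^2^2 \<Rightarrow> real^2^2" where
  "tensor_apply T A = (\<chi> \<alpha> \<beta>. \<Sum>l\<in>UNIV. \<Sum>m\<in>UNIV. T \<alpha> \<beta> l m * A $ l $ m)"

definition tensor_form :: "tensor4 \<Rightarrow> real^2^2 \<Rightarrow> real^2^2 \<Rightarrow> real" where
  "tensor_form T A B =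
     (\<Sum>\<alpha>\<in>UNIV. \<Sum>\<beta>\<in>UNIV. \<Sum>l\<in>UNIV. \<Sum>m\<in>UNIV. T \<alpha> \<beta> l m * A $ \<alpha> $ \<beta> * B $ l $ m)"

definition sym_mat :: "(real^2^2) set" where
  "sym_mat = {A. transpose A = A}"

text \<open>Components of the inverse of \<open>T\<close> as an operator on symmetric matrices. They are read off from
  the symmetrized matrix units, so the result has the minor symmetries
  \<open>\<alpha>\<beta> \<leftrightarrow> \<beta>\<alpha>\<close> and \<open>lm \<leftrightarrow> ml\<close>.\<close>

definition tensor_inv :: "tensor4 \<Rightarrow> tensor4" where
  "tensor_inv T \<alpha> \<beta> l m =
     inv_into sym_mat (tensor_apply T)
       (\<chi> i j. (kd i l * kd j m + kd i m * kd j l) / 2) $ \<alpha> $ \<beta>"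

definition H_bar :: "real \<Rightarrow> real \<Rightarrow> real \<Rightarrow> tensor4" where
  "H_bar h la mu = tensor_inv (H_tensor h la mu)"

definition h_bar :: "real \<Rightarrow> real \<Rightarrow> real \<Rightarrow> tensor4" where
  "h_bar h la mu = tensor_inv (h_tensor h la mu)"

definition pos_def :: "real^2^2 \<Rightarrow> bool" where
  "pos_def A \<longleftrightarrow> A \<in> sym_mat \<and> (\<forall>x. x \<noteq> 0 \<longrightarrow> x \<bullet> (A *v x) > 0)"

section \<open>Primal problem\<close>

type_synonym scalar_field = "real^2 \<Rightarrow> real"
type_synonym vector_field = "real^2 \<Rightarrow> real^2"
type_synonym matrix_field = "real^2 \<Rightarrow> real^2^2"
type_synonym displacement = "vector_field \<times> scalar_field"

definition U_space :: "(real^2) set \<Rightarrow> displacement set" where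
  "U_space \<Omega> = {(v, w). (\<forall>\<alpha>. (\<lambda>x. v x $ \<alpha>) \<in> W12_0 \<Omega>) \<and> w \<in> W22_0 \<Omega>}"

definition kappa :: "(real^2) set \<Rightarrow> displacement \<Rightarrow> matrix_field" where
  "kappa \<Omega> u x = (case u of (v, w) \<Rightarrow> \<chi> \<alpha> \<beta>. - wpd2 \<Omega> \<alpha> \<beta> w x)"

definition gamma :: "(real^2) set \<Rightarrow> displacement \<Rightarrow> matrix_field" where
  "gamma \<Omega> u x = (case u of (v, w) \<Rightarrow>
     \<chi> \<alpha> \<beta>. (wpd \<Omega> \<beta> (\<lambda>y. v y $ \<alpha>) x + wpd \<Omega> \<alpha> (\<lambda>y. v y $ \<beta>) x) / 2
             + wpd \<Omega> \<alpha> w x * wpd \<Omega> \<beta> w x / 2)"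

text \<open>\<open>P\<close> is the transverse load and \<open>p\<close> the in-plane load \<open>(P\<^sub>1, P\<^sub>2)\<close>.\<close>

definition J :: "(real^2) set \<Rightarrow> real \<Rightarrow> real \<Rightarrow> real \<Rightarrow> scalar_field \<Rightarrow> vector_field \<Rightarrow>
    displacement \<Rightarrow> real" where
  "J \<Omega> h la mu P p u = (case u of (v, w) \<Rightarrow>
     (\<integral>x. tensor_form (h_tensor h la mu) (kappa \<Omega> u x) (kappa \<Omega> u x) \<partial>lebesgue_on \<Omega>) / 2
     + (\<integral>x. tensor_form (H_tensor h la mu) (gamma \<Omega> u x) (gamma \<Omega> u x) \<partial>lebesgue_on \<Omega>) / 2
     - (\<integral>x. w x * P x \<partial>lebesgue_on \<Omega>)
     - (\<integral>x. v x \<bullet> p x \<partial>lebesgue_on \<Omega>))"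

section \<open>Dual functionals\<close>

text \<open>The dual variable is \<open>v = (N, Q, M)\<close>.\<close>

type_synonym dual_var = "matrix_field \<times> vector_field \<times> matrix_field"

definition L2_sym :: "(real^2) set \<Rightarrow> matrix_field set" where
  "L2_sym \<Omega> = {N \<in> L2 \<Omega>. AE x in lebesgue_on \<Omega>. N x \<in> sym_mat}"

definition B_star :: "(real^2) set \<Rightarrow> real \<Rightarrow> dual_var set" where
  "B_star \<Omega> K = {(N, Q, M). N \<in> L2_sym \<Omega> \<and> Q \<in> L2 \<Omega> \<and> M \<in> L2_sym \<Omega> \<and>
     (AE x in lebesgue_on \<Omega>. pos_def (N x + K *\<^sub>R mat 1))}"

definition G1_star :: "(real^2) set \<Rightarrow> real \<Rightarrow> real \<Rightarrow> real \<Rightarrow> matrix_field \<Rightarrow> scalar_field \<Rightarrow> real" where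
  "G1_star \<Omega> h la mu M z =
     (\<integral>x. tensor_form (h_bar h la mu) (M x + z x *\<^sub>R mat 1) (M x + z x *\<^sub>R mat 1) \<partial>lebesgue_on \<Omega>) / 2"

text \<open>On \<open>B_star\<close> the integrand of the first term is nonnegative almost everywhere, but, since the
  positive definiteness of \<open>N + K \<delta>\<close> need not be uniform, its integral may be infinite.
  Hence \<open>G2_star\<close> takes values in \<open>[0, \<infinity>]\<close> and the functionals below take values in
  \<open>[-\<infinity>, \<infinity>)\<close>.\<close>

definition G2_star :: "(real^2) set \<Rightarrow> real \<Rightarrow> real \<Rightarrow> real \<Rightarrow> real \<Rightarrow> matrix_field \<Rightarrow> vector_field \<Rightarrow> ereal"
  where
  "G2_star \<Omega> h la mu K N Q =
     ereal (1 / 2) * enn2ereal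
       (\<integral>\<^sup>+x. ennreal (Q x \<bullet> (matrix_inv (N x + K *\<^sub>R mat 1) *v Q x)) \<partial>lebesgue_on \<Omega>)
     + ereal ((\<integral>x. tensor_form (H_bar h la mu) (N x) (N x) \<partial>lebesgue_on \<Omega>) / 2)"

definition F_star :: "(real^2) set \<Rightarrow> real \<Rightarrow> scalar_field \<Rightarrow> real" where
  "F_star \<Omega> K z = 1 / (2 * K) * (\<integral>x. (norm (grad2 \<Omega> z x))\<^sup>2 \<partial>lebesgue_on \<Omega>)"

definition J_star :: "(real^2) set \<Rightarrow> real \<Rightarrow> real \<Rightarrow> real \<Rightarrow> real \<Rightarrow> dual_var \<Rightarrow> scalar_field \<Rightarrow> ereal" where
  "J_star \<Omega> h la mu K v z = (case v of (N, Q, M) \<Rightarrow>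
     - ereal (G1_star \<Omega> h la mu M z) - G2_star \<Omega> h la mu K N Q + ereal (F_star \<Omega> K z))"

subsection \<open>Equilibrium residuals\<close>

text \<open>The distributions \<open>M\<^sub>\<alpha>\<^sub>\<beta>\<^sub>,\<^sub>\<alpha>\<^sub>\<beta> - Q\<^sub>\<alpha>\<^sub>,\<^sub>\<alpha> - P\<close> and \<open>N\<^sub>\<alpha>\<^sub>\<beta>\<^sub>,\<^sub>\<beta> + P\<^sub>\<alpha>\<close>, as functionals on \<open>W22_0\<close> and
  \<open>W12_0\<close> respectively: each distributional derivative is moved to the argument with a sign change.
  Equality to zero in \<open>\<Omega>\<close> means vanishing on test functions.\<close>

definition transverse_residual :: "(real^2) set \<Rightarrow> scalar_field \<Rightarrow> dual_var \<Rightarrow> scalar_field \<Rightarrow> real" where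
  "transverse_residual \<Omega> P v w = (case v of (N, Q, M) \<Rightarrow>
     (\<integral>x. (\<Sum>\<alpha>\<in>UNIV. \<Sum>\<beta>\<in>UNIV. M x $ \<alpha> $ \<beta> * wpd2 \<Omega> \<alpha> \<beta> w x) \<partial>lebesgue_on \<Omega>)
     + (\<integral>x. (\<Sum>\<alpha>\<in>UNIV. Q x $ \<alpha> * wpd \<Omega> \<alpha> w x) \<partial>lebesgue_on \<Omega>)
     - (\<integral>x. P x * w x \<partial>lebesgue_on \<Omega>))"

definition inplane_residual ::
    "(real^2) set \<Rightarrow> vector_field \<Rightarrow> dual_var \<Rightarrow> 2 \<Rightarrow> scalar_field \<Rightarrow> real" where
  "inplane_residual \<Omega> p v \<alpha> f = (case v of (N, Q, M) \<Rightarrow>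
     - (\<integral>x. (\<Sum>\<beta>\<in>UNIV. N x $ \<alpha> $ \<beta> * wpd \<Omega> \<beta> f x) \<partial>lebesgue_on \<Omega>)
     + (\<integral>x. p x $ \<alpha> * f x \<partial>lebesgue_on \<Omega>))"

definition A1_star :: "(real^2) set \<Rightarrow> real \<Rightarrow> vector_field \<Rightarrow> dual_var set" where
  "A1_star \<Omega> K p = {v \<in> B_star \<Omega> K. \<forall>\<alpha>. \<forall>\<phi>\<in>test_fun \<Omega>. inplane_residual \<Omega> p v \<alpha> \<phi> = 0}"

definition A2_star :: "(real^2) set \<Rightarrow> real \<Rightarrow> scalar_field \<Rightarrow> dual_var set" where
  "A2_star \<Omega> K P = {v \<in> B_star \<Omega> K. \<forall>\<phi>\<in>test_fun \<Omega>. transverse_residual \<Omega> P v \<phi> = 0}"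

definition A_star :: "(real^2) set \<Rightarrow> real \<Rightarrow> scalar_field \<Rightarrow> vector_field \<Rightarrow> dual_var set" where
  "A_star \<Omega> K P p = A1_star \<Omega> K p \<inter> A2_star \<Omega> K P"

definition J3_star :: "(real^2) set \<Rightarrow> real \<Rightarrow> real \<Rightarrow> real \<Rightarrow> real \<Rightarrow> scalar_field \<Rightarrow> vector_field \<Rightarrow>
    dual_var \<Rightarrow> scalar_field \<Rightarrow> displacement \<Rightarrow> ereal" where
  "J3_star \<Omega> h la mu K P p v z u = (case u of (u', w) \<Rightarrow>
     J_star \<Omega> h la mu K v z
     + ereal (transverse_residual \<Omega> P v w
              - (\<Sum>\<alpha>\<in>UNIV. inplane_residual \<Omega> p v \<alpha> (\<lambda>x. u' x $ \<alpha>))))"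

subsection \<open>The compatibility term\<close>

text \<open>\<open>L_op\<close> is the distribution \<open>(hb\<^sub>1\<^sub>1\<^sub>l\<^sub>m (M + z \<delta>)\<^sub>l\<^sub>m)\<^sub>,\<^sub>2\<^sub>2 - (hb\<^sub>2\<^sub>2\<^sub>l\<^sub>m (M + z \<delta>)\<^sub>l\<^sub>m)\<^sub>,\<^sub>1\<^sub>1\<close>
  (with \<open>hb = h_bar\<close>) and \<open>plate_op w\<close> the distribution
  \<open>hb\<^sub>2\<^sub>2\<^sub>2\<^sub>2 w\<^sub>,\<^sub>1\<^sub>1\<^sub>1\<^sub>1 - 2 hb\<^sub>1\<^sub>1\<^sub>2\<^sub>2 w\<^sub>,\<^sub>2\<^sub>2\<^sub>1\<^sub>1 + hb\<^sub>1\<^sub>1\<^sub>1\<^sub>1 w\<^sub>,\<^sub>2\<^sub>2\<^sub>2\<^sub>2\<close>, both as functionals on \<open>W22_0\<close>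
  obtained by moving two derivatives to the argument.\<close>

definition L_op :: "(real^2) set \<Rightarrow> real \<Rightarrow> real \<Rightarrow> real \<Rightarrow> dual_var \<Rightarrow> scalar_field \<Rightarrow> scalar_field \<Rightarrow> real"
  where
  "L_op \<Omega> h la mu v z f = (case v of (N, Q, M) \<Rightarrow>
     (\<integral>x. tensor_apply (h_bar h la mu) (M x + z x *\<^sub>R mat 1) $ 1 $ 1 * wpd2 \<Omega> 2 2 f x \<partial>lebesgue_on \<Omega>)
     - (\<integral>x. tensor_apply (h_bar h la mu) (M x + z x *\<^sub>R mat 1) $ 2 $ 2 * wpd2 \<Omega> 1 1 f x \<partial>lebesgue_on \<Omega>))"

definition plate_op :: "(real^2) set \<Rightarrow> real \<Rightarrow> real \<Rightarrow> real \<Rightarrow> scalar_field \<Rightarrow> scalar_field \<Rightarrow> real" where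
  "plate_op \<Omega> h la mu w f =
     h_bar h la mu 2 2 2 2 * (\<integral>x. wpd2 \<Omega> 1 1 w x * wpd2 \<Omega> 1 1 f x \<partial>lebesgue_on \<Omega>)
     - 2 * h_bar h la mu 1 1 2 2 * (\<integral>x. wpd2 \<Omega> 2 2 w x * wpd2 \<Omega> 1 1 f x \<partial>lebesgue_on \<Omega>)
     + h_bar h la mu 1 1 1 1 * (\<integral>x. wpd2 \<Omega> 2 2 w x * wpd2 \<Omega> 2 2 f x \<partial>lebesgue_on \<Omega>)"

text \<open>The solution of \<open>plate_op w = y\<close> in \<open>W22_0\<close> is unique up to null sets.\<close>

definition C0 :: "(real^2) set \<Rightarrow> real \<Rightarrow> real \<Rightarrow> real \<Rightarrow> real \<Rightarrow> (scalar_field \<Rightarrow> real) \<Rightarrow> scalar_field" where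
  "C0 \<Omega> h la mu eps3 y =
     (1 - eps3) *\<^sub>R (SOME w. w \<in> W22_0 \<Omega> \<and> (\<forall>\<phi>\<in>test_fun \<Omega>. plate_op \<Omega> h la mu w \<phi> = y \<phi>))"

definition J1_star :: "(real^2) set \<Rightarrow> real \<Rightarrow> real \<Rightarrow> real \<Rightarrow> real \<Rightarrow> real \<Rightarrow>
    dual_var \<Rightarrow> scalar_field \<Rightarrow> ereal" where
  "J1_star \<Omega> h la mu K eps3 v z =
     J_star \<Omega> h la mu K v z
     + ereal (1 / 2 * L_op \<Omega> h la mu v z (C0 \<Omega> h la mu eps3 (L_op \<Omega> h la mu v z)))"

end

theory Submission
  imports Defs
begin

text \<open>
  Write \<open>A = N + K \<delta>\<close>. Three Fenchel inequalities, one for the bending energy, one for the membrane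
  energy and \<open>Q \<bullet> y - Q \<bullet> A\<^sup>-\<^sup>1 Q / 2 \<le> y \<bullet> A y / 2\<close> with \<open>y = \<nabla> w\<close>, add up to a bound of the Lagrangian
  \<open>J3_star v z u\<close> by a functional \<open>primal_bound z u\<close> free of \<open>v\<close> (lemma \<open>lagrangian_le_primal_bound\<close>).
  On \<open>A_star\<close> the residuals vanish and the Lagrangian is \<open>J_star v z\<close>, whatever \<open>u\<close> is
  (lemma \<open>J_star_A_star\<close>).

  Stationarity gives four facts at \<open>(v\<^sub>0, z\<^sub>0, u\<^sub>0)\<close>. The variation of \<open>u\<close> gives \<open>v\<^sub>0 \<in> A_star\<close>. The
  variation of \<open>v\<close> gives the equality cases of the three Fenchel inequalities
  (lemma \<open>stationary_dual_equations\<close>), hence equality of the Lagrangian and its bound. The variation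
  of \<open>z\<close> gives \<open>\<nabla> z\<^sub>0 = - K \<nabla> w\<^sub>0\<close> (lemma \<open>stationary_gradient\<close>). With this gradient,
  \<open>primal_bound z\<^sub>0 u\<close> is the regularized energy \<open>J u + K / 2 \<integral> |\<nabla> w - \<nabla> w\<^sub>0|\<^sup>2\<close>
  (lemma \<open>primal_bound_regularized\<close>). Therefore, for all \<open>u\<close> and all \<open>v\<close> in \<open>A_star\<close>,
  \<open>J_star v z\<^sub>0 \<le> J u\<^sub>0 = J_star v\<^sub>0 z\<^sub>0 \<le> J u + K / 2 \<integral> |\<nabla> w - \<nabla> w\<^sub>0|\<^sup>2\<close>,
  which is the equality of infimum and supremum. Since \<open>u\<^sub>0\<close> minimizes \<open>J\<close> plus a quadratic term that
  is stationary at \<open>u\<^sub>0\<close>, the first variation of \<open>J\<close> vanishes there. Finally \<open>h_bar (M\<^sub>0 + z\<^sub>0 \<delta>)\<close> is the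
  Hessian of \<open>w\<^sub>0\<close>, so the compatibility operator \<open>L_op\<close> annihilates \<open>W22_0\<close> and \<open>J1_star\<close> agrees with
  \<open>J_star\<close>.

  The analytic input consists of the fundamental lemma of the calculus of variations (which makes weak
  derivatives unique and turns residuals into equations), integration by parts in \<open>W12_0\<close> and the inequality of Ladyzhenskaya, which puts the
  products \<open>w\<^sub>,\<^sub>\<alpha> w\<^sub>,\<^sub>\<beta>\<close> into \<open>L2\<close> and so makes the membrane energy an integrable function.
\<close>

section \<open>Calculus of test functions\<close>

lemma pd_eqI: "(f has_derivative f') (at x) \<Longrightarrow> pd \<alpha> f x = f' (axis \<alpha> 1)"
  unfolding pd_def using frechet_derivative_at by metis

lemma pd_add:
  assumes "f differentiable (at x)" "g differentiable (at x)"
  shows "pd \<alpha> (\<lambda>x. f x + g x) x = pd \<alpha> f x + pd \<alpha> g x"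
  using pd_eqI[OF has_derivative_add[OF assms[unfolded frechet_derivative_works]]]
  by (simp add: pd_def)

lemma pd_mult:
  assumes "f differentiable (at x)" "g differentiable (at x)"
  shows "pd \<alpha> (\<lambda>x. f x * g x) x = f x * pd \<alpha> g x + pd \<alpha> f x * g x"
  using pd_eqI[OF has_derivative_mult[OF assms[unfolded frechet_derivative_works]]]
  by (simp add: pd_def)

lemma pd_const: "pd \<alpha> (\<lambda>x. c) x = 0"
  by (rule pd_eqI[OF has_derivative_const])

lemma pd_along_line:
  assumes "\<And>x. f differentiable (at x)"
  shows "((\<lambda>t. f (x + t *\<^sub>R axis \<alpha> 1)) has_real_derivative pd \<alpha> f (x + t *\<^sub>R axis \<alpha> 1)) (at t)"
proof -
  define y where "y = x + t *\<^sub>R axis \<alpha> 1"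
  have d: "(f has_derivative frechet_derivative f (at y)) (at y)"
    using assms frechet_derivative_works by blast
  have "((\<lambda>t. x + t *\<^sub>R axis \<alpha> 1) has_derivative (\<lambda>s. s *\<^sub>R axis \<alpha> 1)) (at t)"
    by (auto intro!: derivative_eq_intros)
  then have "((\<lambda>t. f (x + t *\<^sub>R axis \<alpha> 1)) has_derivative
      (\<lambda>s. frechet_derivative f (at y) (s *\<^sub>R axis \<alpha> 1))) (at t)"
    using d has_derivative_compose unfolding y_def by fast
  moreover have "(\<lambda>s. frechet_derivative f (at y) (s *\<^sub>R axis \<alpha> 1)) = (*) (pd \<alpha> f y)"
    using linear_scale[OF has_derivative_linear[OF d]] by (auto simp: pd_def)
  ultimately show ?thesis
    unfolding has_field_derivative_def y_def by simp
qed

lemma Ck_Suc_imp: "Ck (Suc k) f \<Longrightarrow> Ck k f"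
proof (induction k arbitrary: f)
  case 0
  then show ?case
    by (auto intro!: continuous_at_imp_continuous_on differentiable_imp_continuous_within)
next
  case (Suc k)
  then show ?case by simp
qed

lemma Ck_0: "Ck k f \<Longrightarrow> continuous_on UNIV f"
  by (induction k) (use Ck_Suc_imp in auto)

lemma Ck_const: "Ck k (\<lambda>x. c)"
proof (induction k arbitrary: c)
  case (Suc k)
  have "pd \<alpha> (\<lambda>x. c) = (\<lambda>x. 0)" for \<alpha>
    by (auto simp: pd_const)
  with Suc show ?case by simp
qed simp

lemma Ck_add: "Ck k f \<Longrightarrow> Ck k g \<Longrightarrow> Ck k (\<lambda>x. f x + g x)"
proof (induction k arbitrary: f g)
  case 0 then show ?case by (auto intro!: continuous_intros)
next
  case (Suc k)
  then have "pd \<alpha> (\<lambda>x. f x + g x) = (\<lambda>x. pd \<alpha> f x + pd \<alpha> g x)" for \<alpha>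
    using pd_add by auto
  with Suc show ?case by auto
qed

lemma Ck_mult: "Ck k f \<Longrightarrow> Ck k g \<Longrightarrow> Ck k (\<lambda>x. f x * g x)"
proof (induction k arbitrary: f g)
  case 0 then show ?case by (auto intro!: continuous_intros)
next
  case (Suc k)
  then have eq: "pd \<alpha> (\<lambda>x. f x * g x) = (\<lambda>x. f x * pd \<alpha> g x + pd \<alpha> f x * g x)" for \<alpha>
    using pd_mult by auto
  have "Ck k f" "Ck k g"
    using Suc.prems Ck_Suc_imp by blast+
  then have "Ck k (\<lambda>x. f x * pd \<alpha> g x + pd \<alpha> f x * g x)" for \<alpha>
    using Suc by (intro Ck_add) auto
  with Suc show ?case
    by (simp add: eq)
qed

lemma test_fun_smooth: "\<phi> \<in> test_fun \<Omega> \<Longrightarrow> Ck k \<phi>"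
  by (simp add: test_fun_def)

lemma test_fun_differentiable: "\<phi> \<in> test_fun \<Omega> \<Longrightarrow> \<phi> differentiable (at x)"
  using test_fun_smooth[of \<phi> \<Omega> "Suc 0"] by simp

lemma test_fun_continuous: "\<phi> \<in> test_fun \<Omega> \<Longrightarrow> continuous_on UNIV \<phi>"
  using test_fun_smooth[of \<phi> \<Omega> 0] by simp

lemma test_fun_support:
  assumes "\<phi> \<in> test_fun \<Omega>"
  shows "\<exists>S. compact S \<and> S \<subseteq> \<Omega> \<and> (\<forall>x. x \<notin> S \<longrightarrow> \<phi> x = 0)"
  using assms by (simp add: test_fun_def)

lemma pd_outside_support:
  assumes "closed S" "\<forall>x. x \<notin> S \<longrightarrow> \<phi> x = 0" "x \<notin> S"
  shows "pd \<alpha> \<phi> x = 0"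
proof (rule trans[OF pd_eqI])
  show "(\<phi> has_derivative (\<lambda>_. 0)) (at x)"
    by (rule has_derivative_transform_within_open[where s = "- S" and f = "\<lambda>_. 0"])
      (use assms in auto)
qed simp

lemma test_fun_zero: "(\<lambda>x. 0) \<in> test_fun \<Omega>"
proof -
  have "\<exists>S. compact S \<and> S \<subseteq> \<Omega> \<and> (\<forall>x. x \<notin> S \<longrightarrow> (0::real) = 0)"
    by (rule exI[of _ "{}"]) simp
  then show ?thesis
    by (simp add: test_fun_def Ck_const)
qed

lemma test_fun_add:
  assumes "\<phi> \<in> test_fun \<Omega>" "\<psi> \<in> test_fun \<Omega>"
  shows "(\<lambda>x. \<phi> x + \<psi> x) \<in> test_fun \<Omega>"
proof -
  obtain S T where "compact S" "S \<subseteq> \<Omega>" "\<forall>x. x \<notin> S \<longrightarrow> \<phi> x = 0"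
    "compact T" "T \<subseteq> \<Omega>" "\<forall>x. x \<notin> T \<longrightarrow> \<psi> x = 0"
    using test_fun_support[OF assms(1)] test_fun_support[OF assms(2)] by blast
  then have "compact (S \<union> T) \<and> S \<union> T \<subseteq> \<Omega> \<and> (\<forall>x. x \<notin> S \<union> T \<longrightarrow> \<phi> x + \<psi> x = 0)"
    by (auto simp: compact_Un)
  then show ?thesis
    using assms by (auto simp: test_fun_def intro!: Ck_add)
qed

lemma test_fun_mult:
  assumes "\<phi> \<in> test_fun \<Omega>" "\<And>k. Ck k \<psi>"
  shows "(\<lambda>x. \<phi> x * \<psi> x) \<in> test_fun \<Omega>"
proof -
  obtain S where "compact S" "S \<subseteq> \<Omega>" "\<forall>x. x \<notin> S \<longrightarrow> \<phi> x = 0"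
    using test_fun_support[OF assms(1)] by blast
  then have "compact S \<and> S \<subseteq> \<Omega> \<and> (\<forall>x. x \<notin> S \<longrightarrow> \<phi> x * \<psi> x = 0)"
    by auto
  then show ?thesis
    using assms by (auto simp: test_fun_def intro!: Ck_mult)
qed

lemma test_fun_cmult: "\<phi> \<in> test_fun \<Omega> \<Longrightarrow> (\<lambda>x. c * \<phi> x) \<in> test_fun \<Omega>"
  using test_fun_mult[of \<phi> \<Omega> "\<lambda>x. c"] by (simp add: Ck_const mult.commute)

lemma test_fun_pd:
  assumes "\<phi> \<in> test_fun \<Omega>"
  shows "pd \<alpha> \<phi> \<in> test_fun \<Omega>"
proof -
  obtain S where S: "compact S" "S \<subseteq> \<Omega>" "\<forall>x. x \<notin> S \<longrightarrow> \<phi> x = 0"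
    using test_fun_support[OF assms] by blast
  then have "pd \<alpha> \<phi> x = 0" if "x \<notin> S" for x
    using pd_outside_support that compact_imp_closed by blast
  moreover have "Ck k (pd \<alpha> \<phi>)" for k
    using test_fun_smooth[OF assms, of "Suc k"] by simp
  ultimately show ?thesis
    using S by (auto simp: test_fun_def)
qed

lemma test_fun_cadd_pd:
  assumes "\<phi> \<in> test_fun \<Omega>" "\<psi> \<in> test_fun \<Omega>"
  shows "pd \<alpha> (\<lambda>x. \<phi> x + c * \<psi> x) = (\<lambda>x. pd \<alpha> \<phi> x + c * pd \<alpha> \<psi> x)"
proof
  fix x
  have "\<phi> differentiable (at x)" "(\<lambda>x. c * \<psi> x) differentiable (at x)"
    "(\<lambda>x::real^2. c) differentiable (at x)" "\<psi> differentiable (at x)"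
    using assms test_fun_differentiable test_fun_cmult by auto
  then show "pd \<alpha> (\<lambda>x. \<phi> x + c * \<psi> x) x = pd \<alpha> \<phi> x + c * pd \<alpha> \<psi> x"
    using pd_mult[of "\<lambda>x. c" x \<psi> \<alpha>] by (simp add: pd_add pd_const)
qed

subsection \<open>Bump functions\<close>

text \<open>The function \<open>exp (- 1 / t)\<close>, continued by zero to \<open>t \<le> 0\<close>, is the classical smooth function
  that is not analytic. The powers of \<open>1 / t\<close> make the family closed under differentiation, so
  smoothness follows by induction on the order of the derivative.\<close>

definition flat :: "nat \<Rightarrow> real \<Rightarrow> real" where
  "flat k t = (if t > 0 then inverse t ^ k * exp (- inverse t) else 0)"

lemma flat_tendsto_0: "(flat k \<longlongrightarrow> 0) (at 0)"
proof -
  have "((\<lambda>y. y ^ k * exp (- y)) \<longlongrightarrow> (0::real)) at_top"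
    using tendsto_power_div_exp_0[of k] by (simp add: exp_minus field_simps)
  then have "((\<lambda>t. inverse t ^ k * exp (- inverse t)) \<longlongrightarrow> (0::real)) (at_right 0)"
    using filterlim_compose filterlim_inverse_at_top_right by blast
  moreover have "eventually (\<lambda>t. inverse t ^ k * exp (- inverse t) = flat k t) (at_right 0)"
    by (auto simp: flat_def eventually_at_filter)
  ultimately have r: "(flat k \<longlongrightarrow> 0) (at_right 0)"
    by (rule Lim_transform_eventually)
  have "eventually (\<lambda>t. 0 = flat k t) (at_left 0)"
    by (auto simp: flat_def eventually_at_filter)
  then have "(flat k \<longlongrightarrow> 0) (at_left 0)"
    using tendsto_const Lim_transform_eventually by blast
  with r show ?thesis
    by (simp add: filterlim_split_at)
qed

lemma flat_DERIV: "(flat k has_real_derivative flat (k + 2) t - real k * flat (k + 1) t) (at t)"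
proof (cases t "0::real" rule: linorder_cases)
  case less
  have "(flat k has_real_derivative 0) (at t)"
    by (rule has_field_derivative_transform_within_open[where S = "{..<0}" and f = "\<lambda>_. 0"])
      (use less in \<open>auto simp: flat_def\<close>)
  with less show ?thesis by (simp add: flat_def)
next
  case equal
  have "(\<lambda>s. (flat k s - flat k 0) / (s - 0)) = flat (k + 1)"
    by (auto simp: flat_def fun_eq_iff field_simps)
  with flat_tendsto_0 equal show ?thesis
    by (simp add: has_field_derivative_iff flat_def)
next
  case greater
  have p: "((\<lambda>t. inverse t ^ k) has_real_derivative - (real k * inverse t ^ (k + 1))) (at t)"
    by (rule DERIV_cong[OF DERIV_power[OF DERIV_inverse]]) (use greater in \<open>cases k; auto\<close>)+
  have "((\<lambda>t. exp (- inverse t)) has_real_derivative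
      exp (- inverse t) * (- (- (inverse t ^ Suc (Suc 0))))) (at t)"
    by (rule DERIV_chain2[OF DERIV_exp DERIV_minus[OF DERIV_inverse]]) (use greater in auto)
  from DERIV_mult[OF p this]
  have "((\<lambda>t. inverse t ^ k * exp (- inverse t)) has_real_derivative
      inverse t ^ (k + 2) * exp (- inverse t) - real k * (inverse t ^ (k + 1) * exp (- inverse t))) (at t)"
    by (rule DERIV_cong) (simp add: algebra_simps)
  then have "(flat k has_real_derivative
      inverse t ^ (k + 2) * exp (- inverse t) - real k * (inverse t ^ (k + 1) * exp (- inverse t))) (at t)"
    by (rule has_field_derivative_transform_within_open[where S = "{0<..}"])
      (use greater in \<open>auto simp: flat_def\<close>)
  with greater show ?thesis by (simp add: flat_def)
qed

lemma flat_affine_Ck: "Ck j (\<lambda>x. flat k (c * x $ i + d))"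
proof (induction j arbitrary: k)
  case 0
  have "continuous_on UNIV (flat k)"
    by (intro continuous_at_imp_continuous_on ballI DERIV_isCont[OF flat_DERIV])
  moreover have "continuous_on UNIV (\<lambda>x::real^2. c * x $ i + d)"
    by (intro continuous_intros)
  ultimately have "continuous_on UNIV (\<lambda>x. flat k (c * x $ i + d))"
    by (rule continuous_on_compose2) simp
  then show ?case by simp
next
  case (Suc j)
  have der: "((\<lambda>x. flat k (c * x $ i + d)) has_derivative
    (\<lambda>v. (flat (k + 2) (c * x $ i + d) - real k * flat (k + 1) (c * x $ i + d)) * (c * v $ i))) (at x)"
    for x :: "real^2"
  proof -
    have "((\<lambda>x::real^2. c * x $ i + d) has_derivative (\<lambda>v. c * v $ i)) (at x)"
      by (auto intro!: derivative_eq_intros bounded_linear_imp_has_derivative)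
    from has_derivative_compose[OF this flat_DERIV[of k, unfolded has_field_derivative_def]]
    show ?thesis .
  qed
  have pd: "pd \<alpha> (\<lambda>x. flat k (c * x $ i + d)) =
    (\<lambda>x. c * axis \<alpha> 1 $ i * (flat (k + 2) (c * x $ i + d) + - real k * flat (k + 1) (c * x $ i + d)))"
    for \<alpha>
    using pd_eqI[OF der] by (auto simp: algebra_simps fun_eq_iff)
  have "Ck j (\<lambda>x. c * axis \<alpha> 1 $ i *
      (flat (k + 2) (c * x $ i + d) + - real k * flat (k + 1) (c * x $ i + d)))" for \<alpha>
    by (intro Ck_mult Ck_add Ck_const Suc)
  then show ?case
    using differentiableI[OF der] by (simp only: pd Ck.simps simp_thms)
qed

definition bump :: "real^2 \<Rightarrow> real^2 \<Rightarrow> nat \<Rightarrow> real^2 \<Rightarrow> real" where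
  "bump a b n x =
     flat 0 (real n * (x $ 1 - a $ 1)) * flat 0 (real n * (b $ 1 - x $ 1)) *
     (flat 0 (real n * (x $ 2 - a $ 2)) * flat 0 (real n * (b $ 2 - x $ 2)))"

lemma mem_box_2: "x \<in> box a b \<longleftrightarrow> a $ 1 < x $ 1 \<and> x $ 1 < b $ 1 \<and> a $ 2 < x $ 2 \<and> x $ 2 < b $ 2"
  for x :: "real^2"
  by (auto simp: mem_box_cart forall_2)

lemma bump_outside: "x \<notin> box a b \<Longrightarrow> bump a b n x = 0"
  by (auto simp: bump_def flat_def mem_box_2 zero_less_mult_iff)

lemma flat_0_bounds: "0 \<le> flat 0 t" "flat 0 t \<le> 1"
  by (auto simp: flat_def)

lemma bump_bounds: "0 \<le> bump a b n x" "bump a b n x \<le> 1"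
  unfolding bump_def by (auto intro!: mult_nonneg_nonneg mult_le_one flat_0_bounds)

lemma bump_test_fun:
  assumes "cbox a b \<subseteq> \<Omega>"
  shows "bump a b n \<in> test_fun \<Omega>"
proof -
  have c: "Ck k (\<lambda>x. flat 0 (real n * (x $ i - c)))" "Ck k (\<lambda>x. flat 0 (real n * (c - x $ i)))" for k c i
    using flat_affine_Ck[of k 0 "real n" i "- (real n * c)"]
      flat_affine_Ck[of k 0 "- real n" i "real n * c"] by (simp_all add: algebra_simps)
  have "Ck k (bump a b n)" for k
    unfolding bump_def[abs_def] by (intro Ck_mult c)
  moreover have "\<forall>x. x \<notin> cbox a b \<longrightarrow> bump a b n x = 0"
    using bump_outside box_subset_cbox by blast
  ultimately show ?thesis
    using assms unfolding test_fun_def by (auto intro!: exI[of _ "cbox a b"])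
qed

lemma bump_tendsto: "(\<lambda>n. bump a b n x) \<longlonglongrightarrow> indicator (box a b) x"
proof (cases "x \<in> box a b")
  case True
  have fl: "(\<lambda>n. flat 0 (real n * s)) \<longlonglongrightarrow> 1" if "s > 0" for s
  proof -
    have "filterlim (\<lambda>n. real n * s) at_top sequentially"
      using filterlim_tendsto_pos_mult_at_top[OF tendsto_const that filterlim_real_sequentially]
      by (simp add: mult.commute)
    then have "(\<lambda>n. exp (- inverse (real n * s))) \<longlonglongrightarrow> exp (- 0)"
      by (intro tendsto_intros tendsto_inverse_0_at_top)
    moreover have "eventually (\<lambda>n. exp (- inverse (real n * s)) = flat 0 (real n * s)) sequentially"
      using eventually_gt_at_top[of 0] by eventually_elim (use that in \<open>auto simp: flat_def\<close>)
    ultimately show ?thesis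
      using Lim_transform_eventually by force
  qed
  have "(\<lambda>n. bump a b n x) \<longlonglongrightarrow> 1 * 1 * (1 * 1)"
    unfolding bump_def using True by (intro tendsto_mult fl) (auto simp: mem_box_2)
  with True show ?thesis by simp
next
  case False
  then show ?thesis by (simp add: bump_outside)
qed

subsection \<open>Mixed second derivatives commute\<close>

text \<open>Two applications of the mean value theorem express the same second difference of \<open>f\<close> over a
  small square through either of the two mixed derivatives, taken at points of the square.\<close>

lemma second_difference:
  fixes f :: "real^2 \<Rightarrow> real" and \<alpha> \<beta> :: 2
  assumes d: "\<And>x. f differentiable (at x)" and d': "\<And>x. pd \<alpha> f differentiable (at x)"
    and "s > 0"
  defines "a \<equiv> axis \<alpha> 1" and "b \<equiv> axis \<beta> 1"
  shows "\<exists>u v. 0 < u \<and> u < s \<and> 0 < v \<and> v < s \<and>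
    f (x + s *\<^sub>R a + s *\<^sub>R b) - f (x + s *\<^sub>R a) - f (x + s *\<^sub>R b) + f x
      = s * s * pd \<beta> (pd \<alpha> f) (x + u *\<^sub>R a + v *\<^sub>R b)"
proof -
  have "\<exists>u>0. u < s \<and> (f (x + s *\<^sub>R b + s *\<^sub>R a) - f (x + s *\<^sub>R a)) - (f (x + s *\<^sub>R b + 0 *\<^sub>R a) - f (x + 0 *\<^sub>R a))
      = (s - 0) * (pd \<alpha> f (x + s *\<^sub>R b + u *\<^sub>R a) - pd \<alpha> f (x + u *\<^sub>R a))"
    unfolding a_def by (rule MVT2) (use \<open>s > 0\<close> in \<open>auto intro!: derivative_intros pd_along_line d\<close>)
  then obtain u where u: "0 < u" "u < s"
    "(f (x + s *\<^sub>R b + s *\<^sub>R a) - f (x + s *\<^sub>R a)) - (f (x + s *\<^sub>R b) - f x)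
      = s * (pd \<alpha> f (x + s *\<^sub>R b + u *\<^sub>R a) - pd \<alpha> f (x + u *\<^sub>R a))"
    by auto
  have "\<exists>v>0. v < s \<and> pd \<alpha> f (x + u *\<^sub>R a + s *\<^sub>R b) - pd \<alpha> f (x + u *\<^sub>R a + 0 *\<^sub>R b)
      = (s - 0) * pd \<beta> (pd \<alpha> f) (x + u *\<^sub>R a + v *\<^sub>R b)"
    unfolding b_def by (rule MVT2) (use \<open>s > 0\<close> in \<open>auto intro!: derivative_intros pd_along_line d'\<close>)
  then obtain v where "0 < v" "v < s" "pd \<alpha> f (x + u *\<^sub>R a + s *\<^sub>R b) - pd \<alpha> f (x + u *\<^sub>R a)
      = s * pd \<beta> (pd \<alpha> f) (x + u *\<^sub>R a + v *\<^sub>R b)"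
    by auto
  then show ?thesis
    using u by (intro exI[of _ u] exI[of _ v]) (simp add: algebra_simps)
qed

lemma pd_commute:
  assumes "Ck 2 f"
  shows "pd \<alpha> (pd \<beta> f) x = pd \<beta> (pd \<alpha> f) x"
proof (rule ccontr)
  have C: "Ck 1 f" "\<And>\<gamma>. Ck 1 (pd \<gamma> f)"
    using assms Ck_Suc_imp[of 1 f] by (auto simp: numeral_2_eq_2)
  have diff: "\<And>x. f differentiable (at x)" "\<And>\<gamma> x. pd \<gamma> f differentiable (at x)"
    and cont: "\<And>\<gamma> \<delta>. continuous_on UNIV (pd \<gamma> (pd \<delta> f))"
    using C by auto
  let ?g = "pd \<alpha> (pd \<beta> f)" and ?k = "pd \<beta> (pd \<alpha> f)"
  assume "?g x \<noteq> ?k x"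
  define e where "e = \<bar>?g x - ?k x\<bar> / 2"
  have "e > 0" using \<open>?g x \<noteq> ?k x\<close> by (simp add: e_def)
  have "continuous (at x) ?g" "continuous (at x) ?k"
    using cont continuous_on_eq_continuous_at by blast+
  then obtain r1 r2 where r: "r1 > 0" "\<And>y. dist y x < r1 \<Longrightarrow> dist (?g y) (?g x) < e"
    "r2 > 0" "\<And>y. dist y x < r2 \<Longrightarrow> dist (?k y) (?k x) < e"
    using \<open>e > 0\<close> unfolding continuous_at_eps_delta by metis
  define s where "s = min r1 r2 / 2"
  have s: "s > 0" "2 * s \<le> r1" "2 * s \<le> r2" using r by (auto simp: s_def)
  obtain u v where uv: "0 < u" "u < s" "0 < v" "v < s"
    "f (x + s *\<^sub>R axis \<alpha> 1 + s *\<^sub>R axis \<beta> 1) - f (x + s *\<^sub>R axis \<alpha> 1) - f (x + s *\<^sub>R axis \<beta> 1) + f x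
      = s * s * ?k (x + u *\<^sub>R axis \<alpha> 1 + v *\<^sub>R axis \<beta> 1)"
    using second_difference[OF diff s(1), where x = x and \<alpha> = \<alpha> and \<beta> = \<beta>] by auto
  obtain u' v' where uv': "0 < u'" "u' < s" "0 < v'" "v' < s"
    "f (x + s *\<^sub>R axis \<beta> 1 + s *\<^sub>R axis \<alpha> 1) - f (x + s *\<^sub>R axis \<beta> 1) - f (x + s *\<^sub>R axis \<alpha> 1) + f x
      = s * s * ?g (x + u' *\<^sub>R axis \<beta> 1 + v' *\<^sub>R axis \<alpha> 1)"
    using second_difference[OF diff s(1), where x = x and \<alpha> = \<beta> and \<beta> = \<alpha>] by auto
  have near: "dist (x + u *\<^sub>R axis \<gamma> 1 + v *\<^sub>R axis \<delta> 1) x < r"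
    if "0 < u" "u < s" "0 < v" "v < s" "2 * s \<le> r" for u v r \<gamma> \<delta>
    using that norm_triangle_ineq[of "u *\<^sub>R axis \<gamma> (1::real)" "v *\<^sub>R axis \<delta> 1"]
    by (simp add: dist_norm add.assoc)
  have "?g (x + u' *\<^sub>R axis \<beta> 1 + v' *\<^sub>R axis \<alpha> 1) = ?k (x + u *\<^sub>R axis \<alpha> 1 + v *\<^sub>R axis \<beta> 1)"
    using uv(5) uv'(5) s(1) by (simp add: algebra_simps)
  moreover have "dist (?g (x + u' *\<^sub>R axis \<beta> 1 + v' *\<^sub>R axis \<alpha> 1)) (?g x) < e"
    "dist (?k (x + u *\<^sub>R axis \<alpha> 1 + v *\<^sub>R axis \<beta> 1)) (?k x) < e"
    using uv uv' s by (auto intro!: r near)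
  ultimately have "\<bar>?g x - ?k x\<bar> < e + e"
    unfolding dist_real_def by linarith
  then show False
    by (simp add: e_def)
qed

subsection \<open>Integration by parts for test functions\<close>

lemma compact_support_bounded:
  fixes f :: "real^2 \<Rightarrow> real"
  assumes "continuous_on UNIV f" "compact S" "\<And>x. x \<notin> S \<Longrightarrow> f x = 0"
  obtains C where "\<And>x. \<bar>f x\<bar> \<le> C"
proof -
  have "bounded (f ` S)"
    using compact_continuous_image[OF continuous_on_subset[OF assms(1)] assms(2)] compact_imp_bounded
    by simp
  then obtain C where C: "\<And>x. x \<in> S \<Longrightarrow> \<bar>f x\<bar> \<le> C"
    by (auto simp: bounded_iff)
  have "\<bar>f x\<bar> \<le> max C 0" for x
    using assms(3)[of x] C[of x] by (cases "x \<in> S") auto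
  then show ?thesis using that by blast
qed

lemma compact_support_integrable:
  fixes f :: "real^2 \<Rightarrow> real"
  assumes "continuous_on UNIV f" "compact S" "\<And>x. x \<notin> S \<Longrightarrow> f x = 0"
  shows "integrable lborel f"
proof -
  have "integrable lborel (\<lambda>x. indicator S x *\<^sub>R f x)"
    using borel_integrable_compact[OF assms(2) continuous_on_subset[OF assms(1)]] by simp
  also have "(\<lambda>x. indicator S x *\<^sub>R f x) = f"
    using assms by (auto simp: indicator_def fun_eq_iff)
  finally show ?thesis .
qed

text \<open>The integral of a difference quotient vanishes by translation invariance, and difference
  quotients of \<open>f\<close> converge boundedly to the derivative.\<close>

lemma integral_pd_eq_0:
  fixes f :: "real^2 \<Rightarrow> real"
  assumes C: "Ck 1 f" and S: "compact S" "\<And>x. x \<notin> S \<Longrightarrow> f x = 0"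
  shows "integral\<^sup>L lborel (pd \<alpha> f) = 0"
proof -
  let ?e = "axis \<alpha> 1 :: real^2"
  have diff: "\<And>x. f differentiable (at x)" and cont: "continuous_on UNIV (pd \<alpha> f)"
    using C by auto
  have contf: "continuous_on UNIV f"
    using C Ck_0 by blast
  have pd0: "\<And>x. x \<notin> S \<Longrightarrow> pd \<alpha> f x = 0"
    using pd_outside_support S compact_imp_closed by blast
  obtain C where Cb: "\<And>x. \<bar>pd \<alpha> f x\<bar> \<le> C"
    using compact_support_bounded[OF cont S(1) pd0] by blast
  obtain R where R: "\<And>x. x \<in> S \<Longrightarrow> norm x \<le> R"
    using S compact_imp_bounded bounded_iff by metis
  define q where "q n x = real (Suc n) * (f (x + (1 / real (Suc n)) *\<^sub>R ?e) - f x)" for n x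
  have lip: "\<bar>f (x + s *\<^sub>R ?e) - f x\<bar> \<le> s * C" if "s > 0" for x s
  proof -
    have "\<exists>z>0. z < s \<and> f (x + s *\<^sub>R ?e) - f (x + 0 *\<^sub>R ?e) = (s - 0) * pd \<alpha> f (x + z *\<^sub>R ?e)"
      by (rule MVT2) (use that in \<open>auto intro!: pd_along_line diff\<close>)
    then show ?thesis
      using Cb that by (auto simp: abs_mult)
  qed
  have qb: "\<bar>q n x\<bar> \<le> C" for n x
  proof -
    have "\<bar>f (x + (1 / real (Suc n)) *\<^sub>R ?e) - f x\<bar> \<le> C / real (Suc n)"
      using lip[of "1 / real (Suc n)" x] by simp
    then show ?thesis
      unfolding q_def abs_mult by (simp only: abs_of_nat pos_le_divide_eq of_nat_0_less_iff zero_less_Suc mult.commute)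
  qed
  have q0: "q n x = 0" if "x \<notin> cball 0 (R + 1)" for n x
  proof -
    have "norm x > R + 1" using that by auto
    moreover have "norm ((1 / real (Suc n)) *\<^sub>R ?e) \<le> 1"
      by simp
    ultimately have "norm (x + (1 / real (Suc n)) *\<^sub>R ?e) > R" "norm x > R"
      using norm_diff_ineq[of x "(1 / real (Suc n)) *\<^sub>R ?e"] by linarith+
    then have "x + (1 / real (Suc n)) *\<^sub>R ?e \<notin> S" "x \<notin> S"
      using R by force+
    then show ?thesis
      using S by (simp add: q_def)
  qed
  have "(\<lambda>n. integral\<^sup>L lborel (q n)) \<longlonglongrightarrow> integral\<^sup>L lborel (pd \<alpha> f)"
  proof (rule integral_dominated_convergence)
    show "pd \<alpha> f \<in> borel_measurable lborel"
      using cont by (simp add: borel_measurable_continuous_onI)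
    show "q n \<in> borel_measurable lborel" for n
    proof -
      have [measurable]: "f \<in> borel_measurable borel"
        using contf by (rule borel_measurable_continuous_onI)
      show ?thesis
        unfolding q_def[abs_def] by measurable
    qed
    show "integrable lborel (\<lambda>x::real^2. C * indicator (cball 0 (R + 1)) x :: real)"
      by (intro integrable_mult_right integrable_real_indicator) (use emeasure_bounded_finite[of "cball (0::real^2) (R + 1)"] in auto)
    show "AE x in lborel. norm (q n x) \<le> C * indicator (cball 0 (R + 1)) x" for n
      using q0 qb by (auto simp: indicator_def)
    have "(\<lambda>n. q n x) \<longlonglongrightarrow> pd \<alpha> f x" for x
    proof -
      have "((\<lambda>t. (f (x + t *\<^sub>R ?e) - f x) / t) \<longlongrightarrow> pd \<alpha> f x) (at 0)"
        using pd_along_line[OF diff, of x \<alpha> 0] by (simp add: has_field_derivative_iff)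
      moreover have "filterlim (\<lambda>n. 1 / real (Suc n)) (at 0) sequentially"
        using LIMSEQ_inverse_real_of_nat
        by (auto simp: filterlim_at inverse_eq_divide)
      ultimately have "(\<lambda>n. (f (x + (1 / real (Suc n)) *\<^sub>R ?e) - f x) / (1 / real (Suc n))) \<longlonglongrightarrow> pd \<alpha> f x"
        using filterlim_compose by fast
      then show ?thesis
        by (simp add: q_def mult.commute)
    qed
    then show "AE x in lborel. (\<lambda>n. q n x) \<longlonglongrightarrow> pd \<alpha> f x"
      by simp
  qed
  moreover have "integral\<^sup>L lborel (q n) = 0" for n
  proof -
    let ?s = "(1 / real (Suc n)) *\<^sub>R ?e"
    have i: "integrable lborel f"
      using compact_support_integrable contf S by blast
    have sh: "integral\<^sup>L lborel (\<lambda>x. f (x + ?s)) = integral\<^sup>L lborel f"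
    proof -
      have "integral\<^sup>L lborel f = integral\<^sup>L (distr lborel borel (\<lambda>x. ?s + x)) f"
        by (metis lborel_distr_plus)
      also have "\<dots> = integral\<^sup>L lborel (\<lambda>x. f (?s + x))"
        by (rule integral_distr) (auto intro: borel_measurable_continuous_onI contf)
      finally show ?thesis by (simp add: add.commute)
    qed
    have i': "integrable lborel (\<lambda>x. f (x + ?s))"
    proof (rule compact_support_integrable)
      show "continuous_on UNIV (\<lambda>x. f (x + ?s))"
        by (intro continuous_on_compose2[OF contf] continuous_intros) auto
      show "compact ((\<lambda>x. x - ?s) ` S)"
        using S by (intro compact_continuous_image continuous_intros)
      show "f (x + ?s) = 0" if "x \<notin> (\<lambda>x. x - ?s) ` S" for x
        using that S(2)[of "x + ?s"] by force
    qed
    show ?thesis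
      unfolding q_def using i i' sh by simp
  qed
  ultimately have "(\<lambda>n. 0) \<longlonglongrightarrow> integral\<^sup>L lborel (pd \<alpha> f)"
    by simp
  then show ?thesis
    by (simp add: LIMSEQ_const_iff)
qed

lemma test_fun_integrable:
  assumes "\<phi> \<in> test_fun \<Omega>"
  shows "integrable lborel \<phi>"
proof -
  obtain S where "compact S" "\<forall>x. x \<notin> S \<longrightarrow> \<phi> x = 0"
    using test_fun_support[OF assms] by blast
  then show ?thesis
    by (intro compact_support_integrable[OF test_fun_continuous[OF assms]]) auto
qed

text \<open>A test function vanishes off \<open>\<Omega>\<close>, so integrals over \<open>\<Omega>\<close> and over the plane agree.\<close>

lemma test_fun_integral_lebesgue_on:
  assumes "\<phi> \<in> test_fun \<Omega>" "open \<Omega>"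
  shows "integrable (lebesgue_on \<Omega>) \<phi>" "integral\<^sup>L (lebesgue_on \<Omega>) \<phi> = integral\<^sup>L lborel \<phi>"
proof -
  obtain S where "S \<subseteq> \<Omega>" "\<forall>x. x \<notin> S \<longrightarrow> \<phi> x = 0"
    using test_fun_support[OF assms(1)] by blast
  then have z: "\<And>x. x \<notin> \<Omega> \<Longrightarrow> \<phi> x = 0"
    by blast
  have m: "\<phi> \<in> borel_measurable borel"
    using assms by (simp add: borel_measurable_continuous_onI test_fun_continuous)
  have O: "\<Omega> \<inter> space lebesgue \<in> sets lebesgue"
    using assms by simp
  have eq: "(\<lambda>x. indicator \<Omega> x * \<phi> x) = \<phi>"
    using z by (auto simp: indicator_def fun_eq_iff)
  have "integrable lebesgue \<phi>"
    using test_fun_integrable[OF assms(1)] m by (simp add: integrable_completion)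
  then show "integrable (lebesgue_on \<Omega>) \<phi>"
    using integrable_restrict_space[OF O, of \<phi>] by (simp add: eq)
  have "integral\<^sup>L (lebesgue_on \<Omega>) \<phi> = integral\<^sup>L lebesgue \<phi>"
    using integral_restrict_space[OF O, of \<phi>] by (simp add: eq)
  then show "integral\<^sup>L (lebesgue_on \<Omega>) \<phi> = integral\<^sup>L lborel \<phi>"
    using m by (simp add: integral_completion)
qed

lemma test_fun_integral_by_parts:
  assumes "open \<Omega>" "\<phi> \<in> test_fun \<Omega>" "\<psi> \<in> test_fun \<Omega>"
  shows "(\<integral>x. \<phi> x * pd \<alpha> \<psi> x \<partial>lebesgue_on \<Omega>) = - (\<integral>x. pd \<alpha> \<phi> x * \<psi> x \<partial>lebesgue_on \<Omega>)"
proof -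
  have prod: "(\<lambda>x. \<phi> x * \<psi> x) \<in> test_fun \<Omega>" "(\<lambda>x. \<phi> x * pd \<alpha> \<psi> x) \<in> test_fun \<Omega>"
      "(\<lambda>x. pd \<alpha> \<phi> x * \<psi> x) \<in> test_fun \<Omega>"
    by (intro test_fun_mult test_fun_pd test_fun_smooth[OF assms(3)]
        test_fun_smooth[OF test_fun_pd[OF assms(3)]] assms(2))+
  have pd: "pd \<alpha> (\<lambda>x. \<phi> x * \<psi> x) = (\<lambda>x. \<phi> x * pd \<alpha> \<psi> x + pd \<alpha> \<phi> x * \<psi> x)"
    using pd_mult assms test_fun_differentiable by (intro ext) blast
  obtain S where S: "compact S" "\<forall>x. x \<notin> S \<longrightarrow> \<phi> x * \<psi> x = 0"
    using test_fun_support[OF prod(1)] by blast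
  have "0 = integral\<^sup>L lborel (pd \<alpha> (\<lambda>x. \<phi> x * \<psi> x))"
    using integral_pd_eq_0[OF test_fun_smooth[OF prod(1)] S(1)] S(2) by simp
  also have "\<dots> = (\<integral>x. \<phi> x * pd \<alpha> \<psi> x \<partial>lborel) + (\<integral>x. pd \<alpha> \<phi> x * \<psi> x \<partial>lborel)"
    unfolding pd by (intro Bochner_Integration.integral_add test_fun_integrable[OF prod(2)] test_fun_integrable[OF prod(3)])
  finally show ?thesis
    using test_fun_integral_lebesgue_on(2)[OF prod(2) assms(1)]
      test_fun_integral_lebesgue_on(2)[OF prod(3) assms(1)] by simp
qed

section \<open>The space of square integrable functions\<close>

lemma abs_mult_le_squares: "\<bar>a * b\<bar> \<le> a\<^sup>2 + b\<^sup>2" for a b :: real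
proof -
  have "2 * (\<bar>a\<bar> * \<bar>b\<bar>) \<le> a\<^sup>2 + b\<^sup>2"
    using sum_squares_bound[of "\<bar>a\<bar>" "\<bar>b\<bar>"] by (simp add: mult.assoc)
  moreover have "0 \<le> \<bar>a\<bar> * \<bar>b\<bar>" by simp
  ultimately show ?thesis unfolding abs_mult by linarith
qed

lemma square_add_le: "(a + b)\<^sup>2 \<le> 2 * a\<^sup>2 + 2 * b\<^sup>2" for a b :: real
  using sum_squares_bound[of a b] by (simp add: power2_sum)

lemma borel_measurable_vec_iff:
  fixes f :: "'a \<Rightarrow> 'b::euclidean_space^'n"
  shows "f \<in> borel_measurable M \<longleftrightarrow> (\<forall>i. (\<lambda>x. f x $ i) \<in> borel_measurable M)"
proof
  assume f: "f \<in> borel_measurable M"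
  show "\<forall>i. (\<lambda>x. f x $ i) \<in> borel_measurable M"
    by (intro allI measurable_compose[OF f] borel_measurable_continuous_onI continuous_intros)
next
  assume f: "\<forall>i. (\<lambda>x. f x $ i) \<in> borel_measurable M"
  have "(\<lambda>x. f x \<bullet> b) \<in> borel_measurable M" for b
    using f unfolding inner_vec_def by (intro borel_measurable_sum borel_measurable_inner) auto
  then show "f \<in> borel_measurable M"
    using borel_measurable_euclidean_space by blast
qed

locale bounded_open =
  fixes \<Omega> :: "(real^2) set"
  assumes open_dom: "open \<Omega>" and bounded_dom: "bounded \<Omega>"
begin

abbreviation \<mu> :: "(real^2) measure" where "\<mu> \<equiv> lebesgue_on \<Omega>"

abbreviation \<T> :: "(real^2 \<Rightarrow> real) set" where "\<T> \<equiv> test_fun \<Omega>"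
abbreviation \<L> :: "(real^2 \<Rightarrow> 'b::euclidean_space) set" where "\<L> \<equiv> L2 \<Omega>"
abbreviation L2_to :: "(nat \<Rightarrow> real^2 \<Rightarrow> real) \<Rightarrow> (real^2 \<Rightarrow> real) \<Rightarrow> bool" where "L2_to \<equiv> L2_lim \<Omega>"
abbreviation weak_pd :: "2 \<Rightarrow> (real^2 \<Rightarrow> real) \<Rightarrow> (real^2 \<Rightarrow> real) \<Rightarrow> bool" where "weak_pd \<equiv> has_weak_pd \<Omega>"
abbreviation wd :: "2 \<Rightarrow> (real^2 \<Rightarrow> real) \<Rightarrow> real^2 \<Rightarrow> real" where "wd \<equiv> wpd \<Omega>"
abbreviation wd2 :: "2 \<Rightarrow> 2 \<Rightarrow> (real^2 \<Rightarrow> real) \<Rightarrow> real^2 \<Rightarrow> real" where "wd2 \<equiv> wpd2 \<Omega>"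
abbreviation W1 :: "(real^2 \<Rightarrow> real) set" where "W1 \<equiv> W12 \<Omega>"
abbreviation W2 :: "(real^2 \<Rightarrow> real) set" where "W2 \<equiv> W22 \<Omega>"
abbreviation W1\<^sub>0 :: "(real^2 \<Rightarrow> real) set" where "W1\<^sub>0 \<equiv> W12_0 \<Omega>"
abbreviation W2\<^sub>0 :: "(real^2 \<Rightarrow> real) set" where "W2\<^sub>0 \<equiv> W22_0 \<Omega>"
abbreviation \<U> :: "displacement set" where "\<U> \<equiv> U_space \<Omega>"

lemma dom_sets [simp, measurable]: "\<Omega> \<in> sets lebesgue" "\<Omega> \<inter> space lebesgue \<in> sets lebesgue"
  using open_dom by auto

lemma finite_dom: "emeasure \<mu> (space \<mu>) < \<infinity>"
  using emeasure_bounded_finite[OF bounded_dom] open_dom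
  by (simp add: emeasure_restrict_space)

sublocale dom: finite_measure \<mu>
  by (rule finite_measureI) (use finite_dom in auto)

lemma L2_iff: "f \<in> \<L> \<longleftrightarrow> f \<in> borel_measurable \<mu> \<and> integrable \<mu> (\<lambda>x. (f x)\<^sup>2)"
  for f :: "real^2 \<Rightarrow> real"
  by (simp add: L2_def)

lemma L2_measurable [measurable_dest]: "f \<in> \<L> \<Longrightarrow> f \<in> borel_measurable \<mu>"
  by (simp add: L2_def)

lemma L2_square_integrable: "f \<in> \<L> \<Longrightarrow> integrable \<mu> (\<lambda>x. (f x)\<^sup>2)"
  for f :: "real^2 \<Rightarrow> real"
  by (simp add: L2_iff)

lemma L2_field_lincomb:
  fixes f g :: "real^2 \<Rightarrow> 'b::euclidean_space"
  assumes f: "f \<in> \<L>" and g: "g \<in> \<L>"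
  shows "(\<lambda>x. f x + c *\<^sub>R g x) \<in> \<L>"
proof -
  have [measurable]: "f \<in> borel_measurable \<mu>" "g \<in> borel_measurable \<mu>"
    using f g L2_measurable by auto
  have "integrable \<mu> (\<lambda>x. (norm (f x + c *\<^sub>R g x))\<^sup>2)"
  proof (rule Bochner_Integration.integrable_bound)
    show "integrable \<mu> (\<lambda>x. 2 * (norm (f x))\<^sup>2 + 2 * (c\<^sup>2 * (norm (g x))\<^sup>2))"
      using f g by (simp add: L2_def)
    have "(norm (f x + c *\<^sub>R g x))\<^sup>2 \<le> 2 * (norm (f x))\<^sup>2 + 2 * (c\<^sup>2 * (norm (g x))\<^sup>2)" for x
    proof -
      have "(norm (f x + c *\<^sub>R g x))\<^sup>2 \<le> (norm (f x) + norm (c *\<^sub>R g x))\<^sup>2"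
        by (intro power_mono norm_triangle_ineq) auto
      also have "\<dots> \<le> 2 * (norm (f x))\<^sup>2 + 2 * (c\<^sup>2 * (norm (g x))\<^sup>2)"
        using square_add_le[of "norm (f x)" "norm (c *\<^sub>R g x)"] by (simp add: power_mult_distrib)
      finally show ?thesis .
    qed
    then show "AE x in \<mu>. norm ((norm (f x + c *\<^sub>R g x))\<^sup>2)
        \<le> norm (2 * (norm (f x))\<^sup>2 + 2 * (c\<^sup>2 * (norm (g x))\<^sup>2))"
      by auto
  qed measurable
  then show ?thesis by (simp add: L2_def)
qed

lemma inner_field_integrable:
  fixes f g :: "real^2 \<Rightarrow> 'b::euclidean_space"
  assumes f: "f \<in> \<L>" and g: "g \<in> \<L>"
  shows "integrable \<mu> (\<lambda>x. f x \<bullet> g x)"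
proof (rule Bochner_Integration.integrable_bound)
  show "integrable \<mu> (\<lambda>x. (norm (f x))\<^sup>2 + (norm (g x))\<^sup>2)"
    using f g by (simp add: L2_def)
  show "(\<lambda>x. f x \<bullet> g x) \<in> borel_measurable \<mu>"
    using f g L2_measurable by (intro borel_measurable_inner) auto
  have "\<bar>f x \<bullet> g x\<bar> \<le> (norm (f x))\<^sup>2 + (norm (g x))\<^sup>2" for x
    using Cauchy_Schwarz_ineq2[of "f x" "g x"] abs_mult_le_squares[of "norm (f x)" "norm (g x)"] by simp
  then show "AE x in \<mu>. norm (f x \<bullet> g x) \<le> norm ((norm (f x))\<^sup>2 + (norm (g x))\<^sup>2)"
    by auto
qed

lemma norm_square_integrable: "f \<in> \<L> \<Longrightarrow> integrable \<mu> (\<lambda>x. (norm (f x))\<^sup>2)"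
  by (simp add: L2_def)

lemma L2_zero: "(\<lambda>x. 0 :: 'b::euclidean_space) \<in> \<L>"
  by (simp add: L2_def)

lemma L2_mult_integrable [intro]: "f \<in> \<L> \<Longrightarrow> g \<in> \<L> \<Longrightarrow> integrable \<mu> (\<lambda>x. f x * g x :: real)"
  using inner_field_integrable[of f g] by (simp add: inner_real_def)

lemma L2_lincomb: "f \<in> \<L> \<Longrightarrow> g \<in> \<L> \<Longrightarrow> (\<lambda>x. f x + c * g x :: real) \<in> \<L>"
  using L2_field_lincomb[of f g c] by simp

lemma L2_cmult: "f \<in> \<L> \<Longrightarrow> (\<lambda>x. c * f x :: real) \<in> \<L>"
  using L2_lincomb[OF L2_zero] by simp

lemma L2_add: "f \<in> \<L> \<Longrightarrow> g \<in> \<L> \<Longrightarrow> (\<lambda>x. f x + g x :: real) \<in> \<L>"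
  using L2_lincomb[of f g 1] by simp

lemma L2_diff: "f \<in> \<L> \<Longrightarrow> g \<in> \<L> \<Longrightarrow> (\<lambda>x. f x - g x :: real) \<in> \<L>"
  using L2_lincomb[of f g "- 1"] by simp

lemma L2_sum: "(\<And>i. i \<in> I \<Longrightarrow> f i \<in> \<L>) \<Longrightarrow> (\<lambda>x. \<Sum>i\<in>I. f i x :: real) \<in> \<L>"
  by (induction I rule: infinite_finite_induct) (auto simp: L2_zero intro!: L2_add)

lemma L2_vec_iff:
  fixes f :: "real^2 \<Rightarrow> 'b::euclidean_space^'n"
  shows "f \<in> \<L> \<longleftrightarrow> (\<forall>i. (\<lambda>x. f x $ i) \<in> \<L>)"
proof
  assume f: "f \<in> \<L>"
  show "\<forall>i. (\<lambda>x. f x $ i) \<in> \<L>"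
  proof
    fix i
    have m: "(\<lambda>x. f x $ i) \<in> borel_measurable \<mu>"
      using L2_measurable[OF f] by (simp add: borel_measurable_vec_iff)
    have "integrable \<mu> (\<lambda>x. (norm (f x $ i))\<^sup>2)"
    proof (rule Bochner_Integration.integrable_bound)
      show "integrable \<mu> (\<lambda>x. (norm (f x))\<^sup>2)"
        using f by (simp add: L2_def)
      show "AE x in \<mu>. norm ((norm (f x $ i))\<^sup>2) \<le> norm ((norm (f x))\<^sup>2)"
        by (auto intro!: power_mono Finite_Cartesian_Product.norm_nth_le)
    qed (use m in measurable)
    with m show "(\<lambda>x. f x $ i) \<in> \<L>" by (simp add: L2_def)
  qed
next
  assume f: "\<forall>i. (\<lambda>x. f x $ i) \<in> \<L>"
  then have m: "f \<in> borel_measurable \<mu>"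
    using L2_measurable by (auto simp: borel_measurable_vec_iff)
  have "(norm (f x))\<^sup>2 = (\<Sum>i\<in>UNIV. (norm (f x $ i))\<^sup>2)" for x
    by (simp add: norm_vec_def L2_set_def sum_nonneg)
  moreover have "integrable \<mu> (\<lambda>x. \<Sum>i\<in>UNIV. (norm (f x $ i))\<^sup>2)"
    using f by (intro Bochner_Integration.integrable_sum) (auto simp: L2_def)
  ultimately show "f \<in> \<L>"
    using m by (simp add: L2_def)
qed

text \<open>The Cauchy-Schwarz inequality, from the quadratic polynomial \<open>\<integral> (f + c g)\<^sup>2 \<ge> 0\<close> in \<open>c\<close>.\<close>

lemma L2_Cauchy_Schwarz:
  fixes f g :: "real^2 \<Rightarrow> real"
  assumes f: "f \<in> \<L>" and g: "g \<in> \<L>"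
  shows "(\<integral>x. f x * g x \<partial>\<mu>)\<^sup>2
    \<le> (\<integral>x. (f x)\<^sup>2 \<partial>\<mu>) * (\<integral>x. (g x)\<^sup>2 \<partial>\<mu>)"
proof -
  define A where "A = (\<integral>x. (f x)\<^sup>2 \<partial>\<mu>)"
  define B where "B = (\<integral>x. (g x)\<^sup>2 \<partial>\<mu>)"
  define D where "D = (\<integral>x. f x * g x \<partial>\<mu>)"
  have q: "0 \<le> A + 2 * c * D + c\<^sup>2 * B" for c
  proof -
    have "0 \<le> (\<integral>x. (f x + c * g x)\<^sup>2 \<partial>\<mu>)"
      by simp
    also have "\<dots> = (\<integral>x. (f x)\<^sup>2 + 2 * c * (f x * g x) + c\<^sup>2 * (g x)\<^sup>2 \<partial>\<mu>)"
      by (intro Bochner_Integration.integral_cong) (auto simp: power2_eq_square algebra_simps)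
    also have "\<dots> = A + 2 * c * D + c\<^sup>2 * B"
      using f g L2_square_integrable by (simp add: A_def B_def D_def L2_mult_integrable)
    finally show ?thesis .
  qed
  have "B \<ge> 0" by (simp add: B_def)
  have "D\<^sup>2 \<le> A * B"
  proof (cases "B = 0")
    case True
    have "D = 0"
    proof (rule ccontr)
      assume "D \<noteq> 0"
      then show False
        using q[of "- (A + 1) / (2 * D)"] True by (simp add: field_simps)
    qed
    with True show ?thesis by simp
  next
    case False
    with \<open>B \<ge> 0\<close> have "B > 0" by simp
    have "0 \<le> B * (A + 2 * (- D / B) * D + (- D / B)\<^sup>2 * B)"
      by (rule mult_nonneg_nonneg[OF less_imp_le[OF \<open>B > 0\<close>] q])
    also have "\<dots> = A * B - D\<^sup>2"
      using \<open>B > 0\<close> by (simp add: field_simps power2_eq_square)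
    finally show ?thesis by simp
  qed
  then show ?thesis by (simp add: A_def B_def D_def)
qed

lemma L2_lim_inner:
  assumes F: "\<And>n. F n \<in> \<L>" and f: "f \<in> \<L>" and g: "g \<in> \<L>" and lim: "L2_to F f"
  shows "(\<lambda>n. \<integral>x. F n x * g x \<partial>\<mu>) \<longlonglongrightarrow> (\<integral>x. f x * g x \<partial>\<mu>)"
proof -
  let ?B = "\<integral>x. (g x)\<^sup>2 \<partial>\<mu>"
  have "(\<lambda>n. ((\<integral>x. F n x * g x \<partial>\<mu>) - (\<integral>x. f x * g x \<partial>\<mu>))\<^sup>2) \<longlonglongrightarrow> 0"
  proof (rule tendsto_sandwich[OF _ _ tendsto_const])
    have "(\<lambda>n. (\<integral>x. (F n x - f x)\<^sup>2 \<partial>\<mu>) * ?B) \<longlonglongrightarrow> 0 * ?B"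
      using lim unfolding L2_lim_def by (intro tendsto_intros)
    then show "(\<lambda>n. (\<integral>x. (F n x - f x)\<^sup>2 \<partial>\<mu>) * ?B) \<longlonglongrightarrow> 0"
      by simp
    have "((\<integral>x. F n x * g x \<partial>\<mu>) - (\<integral>x. f x * g x \<partial>\<mu>))\<^sup>2
        \<le> (\<integral>x. (F n x - f x)\<^sup>2 \<partial>\<mu>) * ?B" for n
      using L2_Cauchy_Schwarz[OF L2_diff[OF F f] g, of n] F f g
      by (simp add: left_diff_distrib L2_mult_integrable)
    then show "eventually (\<lambda>n. ((\<integral>x. F n x * g x \<partial>\<mu>) - (\<integral>x. f x * g x \<partial>\<mu>))\<^sup>2
        \<le> (\<integral>x. (F n x - f x)\<^sup>2 \<partial>\<mu>) * ?B) sequentially"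
      by simp
  qed simp
  then have "(\<lambda>n. (\<integral>x. F n x * g x \<partial>\<mu>) - (\<integral>x. f x * g x \<partial>\<mu>)) \<longlonglongrightarrow> 0"
    by (simp add: tendsto_null_power)
  then show ?thesis by (simp add: LIM_zero_iff)
qed

lemma L2_lim_lincomb:
  assumes F: "\<And>n. F n \<in> \<L>" "f \<in> \<L>" "L2_to F f"
    and G: "\<And>n. G n \<in> \<L>" "g \<in> \<L>" "L2_to G g"
    and h: "AE x in \<mu>. h x = f x + c * g x" "h \<in> \<L>"
  shows "L2_to (\<lambda>n x. F n x + c * G n x) h"
  unfolding L2_lim_def
proof (rule tendsto_sandwich[OF _ _ tendsto_const])
  have "(\<lambda>n. 2 * (\<integral>x. (F n x - f x)\<^sup>2 \<partial>\<mu>) + 2 * c\<^sup>2 * (\<integral>x. (G n x - g x)\<^sup>2 \<partial>\<mu>))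
      \<longlonglongrightarrow> 2 * 0 + 2 * c\<^sup>2 * 0"
    using F G unfolding L2_lim_def by (intro tendsto_intros)
  then show "(\<lambda>n. 2 * (\<integral>x. (F n x - f x)\<^sup>2 \<partial>\<mu>) + 2 * c\<^sup>2 * (\<integral>x. (G n x - g x)\<^sup>2 \<partial>\<mu>))
      \<longlonglongrightarrow> 0" by simp
  have "(\<integral>x. (F n x + c * G n x - h x)\<^sup>2 \<partial>\<mu>)
      \<le> (\<integral>x. 2 * (F n x - f x)\<^sup>2 + 2 * c\<^sup>2 * (G n x - g x)\<^sup>2 \<partial>\<mu>)" for n
  proof (rule integral_mono_AE)
    show "integrable \<mu> (\<lambda>x. (F n x + c * G n x - h x)\<^sup>2)"
      using F G h by (intro L2_square_integrable L2_diff L2_lincomb)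
    show "integrable \<mu> (\<lambda>x. 2 * (F n x - f x)\<^sup>2 + 2 * c\<^sup>2 * (G n x - g x)\<^sup>2)"
      using F G by (intro Bochner_Integration.integrable_add integrable_mult_right L2_square_integrable L2_diff)
    show "AE x in \<mu>. (F n x + c * G n x - h x)\<^sup>2
        \<le> 2 * (F n x - f x)\<^sup>2 + 2 * c\<^sup>2 * (G n x - g x)\<^sup>2"
      using h(1)
    proof eventually_elim
      case (elim x)
      have "F n x + c * G n x - h x = (F n x - f x) + c * (G n x - g x)"
        by (simp add: elim algebra_simps)
      then show ?case
        using square_add_le[of "F n x - f x" "c * (G n x - g x)"]
        by (simp only: power_mult_distrib mult.assoc)
    qed
  qed
  also have "\<dots> n = 2 * (\<integral>x. (F n x - f x)\<^sup>2 \<partial>\<mu>) + 2 * c\<^sup>2 * (\<integral>x. (G n x - g x)\<^sup>2 \<partial>\<mu>)"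
    for n
    by (subst Bochner_Integration.integral_add) (use F G in \<open>auto intro!: integrable_mult_right L2_square_integrable L2_diff\<close>)
  finally show "eventually (\<lambda>n. (\<integral>x. (F n x + c * G n x - h x)\<^sup>2 \<partial>\<mu>)
      \<le> 2 * (\<integral>x. (F n x - f x)\<^sup>2 \<partial>\<mu>) + 2 * c\<^sup>2 * (\<integral>x. (G n x - g x)\<^sup>2 \<partial>\<mu>)) sequentially"
    by simp
qed simp

lemma L2_lim_const_AE:
  assumes "AE x in \<mu>. f x = F x" "f \<in> \<L>" "F \<in> \<L>"
  shows "L2_to (\<lambda>n. F) f"
proof -
  have "(\<integral>x. (F x - f x)\<^sup>2 \<partial>\<mu>) = 0"
    by (rule integral_eq_zero_AE) (use assms in auto)
  then show ?thesis by (simp add: L2_lim_def)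
qed

lemma test_fun_L2:
  assumes "\<phi> \<in> \<T>"
  shows "\<phi> \<in> \<L>"
proof -
  have "(\<lambda>x. \<phi> x * \<phi> x) \<in> \<T>"
    using test_fun_mult[OF assms(1) test_fun_smooth[OF assms(1)]] .
  then have "integrable \<mu> (\<lambda>x. \<phi> x * \<phi> x)"
    using test_fun_integral_lebesgue_on open_dom by blast
  moreover have "\<phi> \<in> borel_measurable \<mu>"
    using test_fun_integral_lebesgue_on[OF assms open_dom] by (simp add: borel_measurable_integrable)
  ultimately show ?thesis by (simp add: L2_iff power2_eq_square)
qed

lemma L2_integrable: "f \<in> \<L> \<Longrightarrow> integrable \<mu> f" for f :: "real^2 \<Rightarrow> real"
  using L2_mult_integrable[of f "\<lambda>_. 1"] by (simp add: L2_iff)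

section \<open>Weak derivatives\<close>

text \<open>The bumps of a box converge to its indicator function, so a function that annihilates all test
  functions has vanishing mean over every box inside the domain. By Lebesgue differentiation the
  function is the limit of such means almost everywhere.\<close>

lemma fundamental_lemma:
  assumes g: "g \<in> \<L>" and orth: "\<And>\<phi>. \<phi> \<in> \<T> \<Longrightarrow> (\<integral>x. g x * \<phi> x \<partial>\<mu>) = 0"
  shows "AE x in \<mu>. g x = 0"
proof -
  define f where "f x = (if x \<in> \<Omega> then g x else 0)" for x
  have gi: "integrable \<mu> g" using g by (rule L2_integrable)
  have "integrable lebesgue (\<lambda>x. indicator \<Omega> x *\<^sub>R g x)"
    using gi integrable_restrict_space[of \<Omega> lebesgue g] by simp
  moreover have "(\<lambda>x. indicator \<Omega> x *\<^sub>R g x) = f"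
    by (auto simp: f_def)
  ultimately have fi: "integrable lebesgue f" by simp
  have fint: "f integrable_on cbox a b" for a b
    using integrable_on_lebesgue[OF fi] integrable_on_subcbox by blast
  have box0: "integral (cbox a b) f = 0" if sub: "cbox a b \<subseteq> \<Omega>" for a b
  proof -
    have "(\<lambda>n. \<integral>x. g x * bump a b n x \<partial>\<mu>) \<longlonglongrightarrow> (\<integral>x. g x * indicator (box a b) x \<partial>\<mu>)"
    proof (rule integral_dominated_convergence)
      show "integrable \<mu> (\<lambda>x. \<bar>g x\<bar>)" using gi by simp
      show "AE x in \<mu>. norm (g x * bump a b n x) \<le> \<bar>g x\<bar>" for n
        using bump_bounds[of a b n] by (auto simp: abs_mult intro!: mult_left_le)
      show "AE x in \<mu>. (\<lambda>n. g x * bump a b n x) \<longlonglongrightarrow> g x * indicator (box a b) x"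
        by (auto intro!: tendsto_mult bump_tendsto)
      show "(\<lambda>x. g x * indicator (box a b) x) \<in> borel_measurable \<mu>"
      proof (rule borel_measurable_times)
        show "indicator (box a b) \<in> borel_measurable \<mu>"
          by (intro measurable_restrict_space1 borel_measurable_indicator) auto
      qed (use gi in simp)
      show "(\<lambda>x. g x * bump a b n x) \<in> borel_measurable \<mu>" for n
        using g test_fun_L2[OF bump_test_fun[OF sub, of n]]
        by (intro borel_measurable_times L2_measurable)
    qed
    then have "(\<integral>x. g x * indicator (box a b) x \<partial>\<mu>) = 0"
      using orth[OF bump_test_fun[OF sub]] by (simp add: LIMSEQ_const_iff)
    moreover have "(\<integral>x. g x * indicator (box a b) x \<partial>\<mu>)
        = (\<integral>x. indicator \<Omega> x *\<^sub>R (g x * indicator (box a b) x) \<partial>lebesgue)"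
      by (subst integral_restrict_space) auto
    moreover have "(\<lambda>x. indicator \<Omega> x *\<^sub>R (g x * indicator (box a b) x))
        = (\<lambda>x. indicator (box a b) x *\<^sub>R f x)"
      using sub box_subset_cbox[of a b] by (auto simp: f_def fun_eq_iff indicator_def)
    ultimately have "(LINT x:box a b|lebesgue. f x) = 0"
      by (simp add: set_lebesgue_integral_def)
    moreover have "set_integrable lebesgue (box a b) f"
      unfolding set_integrable_def by (intro integrable_mult_indicator fi) auto
    ultimately have "integral (box a b) f = 0"
      using set_lebesgue_integral_eq_integral by metis
    then show ?thesis by (simp add: integral_open_interval)
  qed
  obtain N where N: "negligible N"
    "\<And>x e. \<lbrakk>x \<notin> N; 0 < e\<rbrakk> \<Longrightarrow> \<exists>d>0. \<forall>h. 0 < h \<and> h < d \<longrightarrow>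
        norm (integral (cbox x (x + h *\<^sub>R One)) f /\<^sub>R h ^ DIM(real^2) - f x) < e"
    using integrable_ccontinuous_explicit[OF fint] by blast
  have "f x = 0" if x: "x \<in> \<Omega>" "x \<notin> N" for x
  proof (rule ccontr)
    assume "f x \<noteq> 0"
    then obtain d where d: "d > 0" "\<And>h. 0 < h \<Longrightarrow> h < d \<Longrightarrow>
        norm (integral (cbox x (x + h *\<^sub>R One)) f /\<^sub>R h ^ DIM(real^2) - f x) < \<bar>f x\<bar>"
      using N(2)[OF x(2), of "\<bar>f x\<bar>"] by auto
    obtain r where r: "r > 0" "ball x r \<subseteq> \<Omega>"
      using open_dom x open_contains_ball by blast
    define h where "h = min (d / 2) (r / 2 / (norm (One::real^2) + 1))"
    have pos: "norm (One::real^2) + 1 > 0" by (simp add: add_nonneg_pos)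
    have "0 < h" using d(1) r(1) pos by (simp add: h_def)
    moreover have "h \<le> d / 2" unfolding h_def by (rule min.cobounded1)
    ultimately have h: "0 < h" "h < d" using d(1) by auto
    have "h * (norm (One::real^2) + 1) \<le> r / 2"
      using min.cobounded2[of "d / 2"] pos unfolding h_def by (simp only: pos_le_divide_eq[symmetric])
    then have hr: "h * norm (One::real^2) < r" using h(1) r(1) by (simp add: algebra_simps)
    have "cbox x (x + h *\<^sub>R One) \<subseteq> ball x r"
    proof
      fix y assume y: "y \<in> cbox x (x + h *\<^sub>R One)"
      have "norm (y - x) \<le> norm (h *\<^sub>R (One::real^2))"
        by (rule norm_le_componentwise) (use y h(1) in \<open>auto simp: mem_box inner_simps\<close>)
      then show "y \<in> ball x r"
        using hr h(1) by (simp add: dist_norm norm_minus_commute)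
    qed
    then have "integral (cbox x (x + h *\<^sub>R One)) f = 0"
      using box0 r by blast
    then show False using d(2)[OF h] by simp
  qed
  then have "{x. \<not> (x \<in> \<Omega> \<longrightarrow> g x = 0)} \<subseteq> N"
    by (auto simp: f_def)
  moreover have "N \<in> null_sets lebesgue" using N(1) negligible_iff_null_sets by blast
  ultimately have "AE x in lebesgue. x \<in> \<Omega> \<longrightarrow> g x = 0"
    by (intro AE_I'[of N]) auto
  then show ?thesis
    by (simp add: AE_restrict_space_iff)
qed

lemma has_weak_pd_unique:
  assumes "weak_pd \<alpha> f g" "weak_pd \<alpha> f g'"
  shows "AE x in \<mu>. g x = g' x"
proof -
  have L: "g \<in> \<L>" "g' \<in> \<L>" using assms by (auto simp: has_weak_pd_def)
  have "(\<integral>x. (g x - g' x) * \<phi> x \<partial>\<mu>) = 0" if "\<phi> \<in> \<T>" for \<phi>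
    using assms that L test_fun_L2[OF that]
    by (simp add: has_weak_pd_def left_diff_distrib L2_mult_integrable)
  from fundamental_lemma[OF L2_diff[OF L] this] show ?thesis by simp
qed

lemma has_weak_pd_wpd: "weak_pd \<alpha> f g \<Longrightarrow> weak_pd \<alpha> f (wd \<alpha> f)"
  unfolding wpd_def using someI[of "weak_pd \<alpha> f" g] .

lemma wpd_AE: "weak_pd \<alpha> f g \<Longrightarrow> AE x in \<mu>. wd \<alpha> f x = g x"
  using has_weak_pd_wpd has_weak_pd_unique by blast

lemma has_weak_pd_cong:
  assumes "weak_pd \<alpha> f g" "AE x in \<mu>. f' x = f x" "f \<in> \<L>" "f' \<in> \<L>"
  shows "weak_pd \<alpha> f' g"
proof -
  have "(\<integral>x. f' x * pd \<alpha> \<phi> x \<partial>\<mu>) = (\<integral>x. f x * pd \<alpha> \<phi> x \<partial>\<mu>)" if "\<phi> \<in> \<T>" for \<phi>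
    by (rule integral_cong_AE)
      (use assms test_fun_L2[OF test_fun_pd[OF that], of \<alpha>] in auto)
  with assms show ?thesis by (simp add: has_weak_pd_def)
qed

lemma has_weak_pd_lincomb:
  assumes "weak_pd \<alpha> f f'" "weak_pd \<alpha> g g'" "f \<in> \<L>" "g \<in> \<L>"
  shows "weak_pd \<alpha> (\<lambda>x. f x + c * g x) (\<lambda>x. f' x + c * g' x)"
proof -
  have L: "f' \<in> \<L>" "g' \<in> \<L>" using assms by (auto simp: has_weak_pd_def)
  have "(\<integral>x. (f x + c * g x) * pd \<alpha> \<phi> x \<partial>\<mu>) = - (\<integral>x. (f' x + c * g' x) * \<phi> x \<partial>\<mu>)"
    if \<phi>: "\<phi> \<in> \<T>" for \<phi>
  proof -
    have L': "\<phi> \<in> \<L>" "pd \<alpha> \<phi> \<in> \<L>"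
      using test_fun_L2 \<phi> test_fun_pd by auto
    have "(\<integral>x. (f x + c * g x) * pd \<alpha> \<phi> x \<partial>\<mu>) = (\<integral>x. f x * pd \<alpha> \<phi> x \<partial>\<mu>) + c * (\<integral>x. g x * pd \<alpha> \<phi> x \<partial>\<mu>)"
      using L2_mult_integrable[OF assms(3) L'(2)] L2_mult_integrable[OF assms(4) L'(2)]
      by (simp add: distrib_right mult.assoc)
    moreover have "(\<integral>x. (f' x + c * g' x) * \<phi> x \<partial>\<mu>) = (\<integral>x. f' x * \<phi> x \<partial>\<mu>) + c * (\<integral>x. g' x * \<phi> x \<partial>\<mu>)"
      using L2_mult_integrable[OF L(1) L'(1)] L2_mult_integrable[OF L(2) L'(1)]
      by (simp add: distrib_right mult.assoc)
    ultimately show ?thesis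
      using assms(1,2) \<phi> by (simp add: has_weak_pd_def algebra_simps)
  qed
  with L show ?thesis by (simp add: has_weak_pd_def L2_lincomb)
qed

lemma test_fun_has_weak_pd: "\<phi> \<in> \<T> \<Longrightarrow> weak_pd \<alpha> \<phi> (pd \<alpha> \<phi>)"
  unfolding has_weak_pd_def
  using test_fun_L2 test_fun_pd test_fun_integral_by_parts open_dom by blast

lemma W12_L2: "f \<in> W1 \<Longrightarrow> f \<in> \<L>"
  by (simp add: W12_def)

lemma W12_has_weak_pd: "f \<in> W1 \<Longrightarrow> weak_pd \<alpha> f (wd \<alpha> f)"
  unfolding W12_def by (elim CollectE conjE allE[of _ \<alpha>] exE) (rule has_weak_pd_wpd)

lemma W12_wpd_L2: "f \<in> W1 \<Longrightarrow> wd \<alpha> f \<in> \<L>"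
  using W12_has_weak_pd by (auto simp: has_weak_pd_def)

lemma W12_I: "f \<in> \<L> \<Longrightarrow> (\<And>\<alpha>. weak_pd \<alpha> f (g \<alpha>)) \<Longrightarrow> f \<in> W1"
  by (auto simp: W12_def)

lemma W12_lincomb: "f \<in> W1 \<Longrightarrow> g \<in> W1 \<Longrightarrow> (\<lambda>x. f x + c * g x) \<in> W1"
  by (rule W12_I[OF _ has_weak_pd_lincomb[OF W12_has_weak_pd W12_has_weak_pd]])
    (auto intro: L2_lincomb W12_L2)

lemma wpd_lincomb:
  assumes "f \<in> W1" "g \<in> W1"
  shows "AE x in \<mu>. wd \<alpha> (\<lambda>x. f x + c * g x) x = wd \<alpha> f x + c * wd \<alpha> g x"
  by (intro wpd_AE has_weak_pd_lincomb W12_has_weak_pd W12_L2 assms)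

lemma test_fun_W12: "\<phi> \<in> \<T> \<Longrightarrow> \<phi> \<in> W1"
  by (rule W12_I[OF test_fun_L2 test_fun_has_weak_pd]) (auto intro: open_dom)

lemma wpd_test_fun: "\<phi> \<in> \<T> \<Longrightarrow> AE x in \<mu>. wd \<alpha> \<phi> x = pd \<alpha> \<phi> x"
  by (intro wpd_AE test_fun_has_weak_pd)

lemma W22_W12: "f \<in> W2 \<Longrightarrow> f \<in> W1" "f \<in> W2 \<Longrightarrow> wd \<alpha> f \<in> W1"
  by (auto simp: W22_def)

lemma W22_wpd2_L2: "f \<in> W2 \<Longrightarrow> wd2 \<alpha> \<beta> f \<in> \<L>"
  unfolding wpd2_def using W22_W12 W12_wpd_L2 by blast

lemma has_weak_pd_wpd_lincomb:
  assumes "f \<in> W2" "g \<in> W2"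
  shows "weak_pd \<beta> (wd \<alpha> (\<lambda>x. f x + c * g x)) (\<lambda>x. wd2 \<alpha> \<beta> f x + c * wd2 \<alpha> \<beta> g x)"
proof (rule has_weak_pd_cong[OF _ wpd_lincomb])
  show "weak_pd \<beta> (\<lambda>x. wd \<alpha> f x + c * wd \<alpha> g x) (\<lambda>x. wd2 \<alpha> \<beta> f x + c * wd2 \<alpha> \<beta> g x)"
    unfolding wpd2_def using assms
    by (intro has_weak_pd_lincomb W12_has_weak_pd W12_L2 W22_W12)
qed (use assms in \<open>auto intro: W22_W12 L2_lincomb W12_wpd_L2 W12_lincomb\<close>)

lemma W22_lincomb: "f \<in> W2 \<Longrightarrow> g \<in> W2 \<Longrightarrow> (\<lambda>x. f x + c * g x) \<in> W2"
  unfolding W22_def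
  by (auto intro!: W12_lincomb W12_I[OF _ has_weak_pd_wpd_lincomb] W12_wpd_L2 simp: W22_def)

lemma wpd2_lincomb:
  assumes "f \<in> W2" "g \<in> W2"
  shows "AE x in \<mu>. wd2 \<alpha> \<beta> (\<lambda>x. f x + c * g x) x = wd2 \<alpha> \<beta> f x + c * wd2 \<alpha> \<beta> g x"
  using wpd_AE[OF has_weak_pd_wpd_lincomb[OF assms]] by (simp add: wpd2_def)

lemma test_fun_has_weak_pd2:
  assumes "\<phi> \<in> \<T>"
  shows "weak_pd \<beta> (wd \<alpha> \<phi>) (pd \<beta> (pd \<alpha> \<phi>))"
  by (rule has_weak_pd_cong[OF test_fun_has_weak_pd[OF test_fun_pd] wpd_test_fun])
    (use assms open_dom in \<open>auto intro: test_fun_L2 test_fun_pd W12_wpd_L2 test_fun_W12\<close>)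

lemma test_fun_W22: "\<phi> \<in> \<T> \<Longrightarrow> \<phi> \<in> W2"
  by (simp add: W22_def test_fun_W12 W12_I[OF W12_wpd_L2[OF test_fun_W12] test_fun_has_weak_pd2])

lemma wpd2_test_fun: "\<phi> \<in> \<T> \<Longrightarrow> AE x in \<mu>. wd2 \<alpha> \<beta> \<phi> x = pd \<beta> (pd \<alpha> \<phi>) x"
  unfolding wpd2_def by (intro wpd_AE test_fun_has_weak_pd2)

subsection \<open>Spaces with zero boundary values\<close>

lemma W12_0_W12: "f \<in> W1\<^sub>0 \<Longrightarrow> f \<in> W1"
  by (simp add: W12_0_def)

lemma W22_0_W22: "f \<in> W2\<^sub>0 \<Longrightarrow> f \<in> W2"
  by (simp add: W22_0_def)

lemma test_fun_pd_L2: "\<phi> \<in> \<T> \<Longrightarrow> pd \<alpha> \<phi> \<in> \<L>"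
  "\<phi> \<in> \<T> \<Longrightarrow> pd \<beta> (pd \<alpha> \<phi>) \<in> \<L>"
  by (simp_all add: test_fun_L2 test_fun_pd)

lemma test_fun_W12_0:
  assumes "\<phi> \<in> \<T>"
  shows "\<phi> \<in> W1\<^sub>0"
  unfolding W12_0_def
  using assms open_dom
  by (auto intro!: exI[of _ "\<lambda>n. \<phi>"] L2_lim_const_AE wpd_test_fun
      intro: test_fun_W12 W12_wpd_L2 test_fun_L2 test_fun_pd)

lemma test_fun_W22_0:
  assumes "\<phi> \<in> \<T>"
  shows "\<phi> \<in> W2\<^sub>0"
  unfolding W22_0_def
  using assms open_dom
  by (auto intro!: exI[of _ "\<lambda>n. \<phi>"] L2_lim_const_AE wpd_test_fun wpd2_test_fun
      intro: test_fun_W12 W12_wpd_L2 test_fun_L2 test_fun_pd test_fun_W22 W22_wpd2_L2)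

lemma W22_0_W12_0: "f \<in> W2\<^sub>0 \<Longrightarrow> f \<in> W1\<^sub>0"
  unfolding W22_0_def W12_0_def using W22_W12 by blast

lemma W22_0_wpd_W12_0: 
  assumes "f \<in> W2\<^sub>0"
  shows "wd \<alpha> f \<in> W1\<^sub>0"
proof -
  obtain \<phi> where "\<And>n. \<phi> n \<in> \<T>" "L2_to (\<lambda>n. pd \<alpha> (\<phi> n)) (wd \<alpha> f)"
      "\<And>\<beta>. L2_to (\<lambda>n. pd \<beta> (pd \<alpha> (\<phi> n))) (wd2 \<alpha> \<beta> f)"
    using assms unfolding W22_0_def by (elim CollectE conjE exE) blast
  then show ?thesis
    unfolding W12_0_def using W22_W12(2)[OF W22_0_W22[OF assms]]
    by (auto intro!: exI[of _ "\<lambda>n. pd \<alpha> (\<phi> n)"] test_fun_pd simp: wpd2_def)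
qed

lemma W12_0_lincomb:
  assumes f: "f \<in> W1\<^sub>0" and g: "g \<in> W1\<^sub>0"
  shows "(\<lambda>x. f x + c * g x) \<in> W1\<^sub>0"
proof -
  obtain \<phi> \<psi> where a: "\<And>n. \<phi> n \<in> \<T>" "L2_to \<phi> f" "\<And>\<alpha>. L2_to (\<lambda>n. pd \<alpha> (\<phi> n)) (wd \<alpha> f)"
    and b: "\<And>n. \<psi> n \<in> \<T>" "L2_to \<psi> g" "\<And>\<alpha>. L2_to (\<lambda>n. pd \<alpha> (\<psi> n)) (wd \<alpha> g)"
    using f g by (auto simp: W12_0_def)
  have W: "f \<in> W1" "g \<in> W1" using f g W12_0_W12 by auto
  have "L2_to (\<lambda>n x. \<phi> n x + c * \<psi> n x) (\<lambda>x. f x + c * g x)"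
    by (rule L2_lim_lincomb[OF _ _ a(2) _ _ b(2)])
      (use a b W open_dom in \<open>auto intro: test_fun_L2 W12_L2 L2_lincomb\<close>)
  moreover have "L2_to (\<lambda>n. pd \<alpha> (\<lambda>x. \<phi> n x + c * \<psi> n x)) (wd \<alpha> (\<lambda>x. f x + c * g x))" for \<alpha>
    unfolding test_fun_cadd_pd[OF a(1) b(1)]
    by (rule L2_lim_lincomb[OF _ _ a(3) _ _ b(3) wpd_lincomb])
      (use a b W open_dom in \<open>auto intro: test_fun_pd_L2 W12_wpd_L2 W12_lincomb\<close>)
  ultimately show ?thesis
    unfolding W12_0_def using W a b
    by (auto intro!: W12_lincomb exI[of _ "\<lambda>n x. \<phi> n x + c * \<psi> n x"] test_fun_add test_fun_cmult)
qed

lemma W22_0_lincomb: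
  assumes f: "f \<in> W2\<^sub>0" and g: "g \<in> W2\<^sub>0"
  shows "(\<lambda>x. f x + c * g x) \<in> W2\<^sub>0"
proof -
  obtain \<phi> \<psi> where a: "\<And>n. \<phi> n \<in> \<T>" "L2_to \<phi> f" "\<And>\<alpha>. L2_to (\<lambda>n. pd \<alpha> (\<phi> n)) (wd \<alpha> f)"
      "\<And>\<alpha> \<beta>. L2_to (\<lambda>n. pd \<beta> (pd \<alpha> (\<phi> n))) (wd2 \<alpha> \<beta> f)"
    and b: "\<And>n. \<psi> n \<in> \<T>" "L2_to \<psi> g" "\<And>\<alpha>. L2_to (\<lambda>n. pd \<alpha> (\<psi> n)) (wd \<alpha> g)"
      "\<And>\<alpha> \<beta>. L2_to (\<lambda>n. pd \<beta> (pd \<alpha> (\<psi> n))) (wd2 \<alpha> \<beta> g)"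
    using f g unfolding W22_0_def by (elim CollectE conjE exE) blast
  have W: "f \<in> W2" "g \<in> W2" using f g W22_0_W22 by auto
  then have W': "f \<in> W1" "g \<in> W1" using W22_W12 by auto
  have "L2_to (\<lambda>n x. \<phi> n x + c * \<psi> n x) (\<lambda>x. f x + c * g x)"
    by (rule L2_lim_lincomb[OF _ _ a(2) _ _ b(2)])
      (use a b W' open_dom in \<open>auto intro: test_fun_L2 W12_L2 L2_lincomb\<close>)
  moreover have "L2_to (\<lambda>n. pd \<alpha> (\<lambda>x. \<phi> n x + c * \<psi> n x)) (wd \<alpha> (\<lambda>x. f x + c * g x))" for \<alpha>
    unfolding test_fun_cadd_pd[OF a(1) b(1)]
    by (rule L2_lim_lincomb[OF _ _ a(3) _ _ b(3) wpd_lincomb])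
      (use a b W' open_dom in \<open>auto intro: test_fun_pd_L2 W12_wpd_L2 W12_lincomb\<close>)
  moreover have "L2_to (\<lambda>n. pd \<beta> (pd \<alpha> (\<lambda>x. \<phi> n x + c * \<psi> n x))) (wd2 \<alpha> \<beta> (\<lambda>x. f x + c * g x))"
    for \<alpha> \<beta>
    unfolding test_fun_cadd_pd[OF a(1) b(1)] test_fun_cadd_pd[OF test_fun_pd[OF a(1)] test_fun_pd[OF b(1)]]
    by (rule L2_lim_lincomb[OF _ _ a(4) _ _ b(4) wpd2_lincomb])
      (use a b W open_dom in \<open>auto intro: test_fun_pd_L2 W22_wpd2_L2 W22_lincomb\<close>)
  ultimately show ?thesis
    unfolding W22_0_def using W a b
    by (auto intro!: W22_lincomb exI[of _ "\<lambda>n x. \<phi> n x + c * \<psi> n x"] test_fun_add test_fun_cmult)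
qed

lemma W22_0_zero: "(\<lambda>x. 0) \<in> W2\<^sub>0"
  by (intro test_fun_W22_0 test_fun_zero)

lemma W22_0_cmult: "f \<in> W2\<^sub>0 \<Longrightarrow> (\<lambda>x. c * f x) \<in> W2\<^sub>0"
  using W22_0_lincomb[OF W22_0_zero, of f c] by simp

lemma W12_0_integral_by_parts:
  assumes f: "f \<in> W1\<^sub>0" and g: "g \<in> W1"
  shows "(\<integral>x. wd \<alpha> f x * g x \<partial>\<mu>) = - (\<integral>x. f x * wd \<alpha> g x \<partial>\<mu>)"
proof -
  obtain \<phi> where a: "\<And>n. \<phi> n \<in> \<T>" "L2_to \<phi> f" "L2_to (\<lambda>n. pd \<alpha> (\<phi> n)) (wd \<alpha> f)"
    using f by (auto simp: W12_0_def)
  have L: "f \<in> \<L>" "g \<in> \<L>" "wd \<alpha> f \<in> \<L>" "wd \<alpha> g \<in> \<L>"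
    "\<And>n. \<phi> n \<in> \<L>" "\<And>n. pd \<alpha> (\<phi> n) \<in> \<L>"
    using f g a(1) open_dom by (auto intro: W12_L2 W12_wpd_L2 W12_0_W12 test_fun_L2 test_fun_pd)
  have "(\<integral>x. pd \<alpha> (\<phi> n) x * g x \<partial>\<mu>) = - (\<integral>x. \<phi> n x * wd \<alpha> g x \<partial>\<mu>)" for n
    using W12_has_weak_pd[OF g, of \<alpha>] a(1) by (simp add: has_weak_pd_def mult.commute)
  moreover have "(\<lambda>n. \<integral>x. pd \<alpha> (\<phi> n) x * g x \<partial>\<mu>) \<longlonglongrightarrow> (\<integral>x. wd \<alpha> f x * g x \<partial>\<mu>)"
    by (intro L2_lim_inner L a)
  moreover have "(\<lambda>n. - (\<integral>x. \<phi> n x * wd \<alpha> g x \<partial>\<mu>)) \<longlonglongrightarrow> - (\<integral>x. f x * wd \<alpha> g x \<partial>\<mu>)"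
    by (intro tendsto_minus L2_lim_inner L a)
  ultimately show ?thesis
    using LIMSEQ_unique by simp
qed

text \<open>Moving the two derivatives one at a time through a smooth approximation turns one of the two
  products of pure second derivatives into the other.\<close>

lemma W22_0_hessian_minor:
  assumes f: "f \<in> W2\<^sub>0" and g: "g \<in> W2\<^sub>0"
  shows "(\<integral>x. wd2 1 1 f x * wd2 2 2 g x \<partial>\<mu>) = (\<integral>x. wd2 2 2 f x * wd2 1 1 g x \<partial>\<mu>)"
proof -
  obtain \<phi> where a: "\<And>n. \<phi> n \<in> \<T>" "\<And>\<alpha> \<beta>. L2_to (\<lambda>n. pd \<beta> (pd \<alpha> (\<phi> n))) (wd2 \<alpha> \<beta> f)"
    using f unfolding W22_0_def by (elim CollectE conjE exE) blast
  obtain \<psi> where b: "\<And>n. \<psi> n \<in> \<T>" "\<And>\<alpha> \<beta>. L2_to (\<lambda>n. pd \<beta> (pd \<alpha> (\<psi> n))) (wd2 \<alpha> \<beta> g)"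
    using g unfolding W22_0_def by (elim CollectE conjE exE) blast
  have L: "wd2 \<alpha> \<beta> f \<in> \<L>" "wd2 \<alpha> \<beta> g \<in> \<L>" for \<alpha> \<beta>
    using f g W22_0_W22 W22_wpd2_L2 by auto
  have T: "pd \<alpha> \<theta> \<in> \<T>" "pd \<alpha> \<theta> \<in> \<L>" if "\<theta> \<in> \<T>" for \<alpha> \<theta>
    using that test_fun_pd test_fun_L2 open_dom by blast+
  have swap: "(\<integral>x. pd 1 (pd 1 u) x * pd 2 (pd 2 v) x \<partial>\<mu>) = (\<integral>x. pd 2 (pd 2 u) x * pd 1 (pd 1 v) x \<partial>\<mu>)"
    if u: "u \<in> \<T>" and v: "v \<in> \<T>" for u v
  proof -
    have c: "pd \<alpha> (pd \<beta> \<theta>) = pd \<beta> (pd \<alpha> \<theta>)" if "\<theta> \<in> \<T>" for \<alpha> \<beta> \<theta>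
      using pd_commute test_fun_smooth[OF that] by blast
    have "pd 2 (pd 2 (pd 1 v)) = pd 1 (pd 2 (pd 2 v))" "pd 1 (pd 1 (pd 2 v)) = pd 2 (pd 1 (pd 1 v))"
      using c T v by metis+
    note c' = this
    have "(\<integral>x. pd 1 (pd 1 u) x * pd 2 (pd 2 v) x \<partial>\<mu>) = - (\<integral>x. pd 1 u x * pd 1 (pd 2 (pd 2 v)) x \<partial>\<mu>)"
      using test_fun_integral_by_parts[OF open_dom] T u v by simp
    also have "\<dots> = (\<integral>x. pd 2 (pd 1 u) x * pd 2 (pd 1 v) x \<partial>\<mu>)"
      using test_fun_integral_by_parts[OF open_dom, of "pd 1 u" "pd 2 (pd 1 v)" 2] T u v by (simp add: c')
    also have "\<dots> = (\<integral>x. pd 1 (pd 2 u) x * pd 1 (pd 2 v) x \<partial>\<mu>)"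
      using c[OF u, of 2 1] c[OF v, of 2 1] by simp
    also have "\<dots> = - (\<integral>x. pd 2 u x * pd 1 (pd 1 (pd 2 v)) x \<partial>\<mu>)"
      using test_fun_integral_by_parts[OF open_dom, of "pd 2 u" "pd 1 (pd 2 v)" 1] T u v by simp
    also have "\<dots> = (\<integral>x. pd 2 (pd 2 u) x * pd 1 (pd 1 v) x \<partial>\<mu>)"
      using test_fun_integral_by_parts[OF open_dom, of "pd 2 u" "pd 1 (pd 1 v)" 2] T u v by (simp add: c')
    finally show ?thesis .
  qed
  have swap': "(\<integral>x. pd 1 (pd 1 u) x * wd2 2 2 g x \<partial>\<mu>) = (\<integral>x. pd 2 (pd 2 u) x * wd2 1 1 g x \<partial>\<mu>)"
    if u: "u \<in> \<T>" for u
  proof -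
    have l: "(\<lambda>n. \<integral>x. pd \<alpha> (pd \<alpha> u) x * pd \<beta> (pd \<beta> (\<psi> n)) x \<partial>\<mu>) \<longlonglongrightarrow>
        (\<integral>x. pd \<alpha> (pd \<alpha> u) x * wd2 \<beta> \<beta> g x \<partial>\<mu>)" for \<alpha> \<beta>
      using L2_lim_inner[OF _ _ _ b(2)[of \<beta> \<beta>], where g = "pd \<alpha> (pd \<alpha> u)"] T u L b by (simp add: mult.commute)
    show ?thesis
      using LIMSEQ_unique[OF l[of 1 2]] l[of 2 1] swap[OF u b(1)] by simp
  qed
  have l: "(\<lambda>n. \<integral>x. pd \<alpha> (pd \<alpha> (\<phi> n)) x * wd2 \<beta> \<beta> g x \<partial>\<mu>) \<longlonglongrightarrow>
      (\<integral>x. wd2 \<alpha> \<alpha> f x * wd2 \<beta> \<beta> g x \<partial>\<mu>)" for \<alpha> \<beta>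
    using T L a by (intro L2_lim_inner) auto
  show ?thesis
    using LIMSEQ_unique[OF l[of 1 2]] l[of 2 1] swap'[OF a(1)] by simp
qed

end

subsection \<open>Square integrability of products of first derivatives\<close>

text \<open>The identification of pairs with vectors, through which Tonelli's theorem for the product measure
  becomes available in the plane.\<close>

definition of_coords :: "real \<times> real \<Rightarrow> real^2" where
  "of_coords p = (\<chi> i. if i = 1 then fst p else snd p)"

lemma of_coords_nth [simp]: "of_coords p $ 1 = fst p" "of_coords p $ 2 = snd p"
  by (simp_all add: of_coords_def)

lemma of_coords_measurable [measurable]: "of_coords \<in> borel_measurable (lborel \<Otimes>\<^sub>M lborel)"
proof -
  have "continuous_on UNIV of_coords"
    unfolding of_coords_def
  proof (rule continuous_on_vec_lambda)
    show "continuous_on UNIV (\<lambda>p::real \<times> real. if i = 1 then fst p else snd p)" for i :: 2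
      by (cases "i = 1") (auto intro!: continuous_intros)
  qed
  then have "of_coords \<in> borel_measurable borel" by (rule borel_measurable_continuous_onI)
  then show ?thesis by (simp add: lborel_prod)
qed

lemma Basis_real2: "(Basis :: (real^2) set) = {axis 1 1, axis 2 1}"
  by (auto simp: Basis_vec_def UNIV_2)

lemma lborel_real2: "lborel = distr (lborel \<Otimes>\<^sub>M lborel) borel of_coords"
proof (rule lborel_eqI)
  fix l u :: "real^2"
  assume le: "\<And>b. b \<in> Basis \<Longrightarrow> l \<bullet> b \<le> u \<bullet> b"
  then have le': "l $ 1 \<le> u $ 1" "l $ 2 \<le> u $ 2"
    using le[of "axis 1 1"] le[of "axis 2 1"] by (auto simp: Basis_real2 inner_axis)
  have "emeasure (distr (lborel \<Otimes>\<^sub>M lborel) borel of_coords) (box l u)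
      = emeasure (lborel \<Otimes>\<^sub>M lborel) ({l $ 1<..<u $ 1} \<times> {l $ 2<..<u $ 2})"
    by (subst emeasure_distr)
      (auto intro!: arg_cong2[where f = emeasure] simp: space_pair_measure mem_box_2)
  also have "\<dots> = ennreal (u $ 1 - l $ 1) * ennreal (u $ 2 - l $ 2)"
    using le' by (simp add: lborel.emeasure_pair_measure_Times)
  also have "\<dots> = ennreal (\<Prod>b\<in>Basis. (u - l) \<bullet> b)"
    using le' by (simp add: Basis_real2 inner_axis axis_eq_axis ennreal_mult)
  finally show "emeasure (distr (lborel \<Otimes>\<^sub>M lborel) borel of_coords) (box l u)
      = ennreal (\<Prod>b\<in>Basis. (u - l) \<bullet> b)" .
qed simp

lemma nn_integral_real2:
  assumes [measurable]: "f \<in> borel_measurable borel"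
  shows "(\<integral>\<^sup>+x. f x \<partial>lborel) = (\<integral>\<^sup>+t. \<integral>\<^sup>+s. f (of_coords (s, t)) \<partial>lborel \<partial>lborel)"
    and "(\<integral>\<^sup>+x. f x \<partial>lborel) = (\<integral>\<^sup>+s. \<integral>\<^sup>+t. f (of_coords (s, t)) \<partial>lborel \<partial>lborel)"
proof -
  have "(\<integral>\<^sup>+x. f x \<partial>lborel) = (\<integral>\<^sup>+p. f (of_coords p) \<partial>(lborel \<Otimes>\<^sub>M lborel))"
    by (subst lborel_real2) (simp add: nn_integral_distr)
  then show "(\<integral>\<^sup>+x. f x \<partial>lborel) = (\<integral>\<^sup>+t. \<integral>\<^sup>+s. f (of_coords (s, t)) \<partial>lborel \<partial>lborel)"
    "(\<integral>\<^sup>+x. f x \<partial>lborel) = (\<integral>\<^sup>+s. \<integral>\<^sup>+t. f (of_coords (s, t)) \<partial>lborel \<partial>lborel)"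
    using lborel_pair.nn_integral_snd[of "\<lambda>p. f (of_coords p)"]
      lborel.nn_integral_fst[of "\<lambda>p. f (of_coords p)" lborel] by simp_all
qed

lemma square_le_nn_integral_line:
  fixes g g' :: "real \<Rightarrow> real"
  assumes g: "\<And>t. (g has_real_derivative g' t) (at t)" and cont: "continuous_on UNIV g'"
    and R: "\<And>t. t < R \<Longrightarrow> g t = 0"
  shows "ennreal ((g t)\<^sup>2) \<le> (\<integral>\<^sup>+s. ennreal (2 * \<bar>g s * g' s\<bar>) \<partial>lborel)"
proof -
  define a where "a = min (R - 1) t"
  have a: "a \<le> t" "g a = 0" using R[of a] by (auto simp: a_def)
  have contg: "continuous_on UNIV g"
    by (intro continuous_at_imp_continuous_on ballI DERIV_isCont[OF g])
  have isc: "isCont (\<lambda>s. 2 * (g s * g' s)) x" for x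
    using contg cont by (auto simp: continuous_on_eq_continuous_at intro!: continuous_intros)
  have "(\<integral>s. 2 * (g s * g' s) * indicator {a..t} s \<partial>lborel) = (g t)\<^sup>2 - (g a)\<^sup>2"
  proof (rule integral_FTC_Icc_real[OF a(1) _ isc])
    show "((\<lambda>s. (g s)\<^sup>2) has_real_derivative 2 * (g x * g' x)) (at x)" for x
      using DERIV_power[OF g[of x], of 2] by (simp add: mult.commute mult.left_commute)
  qed
  then have "ennreal ((g t)\<^sup>2) = ennreal (norm (\<integral>s. 2 * (g s * g' s) * indicator {a..t} s \<partial>lborel))"
    using a by simp
  also have "\<dots> \<le> (\<integral>\<^sup>+s. norm (2 * (g s * g' s) * indicator {a..t} s) \<partial>lborel)"
    by (rule integral_norm_bound_ennreal[OF borel_integrable_atLeastAtMost[OF isc]])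
  also have "\<dots> \<le> (\<integral>\<^sup>+s. ennreal (2 * \<bar>g s * g' s\<bar>) \<partial>lborel)"
    by (intro nn_integral_mono ennreal_leI) (auto simp: abs_mult indicator_def)
  finally show ?thesis .
qed

lemma of_coords_line:
  "of_coords (s, t) = of_coords (0, t) + s *\<^sub>R axis 1 1"
  "of_coords (s, t) = of_coords (s, 0) + t *\<^sub>R axis 2 1"
  by (auto simp: vec_eq_iff forall_2 axis_def)

text \<open>Ladyzhenskaya's inequality. Integrating along lines bounds \<open>\<phi>\<^sup>2\<close> by a function of the second
  coordinate alone and by a function of the first coordinate alone, and the integral of the product
  of these bounds factorizes.\<close>

lemma test_fun_fourth_power:
  assumes \<phi>: "\<phi> \<in> test_fun \<Omega>" and \<Omega>: "open \<Omega>"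
  shows "(\<integral>\<^sup>+x. ennreal ((\<phi> x) ^ 4) \<partial>lborel) \<le>
    ennreal ((\<integral>x. (\<phi> x)\<^sup>2 + (pd 1 \<phi> x)\<^sup>2 \<partial>lborel) * (\<integral>x. (\<phi> x)\<^sup>2 + (pd 2 \<phi> x)\<^sup>2 \<partial>lborel))"
proof -
  define q where "q \<alpha> x = 2 * \<bar>\<phi> x * pd \<alpha> \<phi> x\<bar>" for \<alpha> x
  have cont: "continuous_on UNIV \<phi>" "\<And>\<alpha>. continuous_on UNIV (pd \<alpha> \<phi>)"
    using test_fun_continuous \<phi> test_fun_pd by blast+
  have [measurable]: "\<phi> \<in> borel_measurable borel" "\<And>\<alpha>. pd \<alpha> \<phi> \<in> borel_measurable borel"
    using cont by (auto intro: borel_measurable_continuous_onI)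
  have [measurable]: "\<And>\<alpha>. q \<alpha> \<in> borel_measurable borel"
    unfolding q_def[abs_def] by measurable
  have d: "\<And>x. \<phi> differentiable (at x)" using test_fun_differentiable \<phi> by blast
  obtain S where S: "compact S" "\<forall>x. x \<notin> S \<longrightarrow> \<phi> x = 0" using test_fun_support[OF \<phi>] by blast
  obtain R where R: "\<And>x. x \<in> S \<Longrightarrow> norm x \<le> R"
    using compact_imp_bounded[OF S(1)] bounded_iff by metis
  have out: "\<phi> x = 0" if "\<bar>x $ i\<bar> > R" for x i
  proof -
    have "norm x > R" using that component_le_norm_cart[of x i] by linarith
    then show ?thesis using S(2) R by force
  qed
  define A where "A t = (\<integral>\<^sup>+s. ennreal (q 1 (of_coords (s, t))) \<partial>lborel)" for t
  define B where "B s = (\<integral>\<^sup>+t. ennreal (q 2 (of_coords (s, t))) \<partial>lborel)" for s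
  have [measurable]: "A \<in> borel_measurable lborel" "B \<in> borel_measurable lborel"
    unfolding A_def[abs_def] B_def[abs_def] by measurable
  have A: "ennreal ((\<phi> (of_coords (s, t)))\<^sup>2) \<le> A t" for s t
  proof -
    have "ennreal ((\<phi> (of_coords (0, t) + s *\<^sub>R axis 1 1))\<^sup>2)
      \<le> (\<integral>\<^sup>+s. ennreal (2 * \<bar>\<phi> (of_coords (0, t) + s *\<^sub>R axis 1 1) * pd 1 \<phi> (of_coords (0, t) + s *\<^sub>R axis 1 1)\<bar>) \<partial>lborel)"
    proof (rule square_le_nn_integral_line[OF pd_along_line[OF d]])
      show "continuous_on UNIV (\<lambda>s. pd 1 \<phi> (of_coords (0, t) + s *\<^sub>R axis 1 1))"
        by (intro continuous_on_compose2[OF cont(2)] continuous_intros) auto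
      show "\<phi> (of_coords (0, t) + s *\<^sub>R axis 1 1) = 0" if "s < - \<bar>R\<bar>" for s
        by (rule out[of _ 1]) (use that in \<open>simp add: axis_def\<close>)
    qed
    then show ?thesis
      by (simp only: A_def q_def of_coords_line(1)[symmetric])
  qed
  have B: "ennreal ((\<phi> (of_coords (s, t)))\<^sup>2) \<le> B s" for s t
  proof -
    have "ennreal ((\<phi> (of_coords (s, 0) + t *\<^sub>R axis 2 1))\<^sup>2)
      \<le> (\<integral>\<^sup>+t. ennreal (2 * \<bar>\<phi> (of_coords (s, 0) + t *\<^sub>R axis 2 1) * pd 2 \<phi> (of_coords (s, 0) + t *\<^sub>R axis 2 1)\<bar>) \<partial>lborel)"
    proof (rule square_le_nn_integral_line[OF pd_along_line[OF d]])
      show "continuous_on UNIV (\<lambda>t. pd 2 \<phi> (of_coords (s, 0) + t *\<^sub>R axis 2 1))"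
        by (intro continuous_on_compose2[OF cont(2)] continuous_intros) auto
      show "\<phi> (of_coords (s, 0) + t *\<^sub>R axis 2 1) = 0" if "t < - \<bar>R\<bar>" for t
        by (rule out[of _ 2]) (use that in \<open>simp add: axis_def\<close>)
    qed
    then show ?thesis
      by (simp only: B_def q_def of_coords_line(2)[symmetric])
  qed
  have int: "integrable lborel (\<lambda>x. (\<phi> x)\<^sup>2)" "integrable lborel (\<lambda>x. (pd \<alpha> \<phi> x)\<^sup>2)" for \<alpha>
    unfolding power2_eq_square
    using test_fun_mult[OF \<phi> test_fun_smooth[OF \<phi>]]
      test_fun_mult[OF test_fun_pd[OF \<phi>] test_fun_smooth[OF test_fun_pd[OF \<phi>]]]
    by (blast intro: test_fun_integrable)+
  have q: "(\<integral>\<^sup>+x. ennreal (q \<alpha> x) \<partial>lborel) \<le> ennreal (\<integral>x. (\<phi> x)\<^sup>2 + (pd \<alpha> \<phi> x)\<^sup>2 \<partial>lborel)" for \<alpha>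
  proof -
    have "q \<alpha> x \<le> (\<phi> x)\<^sup>2 + (pd \<alpha> \<phi> x)\<^sup>2" for x
      using sum_squares_bound[of "\<bar>\<phi> x\<bar>" "\<bar>pd \<alpha> \<phi> x\<bar>"] by (simp add: q_def abs_mult)
    then have "(\<integral>\<^sup>+x. ennreal (q \<alpha> x) \<partial>lborel) \<le> (\<integral>\<^sup>+x. ennreal ((\<phi> x)\<^sup>2 + (pd \<alpha> \<phi> x)\<^sup>2) \<partial>lborel)"
      by (intro nn_integral_mono ennreal_leI)
    also have "\<dots> = ennreal (\<integral>x. (\<phi> x)\<^sup>2 + (pd \<alpha> \<phi> x)\<^sup>2 \<partial>lborel)"
      by (rule nn_integral_eq_integral) (use int in auto)
    finally show ?thesis .
  qed
  have "(\<integral>\<^sup>+x. ennreal ((\<phi> x) ^ 4) \<partial>lborel)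
      = (\<integral>\<^sup>+t. \<integral>\<^sup>+s. ennreal ((\<phi> (of_coords (s, t)))\<^sup>2) * ennreal ((\<phi> (of_coords (s, t)))\<^sup>2) \<partial>lborel \<partial>lborel)"
    by (subst nn_integral_real2(1)) (auto simp: ennreal_mult[symmetric] simp flip: power_add)
  also have "\<dots> \<le> (\<integral>\<^sup>+t. \<integral>\<^sup>+s. A t * B s \<partial>lborel \<partial>lborel)"
    by (intro nn_integral_mono mult_mono A B) auto
  also have "\<dots> = (\<integral>\<^sup>+t. A t \<partial>lborel) * (\<integral>\<^sup>+s. B s \<partial>lborel)"
    by (simp add: nn_integral_cmult nn_integral_multc)
  also have "(\<integral>\<^sup>+t. A t \<partial>lborel) = (\<integral>\<^sup>+x. ennreal (q 1 x) \<partial>lborel)"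
    unfolding A_def by (rule nn_integral_real2(1)[symmetric]) measurable
  also have "(\<integral>\<^sup>+s. B s \<partial>lborel) = (\<integral>\<^sup>+x. ennreal (q 2 x) \<partial>lborel)"
    unfolding B_def by (rule nn_integral_real2(2)[symmetric]) measurable
  also have "(\<integral>\<^sup>+x. ennreal (q 1 x) \<partial>lborel) * (\<integral>\<^sup>+x. ennreal (q 2 x) \<partial>lborel)
      \<le> ennreal (\<integral>x. (\<phi> x)\<^sup>2 + (pd 1 \<phi> x)\<^sup>2 \<partial>lborel) * ennreal (\<integral>x. (\<phi> x)\<^sup>2 + (pd 2 \<phi> x)\<^sup>2 \<partial>lborel)"
    by (intro mult_mono q) auto
  finally show ?thesis
    by (simp add: ennreal_mult)
qed

context bounded_open
begin

lemma L2_lim_bounded: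
  assumes F: "\<And>n. F n \<in> \<L>" and f: "f \<in> \<L>" and lim: "L2_to F f"
  obtains M where "M \<ge> 0" "\<And>n. (\<integral>x. (F n x)\<^sup>2 \<partial>\<mu>) \<le> M"
proof -
  obtain C where C: "\<And>n. \<bar>\<integral>x. (F n x - f x)\<^sup>2 \<partial>\<mu>\<bar> \<le> C"
    using lim convergent_imp_Bseq[of "\<lambda>n. \<integral>x. (F n x - f x)\<^sup>2 \<partial>\<mu>"]
    unfolding L2_lim_def convergent_def Bseq_def by auto
  have "(\<integral>x. (F n x)\<^sup>2 \<partial>\<mu>) \<le> 2 * \<bar>C\<bar> + 2 * (\<integral>x. (f x)\<^sup>2 \<partial>\<mu>)" for n
  proof -
    have i: "integrable \<mu> (\<lambda>x. (F n x - f x)\<^sup>2)" "integrable \<mu> (\<lambda>x. (f x)\<^sup>2)"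
      using L2_square_integrable L2_diff[OF F f] f by auto
    have "(\<integral>x. (F n x)\<^sup>2 \<partial>\<mu>) \<le> (\<integral>x. 2 * (F n x - f x)\<^sup>2 + 2 * (f x)\<^sup>2 \<partial>\<mu>)"
    proof (rule integral_mono)
      show "(F n x)\<^sup>2 \<le> 2 * (F n x - f x)\<^sup>2 + 2 * (f x)\<^sup>2" for x
        using square_add_le[of "F n x - f x" "f x"] by simp
    qed (use i L2_square_integrable[OF F] in auto)
    also have "\<dots> = 2 * (\<integral>x. (F n x - f x)\<^sup>2 \<partial>\<mu>) + 2 * (\<integral>x. (f x)\<^sup>2 \<partial>\<mu>)"
      using i by simp
    finally show ?thesis using C[of n] by linarith
  qed
  then show ?thesis
    using that[of "2 * \<bar>C\<bar> + 2 * (\<integral>x. (f x)\<^sup>2 \<partial>\<mu>)"] by simp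
qed

lemma W12_0_square_L2:
  assumes f: "f \<in> W1\<^sub>0"
  shows "(\<lambda>x. (f x)\<^sup>2) \<in> \<L>"
proof -
  obtain \<phi> where a: "\<And>n. \<phi> n \<in> \<T>" "L2_to \<phi> f" "\<And>\<alpha>. L2_to (\<lambda>n. pd \<alpha> (\<phi> n)) (wd \<alpha> f)"
    using f by (auto simp: W12_0_def)
  have L: "f \<in> \<L>" "\<And>\<alpha>. wd \<alpha> f \<in> \<L>" "\<And>n. \<phi> n \<in> \<L>" "\<And>\<alpha> n. pd \<alpha> (\<phi> n) \<in> \<L>"
    using f a(1) W12_L2 W12_wpd_L2 W12_0_W12 test_fun_L2 test_fun_pd_L2 by auto
  obtain M0 where M0: "M0 \<ge> 0" "\<And>n. (\<integral>x. (\<phi> n x)\<^sup>2 \<partial>\<mu>) \<le> M0"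
    using L2_lim_bounded[OF L(3) L(1) a(2)] by blast
  obtain M1 where M1: "M1 \<ge> 0" "\<And>n. (\<integral>x. (pd 1 (\<phi> n) x)\<^sup>2 \<partial>\<mu>) \<le> M1"
    using L2_lim_bounded[OF L(4) L(2) a(3)] by blast
  obtain M2 where M2: "M2 \<ge> 0" "\<And>n. (\<integral>x. (pd 2 (\<phi> n) x)\<^sup>2 \<partial>\<mu>) \<le> M2"
    using L2_lim_bounded[OF L(4) L(2) a(3)] by blast
  have b: "(\<integral>\<^sup>+x. ennreal ((\<phi> n x) ^ 4) \<partial>\<mu>) \<le> ennreal ((M0 + M1) * (M0 + M2))" for n
  proof -
    have t: "(\<lambda>x. (\<phi> n x)\<^sup>2) \<in> \<T>" "(\<lambda>x. (pd \<alpha> (\<phi> n) x)\<^sup>2) \<in> \<T>" for \<alpha>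
      unfolding power2_eq_square
      using test_fun_mult[OF a(1) test_fun_smooth[OF a(1)]]
        test_fun_mult[OF test_fun_pd[OF a(1)] test_fun_smooth[OF test_fun_pd[OF a(1)]]] by blast+
    have e: "(\<integral>x. (\<phi> n x)\<^sup>2 + (pd \<alpha> (\<phi> n) x)\<^sup>2 \<partial>lborel) = (\<integral>x. (\<phi> n x)\<^sup>2 \<partial>\<mu>) + (\<integral>x. (pd \<alpha> (\<phi> n) x)\<^sup>2 \<partial>\<mu>)" for \<alpha>
      using test_fun_integrable[OF t(1)] test_fun_integrable[OF t(2)]
        test_fun_integral_lebesgue_on(2)[OF t(1) open_dom] test_fun_integral_lebesgue_on(2)[OF t(2) open_dom]
      by simp
    have m: "(\<lambda>x. ennreal ((\<phi> n x) ^ 4)) \<in> borel_measurable borel"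
      using test_fun_continuous[OF a(1)[of n]] by (auto intro!: borel_measurable_continuous_onI continuous_intros)
    have "(\<integral>\<^sup>+x. ennreal ((\<phi> n x) ^ 4) \<partial>\<mu>) \<le> (\<integral>\<^sup>+x. ennreal ((\<phi> n x) ^ 4) \<partial>lebesgue)"
      by (subst nn_integral_restrict_space) (auto intro!: nn_integral_mono simp: indicator_def)
    also have "\<dots> = (\<integral>\<^sup>+x. ennreal ((\<phi> n x) ^ 4) \<partial>lborel)"
      by (rule nn_integral_completion)
    also have "\<dots> \<le> ennreal ((\<integral>x. (\<phi> n x)\<^sup>2 + (pd 1 (\<phi> n) x)\<^sup>2 \<partial>lborel) * (\<integral>x. (\<phi> n x)\<^sup>2 + (pd 2 (\<phi> n) x)\<^sup>2 \<partial>lborel))"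
      by (rule test_fun_fourth_power[OF a(1) open_dom])
    also have "\<dots> \<le> ennreal ((M0 + M1) * (M0 + M2))"
      unfolding e using M0 M1 M2 by (intro ennreal_leI mult_mono add_mono) auto
    finally show ?thesis .
  qed
  have "\<exists>r::nat\<Rightarrow>nat. strict_mono r \<and> (AE x in \<mu>. (\<lambda>n. (\<phi> (r n) x - f x)\<^sup>2) \<longlonglongrightarrow> 0)"
  proof (rule tendsto_L1_AE_subseq)
    show "integrable \<mu> (\<lambda>x. (\<phi> n x - f x)\<^sup>2)" for n
      using L2_square_integrable L2_diff[OF L(3) L(1)] by blast
    show "(\<lambda>n. \<integral>x. norm ((\<phi> n x - f x)\<^sup>2) \<partial>\<mu>) \<longlonglongrightarrow> 0"
      using a(2) by (simp add: L2_lim_def)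
  qed
  then obtain r where r: "AE x in \<mu>. (\<lambda>n. (\<phi> (r n) x - f x)\<^sup>2) \<longlonglongrightarrow> 0"
    by blast
  have [measurable]: "f \<in> borel_measurable \<mu>" "\<And>n. \<phi> n \<in> borel_measurable \<mu>"
    using L L2_measurable by auto
  have "(\<integral>\<^sup>+x. ennreal ((f x) ^ 4) \<partial>\<mu>) = (\<integral>\<^sup>+x. liminf (\<lambda>n. ennreal ((\<phi> (r n) x) ^ 4)) \<partial>\<mu>)"
  proof (rule nn_integral_cong_AE)
    show "AE x in \<mu>. ennreal ((f x) ^ 4) = liminf (\<lambda>n. ennreal ((\<phi> (r n) x) ^ 4))"
      using r
    proof eventually_elim
      case (elim x)
      then have "(\<lambda>n. \<phi> (r n) x - f x) \<longlonglongrightarrow> 0"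
        by (simp add: tendsto_null_power)
      then have "(\<lambda>n. \<phi> (r n) x) \<longlonglongrightarrow> f x"
        by (simp add: LIM_zero_iff)
      then have "(\<lambda>n. ennreal ((\<phi> (r n) x) ^ 4)) \<longlonglongrightarrow> ennreal ((f x) ^ 4)"
        by (intro tendsto_ennrealI tendsto_power)
      then show ?case
        by (intro lim_imp_Liminf[symmetric]) auto
    qed
  qed
  also have "\<dots> \<le> liminf (\<lambda>n. \<integral>\<^sup>+x. ennreal ((\<phi> (r n) x) ^ 4) \<partial>\<mu>)"
    by (rule nn_integral_liminf) measurable
  also have "\<dots> \<le> ennreal ((M0 + M1) * (M0 + M2))"
    using b by (intro Liminf_le) (auto intro!: always_eventually)
  also have "\<dots> < \<infinity>" by simp
  finally have "integrable \<mu> (\<lambda>x. (f x) ^ 4)"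
    by (intro integrableI_bounded) (auto simp: zero_le_even_power)
  then show ?thesis
    by (simp add: L2_iff flip: power_mult)
qed

lemma W12_0_mult_L2:
  assumes f: "f \<in> W1\<^sub>0" and g: "g \<in> W1\<^sub>0"
  shows "(\<lambda>x. f x * g x) \<in> \<L>"
proof -
  have "(\<lambda>x. f x * g x) = (\<lambda>x. 1/4 * (f x + 1 * g x)\<^sup>2 - 1/4 * (f x + (- 1) * g x)\<^sup>2)"
    by (auto simp: fun_eq_iff power2_eq_square algebra_simps)
  then show ?thesis
    using W12_0_square_L2[OF W12_0_lincomb[OF f g]]
    by (simp only: L2_diff L2_cmult)
qed

end

section \<open>Isotropic elasticity tensors\<close>

definition iso_tensor :: "real \<Rightarrow> real \<Rightarrow> tensor4" where
  "iso_tensor a b \<alpha> \<beta> l m = a * kd \<alpha> \<beta> * kd l m + b * (kd \<alpha> l * kd \<beta> m + kd \<alpha> m * kd \<beta> l)"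

definition sym_part :: "real^2^2 \<Rightarrow> real^2^2" where
  "sym_part A = (\<chi> \<alpha> \<beta>. (A $ \<alpha> $ \<beta> + A $ \<beta> $ \<alpha>) / 2)"

lemma sym_part_nth [simp]: "sym_part A $ \<alpha> $ \<beta> = (A $ \<alpha> $ \<beta> + A $ \<beta> $ \<alpha>) / 2"
  by (simp add: sym_part_def)

lemma mat2_eq_iff: "A = B \<longleftrightarrow> A $ 1 $ 1 = B $ 1 $ 1 \<and> A $ 1 $ 2 = B $ 1 $ 2 \<and> A $ 2 $ 1 = B $ 2 $ 1 \<and> A $ 2 $ 2 = B $ 2 $ 2"
  for A B :: "real^2^2"
  by (auto simp: vec_eq_iff forall_2)

lemma inner_mat2: "A \<bullet> B = A $ 1 $ 1 * B $ 1 $ 1 + A $ 1 $ 2 * B $ 1 $ 2 + A $ 2 $ 1 * B $ 2 $ 1 + A $ 2 $ 2 * B $ 2 $ 2"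
  for A B :: "real^2^2"
  by (simp add: inner_vec_def sum_2)

lemma inner_vec2: "x \<bullet> y = x $ 1 * y $ 1 + x $ 2 * y $ 2" for x y :: "real^2"
  by (simp add: inner_vec_def sum_2)

lemma sym_mat_iff: "A \<in> sym_mat \<longleftrightarrow> A $ 1 $ 2 = A $ 2 $ 1"
  by (auto simp: sym_mat_def mat2_eq_iff transpose_def)

lemma kd_simps [simp]: "kd 1 1 = 1" "kd 2 2 = 1" "kd 1 2 = 0" "kd 2 1 = 0"
  by (auto simp: kd_def)

lemma tensor_apply_iso:
  "tensor_apply (iso_tensor a b) A $ 1 $ 1 = a * (A $ 1 $ 1 + A $ 2 $ 2) + 2 * b * A $ 1 $ 1"
  "tensor_apply (iso_tensor a b) A $ 2 $ 2 = a * (A $ 1 $ 1 + A $ 2 $ 2) + 2 * b * A $ 2 $ 2"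
  "tensor_apply (iso_tensor a b) A $ 1 $ 2 = b * (A $ 1 $ 2 + A $ 2 $ 1)"
  "tensor_apply (iso_tensor a b) A $ 2 $ 1 = b * (A $ 1 $ 2 + A $ 2 $ 1)"
  by (simp_all add: tensor_apply_def iso_tensor_def sum_2 algebra_simps)

lemma tensor_form_iso: "tensor_form (iso_tensor a b) A B = tensor_apply (iso_tensor a b) A \<bullet> B"
  by (simp add: tensor_form_def inner_mat2 tensor_apply_iso iso_tensor_def sum_2 algebra_simps)

lemma tensor_form_iso_commute: "tensor_form (iso_tensor a b) A B = tensor_form (iso_tensor a b) B A"
  by (simp add: tensor_form_iso inner_mat2 tensor_apply_iso algebra_simps)

lemma tensor_form_iso_square:
  "tensor_form (iso_tensor a b) (A + c *\<^sub>R A') (A + c *\<^sub>R A')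
    = tensor_form (iso_tensor a b) A A + 2 * c * tensor_form (iso_tensor a b) A A' + c\<^sup>2 * tensor_form (iso_tensor a b) A' A'"
  by (simp add: tensor_form_iso inner_mat2 tensor_apply_iso algebra_simps power2_eq_square)

lemma tensor_form_iso_nonneg:
  assumes "a \<ge> 0" "b > 0"
  shows "tensor_form (iso_tensor a b) A A \<ge> 0"
proof -
  have "tensor_form (iso_tensor a b) A A = a * (A $ 1 $ 1 + A $ 2 $ 2)\<^sup>2
      + 2 * b * ((A $ 1 $ 1)\<^sup>2 + (A $ 2 $ 2)\<^sup>2) + b * (A $ 1 $ 2 + A $ 2 $ 1)\<^sup>2"
    by (simp add: tensor_form_iso inner_mat2 tensor_apply_iso algebra_simps power2_eq_square)
  with assms show ?thesis by simp
qed

lemma tensor_apply_iso_sym: "tensor_apply (iso_tensor a b) A \<in> sym_mat"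
  by (simp add: sym_mat_iff tensor_apply_iso)

lemma tensor_apply_iso_sym_part: "tensor_apply (iso_tensor a b) (sym_part A) = tensor_apply (iso_tensor a b) A"
  by (simp add: mat2_eq_iff tensor_apply_iso algebra_simps)

lemma tensor_apply_iso_compose:
  "tensor_apply (iso_tensor a b) (tensor_apply (iso_tensor c d) S)
    = tensor_apply (iso_tensor (a * (2 * c + 2 * d) + 2 * b * c) (2 * b * d)) S"
  by (simp add: mat2_eq_iff tensor_apply_iso algebra_simps)

lemma tensor_apply_identity: "S \<in> sym_mat \<Longrightarrow> tensor_apply (iso_tensor 0 (1 / 2)) S = S"
  by (simp add: mat2_eq_iff tensor_apply_iso sym_mat_iff)

locale isotropic =
  fixes a b :: real
  assumes a_nonneg: "a \<ge> 0" and b_pos: "b > 0"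
begin

definition inv_a :: real where "inv_a = - a / (4 * b * (a + b))"
definition inv_b :: real where "inv_b = 1 / (4 * b)"

lemma inverse_coefficients: "2 * b * inv_b = 1 / 2" "a * (2 * inv_a + 2 * inv_b) + 2 * b * inv_a = 0"
proof -
  have "a + b \<noteq> 0" using a_nonneg b_pos by simp
  then show "a * (2 * inv_a + 2 * inv_b) + 2 * b * inv_a = 0"
    using b_pos unfolding inv_a_def inv_b_def by (simp add: divide_simps)
qed (use b_pos in \<open>simp add: inv_b_def\<close>)

lemma iso_inverse_right: "S \<in> sym_mat \<Longrightarrow> tensor_apply (iso_tensor a b) (tensor_apply (iso_tensor inv_a inv_b) S) = S"
  by (simp only: tensor_apply_iso_compose inverse_coefficients tensor_apply_identity)

lemma iso_inverse_left:
  "S \<in> sym_mat \<Longrightarrow> tensor_apply (iso_tensor inv_a inv_b) (tensor_apply (iso_tensor a b) S) = S"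
proof -
  have "inv_a * (2 * a + 2 * b) + 2 * inv_b * a = 0" "2 * inv_b * b = 1 / 2"
    using inverse_coefficients by (simp_all add: algebra_simps)
  then show "S \<in> sym_mat \<Longrightarrow> tensor_apply (iso_tensor inv_a inv_b) (tensor_apply (iso_tensor a b) S) = S"
    by (simp only: tensor_apply_iso_compose tensor_apply_identity)
qed

lemma tensor_inv_iso: "tensor_inv (iso_tensor a b) = iso_tensor inv_a inv_b"
proof (intro ext)
  fix \<alpha> \<beta> l m :: 2
  let ?E = "(\<chi> i j. (kd i l * kd j m + kd i m * kd j l) / 2) :: real^2^2"
  have E: "?E \<in> sym_mat"
    by (simp add: sym_mat_iff)
  have "inj_on (tensor_apply (iso_tensor a b)) sym_mat"
    by (rule inj_on_inverseI) (rule iso_inverse_left)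
  then have "inv_into sym_mat (tensor_apply (iso_tensor a b)) ?E = tensor_apply (iso_tensor inv_a inv_b) ?E"
    by (rule inv_into_f_eq) (simp_all add: tensor_apply_iso_sym iso_inverse_right[OF E])
  then have "tensor_inv (iso_tensor a b) \<alpha> \<beta> l m = tensor_apply (iso_tensor inv_a inv_b) ?E $ \<alpha> $ \<beta>"
    by (simp add: tensor_inv_def)
  also have "\<dots> = iso_tensor inv_a inv_b \<alpha> \<beta> l m"
    using exhaust_2[of \<alpha>] exhaust_2[of \<beta>] exhaust_2[of l] exhaust_2[of m]
    by (elim disjE; simp add: tensor_apply_iso iso_tensor_def)
  finally show "tensor_inv (iso_tensor a b) \<alpha> \<beta> l m = iso_tensor inv_a inv_b \<alpha> \<beta> l m" .
qed

lemma inverse_form_nonneg: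
  assumes "S \<in> sym_mat"
  shows "tensor_form (iso_tensor inv_a inv_b) S S \<ge> 0"
proof -
  have "tensor_form (iso_tensor inv_a inv_b) S S = tensor_form (iso_tensor a b) (tensor_apply (iso_tensor inv_a inv_b) S) (tensor_apply (iso_tensor inv_a inv_b) S)"
    using iso_inverse_right[OF assms] by (simp add: tensor_form_iso inner_commute)
  then show ?thesis using tensor_form_iso_nonneg a_nonneg b_pos by simp
qed

text \<open>Fenchel's inequality for the quadratic form and its inverse, by completing the square.\<close>

lemma iso_fenchel:
  assumes "S \<in> sym_mat"
  shows "A \<bullet> S \<le> tensor_form (iso_tensor a b) A A / 2 + tensor_form (iso_tensor inv_a inv_b) S S / 2"
proof -
  let ?X = "tensor_apply (iso_tensor inv_a inv_b) S"
  have "0 \<le> tensor_form (iso_tensor a b) (A + (- 1) *\<^sub>R ?X) (A + (- 1) *\<^sub>R ?X)"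
    using tensor_form_iso_nonneg a_nonneg b_pos by blast
  also have "\<dots> = tensor_form (iso_tensor a b) A A - 2 * tensor_form (iso_tensor a b) A ?X + tensor_form (iso_tensor a b) ?X ?X"
    unfolding tensor_form_iso_square by simp
  also have "tensor_form (iso_tensor a b) A ?X = S \<bullet> A"
    using iso_inverse_right[OF assms] by (subst tensor_form_iso_commute) (simp add: tensor_form_iso)
  also have "tensor_form (iso_tensor a b) ?X ?X = tensor_form (iso_tensor inv_a inv_b) S S"
    using iso_inverse_right[OF assms] by (simp add: tensor_form_iso inner_commute)
  finally show ?thesis by (simp add: inner_commute)
qed

lemma iso_fenchel_equality:
  assumes S: "S \<in> sym_mat" and eq: "tensor_apply (iso_tensor inv_a inv_b) S = sym_part A"
  shows "tensor_form (iso_tensor a b) A B = S \<bullet> B" "tensor_form (iso_tensor inv_a inv_b) S S = S \<bullet> A"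
proof -
  have "tensor_apply (iso_tensor a b) A = S"
    using iso_inverse_right[OF S] eq by (simp add: tensor_apply_iso_sym_part)
  then show "tensor_form (iso_tensor a b) A B = S \<bullet> B" by (simp add: tensor_form_iso)
  show "tensor_form (iso_tensor inv_a inv_b) S S = S \<bullet> A"
    using S by (simp add: tensor_form_iso eq inner_mat2 sym_mat_iff algebra_simps)
qed

end

lemma H_tensor_iso: "H_tensor h la mu = iso_tensor (h * (4 * la * mu / (la + 2 * mu))) (h * (2 * mu))"
  by (auto simp: fun_eq_iff H_tensor_def iso_tensor_def algebra_simps)

lemma h_tensor_iso:
  "h_tensor h la mu = iso_tensor (h\<^sup>2 / 3 * (h * (4 * la * mu / (la + 2 * mu)))) (h\<^sup>2 / 3 * (h * (2 * mu)))"
  by (auto simp: fun_eq_iff h_tensor_def H_tensor_iso iso_tensor_def algebra_simps)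

section \<open>Positive definite matrices of order two\<close>

lemma matrix_vector_2: "(A *v x) $ 1 = A $ 1 $ 1 * x $ 1 + A $ 1 $ 2 * x $ 2"
  "(A *v x) $ 2 = A $ 2 $ 1 * x $ 1 + A $ 2 $ 2 * x $ 2" for A :: "real^2^2"
  by (simp_all add: matrix_vector_mult_def sum_2)

lemma quadratic_form_2: "A $ 1 $ 2 = A $ 2 $ 1 \<Longrightarrow>
  x \<bullet> (A *v x) = A $ 1 $ 1 * (x $ 1)\<^sup>2 + 2 * A $ 1 $ 2 * x $ 1 * x $ 2 + A $ 2 $ 2 * (x $ 2)\<^sup>2"
  for A :: "real^2^2"
  by (simp add: inner_vec2 matrix_vector_2 algebra_simps power2_eq_square)

definition det2 :: "real^2^2 \<Rightarrow> real" where
  "det2 A = A $ 1 $ 1 * A $ 2 $ 2 - A $ 1 $ 2 * A $ 2 $ 1"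

lemma pos_def_entries:
  assumes "pos_def A"
  shows "A $ 1 $ 2 = A $ 2 $ 1" "A $ 1 $ 1 > 0" "A $ 2 $ 2 > 0" "det2 A > 0"
proof -
  show sym: "A $ 1 $ 2 = A $ 2 $ 1" using assms by (simp add: pos_def_def sym_mat_iff)
  have pos: "0 < x \<bullet> (A *v x)" if "x \<noteq> 0" for x
    using assms that by (simp add: pos_def_def)
  show p: "A $ 1 $ 1 > 0" "A $ 2 $ 2 > 0"
    using pos[of "axis 1 1"] pos[of "axis 2 1"]
    by (simp_all add: quadratic_form_2[OF sym] axis_eq_0_iff) (simp_all add: axis_def)
  let ?x = "(\<chi> i. if i = 1 then - A $ 1 $ 2 else A $ 1 $ 1) :: real^2"
  have "?x $ 2 \<noteq> 0" using p by simp
  then have "?x \<noteq> 0" by (metis zero_index)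
  from pos[OF this] have "0 < A $ 1 $ 1 * det2 A"
    by (simp add: quadratic_form_2[OF sym] det2_def sym algebra_simps power2_eq_square)
  then show "det2 A > 0" using p by (simp add: zero_less_mult_iff)
qed

definition inv_apply :: "real^2^2 \<Rightarrow> real^2 \<Rightarrow> real^2" where
  "inv_apply A q = (\<chi> i. (if i = 1 then A $ 2 $ 2 * q $ 1 - A $ 1 $ 2 * q $ 2
     else A $ 1 $ 1 * q $ 2 - A $ 2 $ 1 * q $ 1) / det2 A)"

lemma inv_apply_nth [simp]:
  "inv_apply A q $ 1 = (A $ 2 $ 2 * q $ 1 - A $ 1 $ 2 * q $ 2) / det2 A"
  "inv_apply A q $ 2 = (A $ 1 $ 1 * q $ 2 - A $ 2 $ 1 * q $ 1) / det2 A"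
  by (simp_all add: inv_apply_def)

lemma vec2_eq_iff: "x = y \<longleftrightarrow> x $ 1 = y $ 1 \<and> x $ 2 = y $ 2" for x y :: "real^2"
  by (simp add: vec_eq_iff forall_2)

lemma mult_inv_apply: "det2 A \<noteq> 0 \<Longrightarrow> A *v inv_apply A q = q"
  by (auto simp: vec2_eq_iff matrix_vector_2 field_simps) (auto simp: det2_def algebra_simps)

lemma inv_apply_mult: "det2 A \<noteq> 0 \<Longrightarrow> inv_apply A (A *v x) = x"
  by (auto simp: vec2_eq_iff matrix_vector_2 field_simps) (auto simp: det2_def algebra_simps)

lemma matrix_inv_apply:
  assumes "det2 A \<noteq> 0"
  shows "matrix_inv A *v q = inv_apply A q"
proof -
  have "invertible A"
    using assms by (simp add: invertible_det_nz det_2 det2_def)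
  then have "A ** matrix_inv A = mat 1"
    unfolding invertible_def matrix_inv_def by (rule someI2_ex) simp
  then have "A *v (matrix_inv A *v q) = q"
    by (simp add: matrix_vector_mul_assoc)
  then show ?thesis
    using inv_apply_mult[OF assms, of "matrix_inv A *v q"] by simp
qed

lemma inv_apply_lincomb: "inv_apply A (x + c *\<^sub>R y) = inv_apply A x + c *\<^sub>R inv_apply A y"
  by (simp add: vec2_eq_iff add_divide_distrib diff_divide_distrib algebra_simps)

lemma inv_apply_self_adjoint: "A $ 1 $ 2 = A $ 2 $ 1 \<Longrightarrow> x \<bullet> inv_apply A y = y \<bullet> inv_apply A x"
  by (simp add: inner_vec2 add_divide_distrib[symmetric] algebra_simps)

lemma pos_def_nonneg: "pos_def A \<Longrightarrow> 0 \<le> x \<bullet> (A *v x)"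
  by (cases "x = 0") (auto simp: pos_def_def less_imp_le)

lemma inv_apply_form:
  assumes "pos_def A"
  shows "q \<bullet> inv_apply A q = inv_apply A q \<bullet> (A *v inv_apply A q)" "0 \<le> q \<bullet> inv_apply A q"
proof -
  show "q \<bullet> inv_apply A q = inv_apply A q \<bullet> (A *v inv_apply A q)"
    using pos_def_entries(4)[OF assms] by (simp add: mult_inv_apply inner_commute)
  then show "0 \<le> q \<bullet> inv_apply A q" using pos_def_nonneg[OF assms] by simp
qed

text \<open>The quadratic form of the inverse matrix as a supremum of affine functions of the matrix and
  the vector; it is attained at \<open>y = inv_apply A q\<close>.\<close>

lemma inverse_form_fenchel:
  assumes "pos_def A"
  shows "2 * (q \<bullet> y) - y \<bullet> (A *v y) \<le> q \<bullet> inv_apply A q"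
proof -
  note e = pos_def_entries[OF assms]
  define z where "z = inv_apply A q"
  have q: "q = A *v z" using e by (simp add: z_def mult_inv_apply)
  have "0 \<le> (z - y) \<bullet> (A *v (z - y))" by (rule pos_def_nonneg[OF assms])
  also have "\<dots> = q \<bullet> z - (2 * (q \<bullet> y) - y \<bullet> (A *v y))"
    unfolding q using e by (simp add: inner_vec2 matrix_vector_2 algebra_simps)
  finally show ?thesis by (simp add: z_def)
qed

lemma inverse_form_square_add_le:
  assumes "pos_def A"
  shows "(x + y) \<bullet> inv_apply A (x + y) \<le> 2 * (x \<bullet> inv_apply A x) + 2 * (y \<bullet> inv_apply A y)"
proof -
  have "0 \<le> (x + (- 1) *\<^sub>R y) \<bullet> inv_apply A (x + (- 1) *\<^sub>R y)"
    by (rule inv_apply_form[OF assms])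
  then have "0 \<le> x \<bullet> inv_apply A x - 2 * (x \<bullet> inv_apply A y) + y \<bullet> inv_apply A y"
    using inv_apply_self_adjoint[OF pos_def_entries(1)[OF assms], of x y]
    unfolding inv_apply_lincomb by (simp add: inner_simps)
  moreover have "inv_apply A (x + y) = inv_apply A x + inv_apply A y"
    using inv_apply_lincomb[of A x 1 y] by simp
  ultimately show ?thesis
    using inv_apply_self_adjoint[OF pos_def_entries(1)[OF assms], of x y] by (simp add: inner_simps)
qed

text \<open>For a symmetric matrix of order two the smallest eigenvalue is at least the determinant over
  the trace, since \<open>A\<^sup>2 = tr A A - det A\<close> by the Cayley-Hamilton theorem.\<close>

definition eig_bound :: "real^2^2 \<Rightarrow> real" where
  "eig_bound A = det2 A / (A $ 1 $ 1 + A $ 2 $ 2)"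

lemma eig_bound:
  assumes "pos_def A"
  shows "eig_bound A > 0" "eig_bound A * (norm x)\<^sup>2 \<le> x \<bullet> (A *v x)"
proof -
  note e = pos_def_entries[OF assms]
  show "eig_bound A > 0" using e by (simp add: eig_bound_def)
  have "det2 A * (norm x)\<^sup>2 + (norm (A *v x))\<^sup>2 = (A $ 1 $ 1 + A $ 2 $ 2) * (x \<bullet> (A *v x))"
    using e(1) by (simp add: power2_norm_eq_inner inner_vec2 matrix_vector_2 det2_def algebra_simps)
  then have "det2 A * (norm x)\<^sup>2 \<le> (A $ 1 $ 1 + A $ 2 $ 2) * (x \<bullet> (A *v x))"
    using zero_le_power2[of "norm (A *v x)"] by linarith
  then show "eig_bound A * (norm x)\<^sup>2 \<le> x \<bullet> (A *v x)"
    using e by (simp add: eig_bound_def field_simps)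
qed

text \<open>The weight \<open>m\<close> compensates a degeneration of \<open>A\<close>: the norm of \<open>inv_apply A (m *\<^sub>R x)\<close> is at most
  that of \<open>x\<close>.\<close>

lemma inverse_form_bound:
  assumes "pos_def A" "0 < m" "m \<le> eig_bound A" "m \<le> 1"
  shows "(m *\<^sub>R x) \<bullet> inv_apply A (m *\<^sub>R x) \<le> (norm x)\<^sup>2"
proof -
  define z where "z = inv_apply A (m *\<^sub>R x)"
  have pos: "eig_bound A > 0" using eig_bound[OF assms(1)] by simp
  have az: "A *v z = m *\<^sub>R x"
    using pos_def_entries(4)[OF assms(1)] by (simp add: z_def mult_inv_apply)
  have "m * (norm z)\<^sup>2 \<le> eig_bound A * (norm z)\<^sup>2" using assms by (simp add: mult_right_mono)
  also have "\<dots> \<le> z \<bullet> (A *v z)" by (rule eig_bound[OF assms(1)])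
  also have "\<dots> \<le> m * (norm x * norm z)"
    using norm_cauchy_schwarz[of z x] assms(2) by (simp add: az mult.commute)
  finally have "m * (norm z)\<^sup>2 \<le> m * (norm x * norm z)" .
  then have "norm z * norm z \<le> norm x * norm z" using assms(2) by (simp add: power2_eq_square)
  then have "norm z \<le> norm x"
    by (cases "norm z = 0") (auto simp: mult_le_cancel_right)
  have "(m *\<^sub>R x) \<bullet> z \<le> m * (norm x * norm z)"
    using norm_cauchy_schwarz[of x z] assms(2) by simp
  also have "\<dots> \<le> 1 * (norm x * norm x)"
    using assms \<open>norm z \<le> norm x\<close> by (intro mult_mono) auto
  finally show ?thesis by (simp add: z_def power2_eq_square)
qed

text \<open>A perturbation that is small relative to the eigenvalues keeps at least half of the quadratic
  form, hence at most doubles the inverse form.\<close>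

lemma pos_def_perturb:
  assumes A: "pos_def A" and C: "C \<in> sym_mat" "\<And>i j. \<bar>C $ i $ j\<bar> \<le> 1"
    and m: "0 < m" "m \<le> eig_bound A" and t: "\<bar>t\<bar> \<le> 1 / 4"
  shows "pos_def (A + (t * m) *\<^sub>R C)"
    and "q \<bullet> inv_apply (A + (t * m) *\<^sub>R C) q \<le> 2 * (q \<bullet> inv_apply A q)"
proof -
  let ?B = "A + (t * m) *\<^sub>R C"
  have e: "eig_bound A > 0" using eig_bound[OF A] by simp
  have half: "(x \<bullet> (A *v x)) / 2 \<le> x \<bullet> (?B *v x)" for x
  proof -
    have "\<bar>C $ i $ j * (x $ i * x $ j)\<bar> \<le> \<bar>x $ i * x $ j\<bar>" for i j
      using C(2)[of i j] mult_right_mono[of "\<bar>C $ i $ j\<bar>" 1 "\<bar>x $ i * x $ j\<bar>"] by (simp add: abs_mult)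
    note b = this[of 1 1] this[of 1 2] this[of 2 1] this[of 2 2]
    have "x \<bullet> (C *v x) = C $ 1 $ 1 * (x $ 1 * x $ 1) + C $ 1 $ 2 * (x $ 1 * x $ 2)
        + C $ 2 $ 1 * (x $ 2 * x $ 1) + C $ 2 $ 2 * (x $ 2 * x $ 2)"
      by (simp add: inner_vec2 matrix_vector_2 algebra_simps)
    moreover have "2 * \<bar>x $ 1 * x $ 2\<bar> \<le> x $ 1 * x $ 1 + x $ 2 * x $ 2"
      using sum_squares_bound[of "\<bar>x $ 1\<bar>" "\<bar>x $ 2\<bar>"] by (simp add: abs_mult power2_eq_square)
    moreover have "(norm x)\<^sup>2 = x $ 1 * x $ 1 + x $ 2 * x $ 2"
      by (simp add: power2_norm_eq_inner inner_vec2)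
    ultimately have c: "\<bar>x \<bullet> (C *v x)\<bar> \<le> 2 * (norm x)\<^sup>2"
      using b by (simp add: mult.commute[of "x $ 2" "x $ 1"])
    have "\<bar>t\<bar> * m \<le> 1 / 4 * eig_bound A"
      using m t e by (intro mult_mono) auto
    then have "\<bar>t * m\<bar> * \<bar>x \<bullet> (C *v x)\<bar> \<le> (1 / 4 * eig_bound A) * (2 * (norm x)\<^sup>2)"
      using m e c by (intro mult_mono) (auto simp: abs_mult)
    also have "\<dots> \<le> (x \<bullet> (A *v x)) / 2" using eig_bound(2)[OF A, of x] by simp
    finally have "\<bar>(t * m) * (x \<bullet> (C *v x))\<bar> \<le> (x \<bullet> (A *v x)) / 2" by (simp add: abs_mult)
    moreover have "x \<bullet> (?B *v x) = x \<bullet> (A *v x) + (t * m) * (x \<bullet> (C *v x))"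
      by (simp add: inner_vec2 matrix_vector_2 algebra_simps)
    ultimately show ?thesis by linarith
  qed
  show B: "pos_def ?B"
    unfolding pos_def_def
  proof (intro conjI allI impI)
    show "?B \<in> sym_mat" using pos_def_entries(1)[OF A] C(1) by (simp add: sym_mat_iff)
    fix x :: "real^2" assume "x \<noteq> 0"
    then have "0 < x \<bullet> (A *v x)" using A by (simp add: pos_def_def)
    then show "0 < x \<bullet> (?B *v x)" using half[of x] by linarith
  qed
  define y where "y = inv_apply ?B q"
  have "q \<bullet> y = y \<bullet> (?B *v y)" unfolding y_def by (rule inv_apply_form[OF B])
  then have "y \<bullet> (A *v y) \<le> 2 * (q \<bullet> y)" using half[of y] by linarith
  moreover have "2 * (q \<bullet> ((1 / 2) *\<^sub>R y)) - ((1 / 2) *\<^sub>R y) \<bullet> (A *v ((1 / 2) *\<^sub>R y)) \<le> q \<bullet> inv_apply A q"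
    by (rule inverse_form_fenchel[OF A])
  moreover have "2 * (q \<bullet> ((1 / 2) *\<^sub>R y)) - ((1 / 2) *\<^sub>R y) \<bullet> (A *v ((1 / 2) *\<^sub>R y))
      = q \<bullet> y - (y \<bullet> (A *v y)) / 4"
    by (simp add: inner_vec2 matrix_vector_2 field_simps)
  ultimately show "q \<bullet> inv_apply ?B q \<le> 2 * (q \<bullet> inv_apply A q)"
    unfolding y_def[symmetric] by linarith
qed

section \<open>Vector and matrix fields\<close>

context bounded_open
begin

lemma tensor_form_integrable:
  assumes "A \<in> \<L>" "B \<in> \<L>"
  shows "integrable \<mu> (\<lambda>x. tensor_form T (A x) (B x))"
proof -
  have "integrable \<mu> (\<lambda>x. T \<alpha> \<beta> l m * (A x $ \<alpha> $ \<beta> * B x $ l $ m))" for \<alpha> \<beta> l m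
    using assms by (intro integrable_mult_right L2_mult_integrable) (simp_all add: L2_vec_iff)
  then show ?thesis
    unfolding tensor_form_def by (intro Bochner_Integration.integrable_sum) (simp add: mult.assoc)
qed

lemma tensor_apply_L2:
  assumes "A \<in> \<L>"
  shows "(\<lambda>x. tensor_apply T (A x)) \<in> \<L>"
  using assms by (auto simp: L2_vec_iff tensor_apply_def intro!: L2_sum L2_cmult)

lemma identity_field_L2: "z \<in> \<L> \<Longrightarrow> (\<lambda>x. z x *\<^sub>R (mat 1 :: real^2^2)) \<in> \<L>"
  by (auto simp: L2_vec_iff mat_def L2_zero)

definition outer :: "real^2 \<Rightarrow> real^2 \<Rightarrow> real^2^2" where
  "outer x y = (\<chi> \<alpha> \<beta>. x $ \<alpha> * y $ \<beta>)"

lemma inner_outer: "N \<bullet> outer x y = x \<bullet> (N *v y)"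
  by (simp add: inner_mat2 inner_vec2 matrix_vector_2 outer_def algebra_simps)

lemma norm_outer: "norm (outer x y) = norm x * norm y"
proof -
  have "(norm (outer x y))\<^sup>2 = (norm x * norm y)\<^sup>2"
    by (simp add: power_mult_distrib power2_norm_eq_inner inner_mat2 inner_vec2 outer_def algebra_simps)
  then show ?thesis by (simp add: power2_eq_iff_nonneg)
qed

abbreviation grad :: "scalar_field \<Rightarrow> vector_field" where "grad \<equiv> grad2 \<Omega>"
abbreviation strain :: "displacement \<Rightarrow> matrix_field" where "strain \<equiv> gamma \<Omega>"
abbreviation grad_outer :: "scalar_field \<Rightarrow> matrix_field" where "grad_outer w x \<equiv> outer (grad w x) (grad w x)"
abbreviation shift :: "matrix_field \<Rightarrow> scalar_field \<Rightarrow> matrix_field" where "shift M z x \<equiv> M x + z x *\<^sub>R mat 1"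

abbreviation pairing :: "(real^2 \<Rightarrow> 'b::real_inner) \<Rightarrow> (real^2 \<Rightarrow> 'b) \<Rightarrow> real" where
  "pairing f g \<equiv> \<integral>x. f x \<bullet> g x \<partial>\<mu>"
abbreviation square_int :: "(real^2 \<Rightarrow> 'b::real_inner) \<Rightarrow> real" where
  "square_int f \<equiv> \<integral>x. (norm (f x))\<^sup>2 \<partial>\<mu>"
abbreviation form_int :: "tensor4 \<Rightarrow> matrix_field \<Rightarrow> matrix_field \<Rightarrow> real" where
  "form_int T A B \<equiv> \<integral>x. tensor_form T (A x) (B x) \<partial>\<mu>"

abbreviation line :: "(real^2 \<Rightarrow> 'b::real_vector) \<Rightarrow> (real^2 \<Rightarrow> 'b) \<Rightarrow> real \<Rightarrow> real^2 \<Rightarrow> 'b" where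
  "line f g t x \<equiv> f x + t *\<^sub>R g x"

lemma pairing_commute: "pairing f g = pairing g f"
  by (simp add: inner_commute)

text \<open>Along a line of fields the pairing is affine and the quadratic integrals are quadratic polynomials
  in the parameter. The field on the line is given almost everywhere only, since the weak gradient of
  a linear combination is determined only up to null sets.\<close>

lemma pairing_line:
  fixes e f g k :: "real^2 \<Rightarrow> 'b::euclidean_space"
  assumes "e \<in> \<L>" "f \<in> \<L>" "g \<in> \<L>" "k \<in> \<L>" and k: "AE x in \<mu>. k x = line f g t x"
  shows "pairing e k = pairing e f + t * pairing e g"
proof -
  note i = assms(1-4)[THEN inner_field_integrable[OF assms(1)]]
  have "pairing e k = (\<integral>x. e x \<bullet> f x + t * (e x \<bullet> g x) \<partial>\<mu>)"
    using i k by (intro integral_cong_AE borel_measurable_integrable) (auto simp: inner_add_right)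
  then show ?thesis using i by simp
qed

lemma square_int_line:
  fixes f g k :: "real^2 \<Rightarrow> 'b::euclidean_space"
  assumes "f \<in> \<L>" "g \<in> \<L>" "k \<in> \<L>" and k: "AE x in \<mu>. k x = line f g t x"
  shows "square_int k = square_int f + 2 * t * pairing f g + t\<^sup>2 * square_int g"
proof -
  have "square_int k = pairing k f + t * pairing k g" "pairing f k = pairing f f + t * pairing f g"
    "pairing g k = pairing g f + t * pairing g g"
    using assms by (auto simp: power2_norm_eq_inner intro!: pairing_line)
  then show ?thesis
    unfolding power2_norm_eq_inner
    by (simp add: pairing_commute[of k f] pairing_commute[of k g] pairing_commute[of g f] power2_eq_square algebra_simps)
qed

lemma form_int_line_right:
  assumes "A \<in> \<L>" "B \<in> \<L>" "C \<in> \<L>" and T: "T = iso_tensor a b"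
  shows "form_int T A (line B C t) = form_int T A B + t * form_int T A C"
  using assms by (simp add: tensor_form_iso inner_add_right inner_field_integrable tensor_apply_L2)

lemma form_int_line:
  assumes "A \<in> \<L>" "B \<in> \<L>" "C \<in> \<L>" and T: "T = iso_tensor a b" and C: "AE x in \<mu>. C x = line A B t x"
  shows "form_int T C C = form_int T A A + 2 * t * form_int T A B + t\<^sup>2 * form_int T B B"
proof -
  note i = tensor_form_integrable[OF assms(1,1)] tensor_form_integrable[OF assms(1,2)]
    tensor_form_integrable[OF assms(2,2)] tensor_form_integrable[OF assms(3,3)]
  have "form_int T C C = (\<integral>x. tensor_form T (A x) (A x) + 2 * t * tensor_form T (A x) (B x)
      + t\<^sup>2 * tensor_form T (B x) (B x) \<partial>\<mu>)"
    using C i by (intro integral_cong_AE borel_measurable_integrable) (auto simp: T tensor_form_iso_square)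
  then show ?thesis using i by simp
qed

definition hess :: "scalar_field \<Rightarrow> matrix_field" where
  "hess w x = (\<chi> \<alpha> \<beta>. wd2 \<alpha> \<beta> w x)"

definition sym_grad :: "vector_field \<Rightarrow> matrix_field" where
  "sym_grad v x = (\<chi> \<alpha> \<beta>. (wd \<beta> (\<lambda>y. v y $ \<alpha>) x + wd \<alpha> (\<lambda>y. v y $ \<beta>) x) / 2)"

lemma gamma_eq: "strain (v, w) x = sym_grad v x + (1 / 2) *\<^sub>R grad_outer w x"
  by (simp add: gamma_def sym_grad_def outer_def grad2_def vec_eq_iff)

lemma gamma_sym: "strain u x \<in> sym_mat"
  by (simp add: gamma_def sym_mat_iff split_beta add.commute mult.commute)

lemma sym_grad_sym: "sym_grad v x \<in> sym_mat"
  by (simp add: sym_grad_def sym_mat_iff)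

lemma J_eq: "J \<Omega> h la mu P p (v, w) = form_int (h_tensor h la mu) (hess w) (hess w) / 2
    + form_int (H_tensor h la mu) (strain (v, w)) (strain (v, w)) / 2 - pairing P w - pairing p v"
proof -
  have "tensor_form T (kappa \<Omega> (v, w) x) (kappa \<Omega> (v, w) x) = tensor_form T (hess w x) (hess w x)" for T x
    by (simp add: tensor_form_def kappa_def hess_def)
  then show ?thesis by (simp add: J_def inner_real_def inner_commute mult.commute)
qed

lemma bounded_field_L2:
  fixes f :: "real^2 \<Rightarrow> 'b::euclidean_space"
  assumes f: "f \<in> borel_measurable \<mu>" and b: "\<And>x. norm (f x) \<le> C"
  shows "f \<in> \<L>"
proof -
  have "integrable \<mu> (\<lambda>x. (norm (f x))\<^sup>2)"
  proof (rule dom.integrable_const_bound)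
    show "AE x in \<mu>. norm ((norm (f x))\<^sup>2) \<le> C\<^sup>2"
      using b by (auto intro!: power_mono)
  qed (use f in measurable)
  with f show ?thesis by (simp add: L2_def)
qed

lemma hess_L2: "w \<in> W2 \<Longrightarrow> hess w \<in> \<L>"
  by (simp add: L2_vec_iff hess_def W22_wpd2_L2)

lemma grad2_L2: "w \<in> W1 \<Longrightarrow> grad w \<in> \<L>"
  by (simp add: L2_vec_iff grad2_def W12_wpd_L2)

lemma sym_grad_L2: "(\<And>\<alpha>. (\<lambda>x. v x $ \<alpha>) \<in> W1) \<Longrightarrow> sym_grad v \<in> \<L>"
  unfolding L2_vec_iff sym_grad_def
  by (auto intro!: L2_cmult[of _ "1 / 2", simplified] L2_add W12_wpd_L2)

lemma outer_grad_L2: "w \<in> W2\<^sub>0 \<Longrightarrow> z \<in> W2\<^sub>0 \<Longrightarrow> (\<lambda>x. outer (grad w x) (grad z x)) \<in> \<L>"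
  by (simp add: L2_vec_iff outer_def grad2_def W12_0_mult_L2 W22_0_wpd_W12_0)

lemma hess_lincomb: "f \<in> W2 \<Longrightarrow> g \<in> W2 \<Longrightarrow>
    AE x in \<mu>. hess (\<lambda>x. f x + c * g x) x = hess f x + c *\<^sub>R hess g x"
  using wpd2_lincomb[of f g 1 1 c] wpd2_lincomb[of f g 1 2 c] wpd2_lincomb[of f g 2 1 c] wpd2_lincomb[of f g 2 2 c]
  by (auto simp: mat2_eq_iff hess_def)

lemma grad2_lincomb: "f \<in> W1 \<Longrightarrow> g \<in> W1 \<Longrightarrow>
    AE x in \<mu>. grad (\<lambda>x. f x + c * g x) x = grad f x + c *\<^sub>R grad g x"
  using wpd_lincomb[of f g 1 c] wpd_lincomb[of f g 2 c]
  by (auto simp: vec2_eq_iff grad2_def)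

lemma sym_grad_lincomb:
  assumes "\<And>\<alpha>. (\<lambda>x. f x $ \<alpha>) \<in> W1" "\<And>\<alpha>. (\<lambda>x. g x $ \<alpha>) \<in> W1"
  shows "AE x in \<mu>. sym_grad (\<lambda>x. f x + c *\<^sub>R g x) x = sym_grad f x + c *\<^sub>R sym_grad g x"
proof -
  have "AE x in \<mu>. wd \<alpha> (\<lambda>x. f x $ \<beta> + c * g x $ \<beta>) x
      = wd \<alpha> (\<lambda>x. f x $ \<beta>) x + c * wd \<alpha> (\<lambda>x. g x $ \<beta>) x" for \<alpha> \<beta>
    by (rule wpd_lincomb[OF assms])
  from this[of 1 1] this[of 1 2] this[of 2 1] this[of 2 2] show ?thesis
    by eventually_elim (simp add: mat2_eq_iff sym_grad_def field_simps)
qed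

lemma identity_inner_hess_by_parts:
  assumes z: "z \<in> W1" and w: "w \<in> W2\<^sub>0"
  shows "(\<integral>x. (z x *\<^sub>R mat 1) \<bullet> hess w x \<partial>\<mu>) = - pairing (grad z) (grad w)"
proof -
  have b: "(\<integral>x. wd2 \<alpha> \<alpha> w x * z x \<partial>\<mu>) = - (\<integral>x. wd \<alpha> w x * wd \<alpha> z x \<partial>\<mu>)" for \<alpha>
    unfolding wpd2_def by (rule W12_0_integral_by_parts[OF W22_0_wpd_W12_0[OF w] z])
  have L: "z \<in> \<L>" "\<And>\<alpha>. wd \<alpha> z \<in> \<L>" "\<And>\<alpha>. wd \<alpha> w \<in> \<L>" "\<And>\<alpha> \<beta>. wd2 \<alpha> \<beta> w \<in> \<L>"
    using z w W12_L2 W12_wpd_L2 W12_0_W12 W22_0_W12_0 W22_wpd2_L2 W22_0_W22 by auto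
  have "(\<integral>x. (z x *\<^sub>R mat 1) \<bullet> hess w x \<partial>\<mu>) = (\<integral>x. wd2 1 1 w x * z x + wd2 2 2 w x * z x \<partial>\<mu>)"
    by (simp add: inner_mat2 mat_def hess_def algebra_simps)
  also have "\<dots> = (\<integral>x. wd2 1 1 w x * z x \<partial>\<mu>) + (\<integral>x. wd2 2 2 w x * z x \<partial>\<mu>)"
    using L by (intro Bochner_Integration.integral_add L2_mult_integrable)
  also have "\<dots> = - ((\<integral>x. wd 1 w x * wd 1 z x \<partial>\<mu>) + (\<integral>x. wd 2 w x * wd 2 z x \<partial>\<mu>))"
    by (simp add: b)
  also have "(\<integral>x. wd 1 w x * wd 1 z x \<partial>\<mu>) + (\<integral>x. wd 2 w x * wd 2 z x \<partial>\<mu>)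
      = (\<integral>x. wd 1 w x * wd 1 z x + wd 2 w x * wd 2 z x \<partial>\<mu>)"
    using L by (intro Bochner_Integration.integral_add[symmetric] L2_mult_integrable)
  finally show ?thesis
    by (simp add: inner_vec2 grad2_def mult.commute)
qed

subsection \<open>The displacement space\<close>

lemma U_spaceD:
  assumes "(v, w) \<in> \<U>"
  shows "(\<lambda>x. v x $ \<alpha>) \<in> W1\<^sub>0" "(\<lambda>x. v x $ \<alpha>) \<in> W1" "(\<lambda>x. v x $ \<alpha>) \<in> \<L>" "v \<in> \<L>" "w \<in> W2\<^sub>0" "w \<in> W2" "w \<in> W1" "w \<in> \<L>"
    "sym_grad v \<in> \<L>" "grad w \<in> \<L>" "hess w \<in> \<L>"
    "(\<lambda>x. grad_outer w x) \<in> \<L>" "strain (v, w) \<in> \<L>"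
proof -
  have vw: "\<And>\<alpha>. (\<lambda>x. v x $ \<alpha>) \<in> W1\<^sub>0" "w \<in> W2\<^sub>0" using assms by (auto simp: U_space_def)
  then have vw': "\<And>\<alpha>. (\<lambda>x. v x $ \<alpha>) \<in> W1" "w \<in> W2" using W12_0_W12 W22_0_W22 by auto
  show "(\<lambda>x. v x $ \<alpha>) \<in> W1\<^sub>0" "(\<lambda>x. v x $ \<alpha>) \<in> W1" "w \<in> W2\<^sub>0" "w \<in> W2" by fact+
  show "(\<lambda>x. v x $ \<alpha>) \<in> \<L>" "v \<in> \<L>" using vw'(1) W12_L2 by (auto simp: L2_vec_iff)
  show "w \<in> W1" using vw'(2) W22_W12 by blast
  then show "w \<in> \<L>" "grad w \<in> \<L>" using W12_L2 grad2_L2 by auto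
  show s: "sym_grad v \<in> \<L>" using vw'(1) by (rule sym_grad_L2)
  show "hess w \<in> \<L>" using vw'(2) by (rule hess_L2)
  show o: "(\<lambda>x. grad_outer w x) \<in> \<L>" using outer_grad_L2 vw(2) by blast
  have "strain (v, w) = (\<lambda>x. sym_grad v x + (1 / 2) *\<^sub>R grad_outer w x)"
    using gamma_eq by blast
  then show "strain (v, w) \<in> \<L>" using L2_field_lincomb[OF s o] by simp
qed

lemma U_space_lincomb:
  assumes "(v, w) \<in> \<U>" "(v', w') \<in> \<U>"
  shows "(\<lambda>x. v x + c *\<^sub>R v' x, \<lambda>x. w x + c * w' x) \<in> \<U>"
  using assms by (auto simp: U_space_def intro!: W12_0_lincomb W22_0_lincomb)

lemma L2_lim_cong_AE:
  assumes "L2_to F f" "\<And>n. AE x in \<mu>. G n x = F n x" "\<And>n. F n \<in> \<L>" "\<And>n. G n \<in> \<L>" "f \<in> \<L>"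
  shows "L2_to G f"
proof -
  have "(\<integral>x. (G n x - f x)\<^sup>2 \<partial>\<mu>) = (\<integral>x. (F n x - f x)\<^sup>2 \<partial>\<mu>)" for n
  proof (rule integral_cong_AE)
    show "AE x in \<mu>. (G n x - f x)\<^sup>2 = (F n x - f x)\<^sup>2" using assms(2)[of n] by eventually_elim simp
  qed (use assms in \<open>auto intro!: borel_measurable_power borel_measurable_diff L2_measurable\<close>)
  then show ?thesis using assms(1) by (simp add: L2_lim_def)
qed

end

section \<open>Equilibrium residuals\<close>

locale plate = bounded_open \<Omega> for \<Omega> +
  fixes h la mu K :: real and P :: scalar_field and p :: vector_field
  assumes h_pos: "h > 0" and la_pos: "la > 0" and mu_pos: "mu > 0" and K_pos: "K > 0"
    and P_L2: "P \<in> \<L>" and p_L2: "p \<in> \<L>"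
begin

abbreviation TR :: "dual_var \<Rightarrow> scalar_field \<Rightarrow> real" where "TR \<equiv> transverse_residual \<Omega> P"
abbreviation IR :: "dual_var \<Rightarrow> 2 \<Rightarrow> scalar_field \<Rightarrow> real" where "IR \<equiv> inplane_residual \<Omega> p"

lemma transverse_residual_eq: "TR (N, Q, M) w = pairing M (hess w) + pairing Q (grad w) - pairing P w"
  by (simp add: transverse_residual_def inner_vec_def hess_def grad2_def inner_real_def)

lemma inplane_residual_eq: "IR (N, Q, M) \<alpha> f = pairing (\<lambda>x. p x $ \<alpha>) f - pairing (\<lambda>x. N x $ \<alpha>) (grad f)"
proof -
  have "(\<Sum>\<beta>\<in>UNIV. N x $ \<alpha> $ \<beta> * wd \<beta> f x) = N x $ \<alpha> \<bullet> grad f x" for x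
    by (simp add: inner_vec_def grad2_def)
  then show ?thesis by (simp add: inplane_residual_def inner_real_def)
qed

lemma transverse_residual_lincomb:
  assumes L: "M \<in> \<L>" "Q \<in> \<L>" and w: "w \<in> W2" "w' \<in> W2"
  shows "TR (N, Q, M) (\<lambda>x. w x + c * w' x) = TR (N, Q, M) w + c * TR (N, Q, M) w'"
proof -
  have w1: "w \<in> W1" "w' \<in> W1" using w W22_W12 by auto
  have "pairing M (hess (\<lambda>x. w x + c * w' x)) = pairing M (hess w) + c * pairing M (hess w')"
    by (intro pairing_line L hess_L2 w W22_lincomb hess_lincomb)
  moreover have "pairing Q (grad (\<lambda>x. w x + c * w' x)) = pairing Q (grad w) + c * pairing Q (grad w')"
    by (intro pairing_line L grad2_L2 w1 W12_lincomb grad2_lincomb)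
  moreover have "pairing P (\<lambda>x. w x + c * w' x) = pairing P w + c * pairing P w'"
    by (intro pairing_line P_L2 W12_L2 w1 W12_lincomb) simp
  ultimately show ?thesis
    unfolding transverse_residual_eq by (simp only:) (simp add: algebra_simps)
qed

lemma inplane_residual_lincomb:
  assumes L: "N \<in> \<L>" and f: "f \<in> W1" "g \<in> W1"
  shows "IR (N, Q, M) \<alpha> (\<lambda>x. f x + c * g x) = IR (N, Q, M) \<alpha> f + c * IR (N, Q, M) \<alpha> g"
proof -
  have c: "(\<lambda>x. N x $ \<alpha>) \<in> \<L>" "(\<lambda>x. p x $ \<alpha>) \<in> \<L>" using L p_L2 by (auto simp: L2_vec_iff)
  have "pairing (\<lambda>x. N x $ \<alpha>) (grad (\<lambda>x. f x + c * g x))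
      = pairing (\<lambda>x. N x $ \<alpha>) (grad f) + c * pairing (\<lambda>x. N x $ \<alpha>) (grad g)"
    by (intro pairing_line c grad2_L2 f W12_lincomb grad2_lincomb)
  moreover have "pairing (\<lambda>x. p x $ \<alpha>) (\<lambda>x. f x + c * g x) = pairing (\<lambda>x. p x $ \<alpha>) f + c * pairing (\<lambda>x. p x $ \<alpha>) g"
    by (intro pairing_line c W12_L2 f W12_lincomb) simp
  ultimately show ?thesis
    unfolding inplane_residual_eq by (simp only:) (simp add: algebra_simps)
qed

lemma inplane_residual_sum:
  assumes N: "N \<in> L2_sym \<Omega>" and v: "\<And>\<alpha>. (\<lambda>x. v x $ \<alpha>) \<in> W1"
  shows "(\<Sum>\<alpha>\<in>UNIV. IR (N, Q, M) \<alpha> (\<lambda>x. v x $ \<alpha>)) = pairing p v - pairing N (sym_grad v)"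
proof -
  have NL: "N \<in> \<L>" and Ns: "AE x in \<mu>. N x \<in> sym_mat" using N by (auto simp: L2_sym_def)
  have L: "\<And>\<alpha>. (\<lambda>x. N x $ \<alpha>) \<in> \<L>" "\<And>\<alpha>. (\<lambda>x. p x $ \<alpha>) \<in> \<L>" using NL p_L2 by (auto simp: L2_vec_iff)
  note i = inner_field_integrable[OF L(1) grad2_L2[OF v]] inner_field_integrable[OF L(2) W12_L2[OF v]]
  have "pairing N (sym_grad v) = (\<integral>x. N x $ 1 \<bullet> grad (\<lambda>x. v x $ 1) x + N x $ 2 \<bullet> grad (\<lambda>x. v x $ 2) x \<partial>\<mu>)"
  proof (intro integral_cong_AE borel_measurable_integrable)
    show "AE x in \<mu>. N x \<bullet> sym_grad v x = N x $ 1 \<bullet> grad (\<lambda>x. v x $ 1) x + N x $ 2 \<bullet> grad (\<lambda>x. v x $ 2) x"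
      using Ns
      by eventually_elim (simp add: sym_mat_iff inner_mat2 inner_vec2 sym_grad_def grad2_def field_simps)
  qed (use inner_field_integrable[OF NL sym_grad_L2[OF v]] i in auto)
  moreover have "pairing p v = (\<integral>x. p x $ 1 \<bullet> v x $ 1 + p x $ 2 \<bullet> v x $ 2 \<partial>\<mu>)"
    by (simp add: inner_vec2 inner_real_def)
  ultimately show ?thesis
    using i by (simp add: inplane_residual_eq sum_2)
qed

text \<open>Both residuals are continuous on the Sobolev spaces, so vanishing on test functions extends to
  the closure.\<close>

lemma transverse_residual_eq_0:
  assumes L: "M \<in> \<L>" "Q \<in> \<L>"
    and 0: "\<And>\<phi>. \<phi> \<in> \<T> \<Longrightarrow> TR (N, Q, M) \<phi> = 0" and w: "w \<in> W2\<^sub>0"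
  shows "TR (N, Q, M) w = 0"
proof -
  obtain \<phi> where a: "\<And>n. \<phi> n \<in> \<T>" "L2_to \<phi> w" "\<And>\<alpha>. L2_to (\<lambda>n. pd \<alpha> (\<phi> n)) (wd \<alpha> w)"
      "\<And>\<alpha> \<beta>. L2_to (\<lambda>n. pd \<beta> (pd \<alpha> (\<phi> n))) (wd2 \<alpha> \<beta> w)"
    using w unfolding W22_0_def by (elim CollectE conjE exE) blast
  have W: "w \<in> W2" "w \<in> W1" "w \<in> \<L>" using w W22_0_W22 W22_W12 W12_L2 by blast+
  have c: "\<And>\<alpha> \<beta>. (\<lambda>x. M x $ \<alpha> $ \<beta>) \<in> \<L>" "\<And>\<alpha>. (\<lambda>x. Q x $ \<alpha>) \<in> \<L>" using L by (auto simp: L2_vec_iff)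
  have T: "\<phi> n \<in> W2" "\<phi> n \<in> W1" "\<phi> n \<in> \<L>" for n
    using a(1) test_fun_W22 W22_W12 W12_L2 by blast+
  have l1: "L2_to (\<lambda>n. wd \<alpha> (\<phi> n)) (wd \<alpha> w)" for \<alpha>
    using a T W by (intro L2_lim_cong_AE[OF a(3)] wpd_test_fun test_fun_pd_L2 W12_wpd_L2)
  have l2: "L2_to (\<lambda>n. wd2 \<alpha> \<beta> (\<phi> n)) (wd2 \<alpha> \<beta> w)" for \<alpha> \<beta>
    using a T W by (intro L2_lim_cong_AE[OF a(4)] wpd2_test_fun test_fun_pd_L2 W22_wpd2_L2)
  have eq: "TR (N, Q, M) u = (\<Sum>\<alpha>\<in>UNIV. \<Sum>\<beta>\<in>UNIV. \<integral>x. wd2 \<alpha> \<beta> u x * M x $ \<alpha> $ \<beta> \<partial>\<mu>)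
      + (\<Sum>\<alpha>\<in>UNIV. \<integral>x. wd \<alpha> u x * Q x $ \<alpha> \<partial>\<mu>) - (\<integral>x. u x * P x \<partial>\<mu>)" if "u \<in> W2" for u
  proof -
    have "\<And>\<alpha> \<beta>. integrable \<mu> (\<lambda>x. wd2 \<alpha> \<beta> u x * M x $ \<alpha> $ \<beta>)" "\<And>\<alpha>. integrable \<mu> (\<lambda>x. wd \<alpha> u x * Q x $ \<alpha>)"
      by (intro L2_mult_integrable c W22_wpd2_L2 W12_wpd_L2 W22_W12(1) that)+
    then show ?thesis
      by (simp add: transverse_residual_def mult.commute sum_2)
  qed
  have "(\<lambda>n. TR (N, Q, M) (\<phi> n)) \<longlonglongrightarrow> TR (N, Q, M) w"
    unfolding eq[OF T(1)] eq[OF W(1)]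
    using a(2) l1 l2 c P_L2 T W
    by (intro tendsto_diff tendsto_add tendsto_sum L2_lim_inner) (auto intro: W22_wpd2_L2 W12_wpd_L2)
  then show ?thesis using 0[OF a(1)] by (simp add: LIMSEQ_const_iff)
qed

lemma inplane_residual_eq_0:
  assumes L: "N \<in> \<L>"
    and 0: "\<And>\<phi>. \<phi> \<in> \<T> \<Longrightarrow> IR (N, Q, M) \<alpha> \<phi> = 0" and f: "f \<in> W1\<^sub>0"
  shows "IR (N, Q, M) \<alpha> f = 0"
proof -
  obtain \<phi> where a: "\<And>n. \<phi> n \<in> \<T>" "L2_to \<phi> f" "\<And>\<alpha>. L2_to (\<lambda>n. pd \<alpha> (\<phi> n)) (wd \<alpha> f)"
    using f by (auto simp: W12_0_def)
  have W: "f \<in> W1" "f \<in> \<L>" using f W12_0_W12 W12_L2 by blast+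
  have c: "\<And>\<alpha> \<beta>. (\<lambda>x. N x $ \<alpha> $ \<beta>) \<in> \<L>" "\<And>\<alpha>. (\<lambda>x. p x $ \<alpha>) \<in> \<L>" using L p_L2 by (auto simp: L2_vec_iff)
  have T: "\<phi> n \<in> W1" "\<phi> n \<in> \<L>" for n
    using a(1) test_fun_W12 W12_L2 by blast+
  have l: "L2_to (\<lambda>n. wd \<alpha> (\<phi> n)) (wd \<alpha> f)" for \<alpha>
    using a T W by (intro L2_lim_cong_AE[OF a(3)] wpd_test_fun test_fun_pd_L2 W12_wpd_L2)
  have eq: "IR (N, Q, M) \<alpha> u = - (\<Sum>\<beta>\<in>UNIV. \<integral>x. wd \<beta> u x * N x $ \<alpha> $ \<beta> \<partial>\<mu>)
      + (\<integral>x. u x * p x $ \<alpha> \<partial>\<mu>)" if "u \<in> W1" for u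
  proof -
    have "\<And>\<beta>. integrable \<mu> (\<lambda>x. wd \<beta> u x * N x $ \<alpha> $ \<beta>)"
      by (intro L2_mult_integrable c W12_wpd_L2 that)
    then show ?thesis
      by (simp add: inplane_residual_def mult.commute sum_2)
  qed
  have "(\<lambda>n. IR (N, Q, M) \<alpha> (\<phi> n)) \<longlonglongrightarrow> IR (N, Q, M) \<alpha> f"
    unfolding eq[OF T(1)] eq[OF W(1)]
    using a(2) l c T W
    by (intro tendsto_add tendsto_minus tendsto_sum L2_lim_inner) (auto intro: W12_wpd_L2)
  then show ?thesis using 0[OF a(1)] by (simp add: LIMSEQ_const_iff)
qed

section \<open>Weak duality\<close>

sublocale memb: isotropic "h * (4 * la * mu / (la + 2 * mu))" "h * (2 * mu)"
  by unfold_locales (use h_pos la_pos mu_pos in auto)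

sublocale bend: isotropic "h\<^sup>2 / 3 * (h * (4 * la * mu / (la + 2 * mu)))" "h\<^sup>2 / 3 * (h * (2 * mu))"
  by unfold_locales (use h_pos la_pos mu_pos in auto)

abbreviation \<B> :: "dual_var set" where "\<B> \<equiv> B_star \<Omega> K"
abbreviation \<A> :: "dual_var set" where "\<A> \<equiv> A_star \<Omega> K P p"
abbreviation Jp :: "displacement \<Rightarrow> real" where "Jp \<equiv> J \<Omega> h la mu P p"
abbreviation dual :: "dual_var \<Rightarrow> scalar_field \<Rightarrow> ereal" where "dual \<equiv> J_star \<Omega> h la mu K"
abbreviation Fz :: "scalar_field \<Rightarrow> real" where "Fz \<equiv> F_star \<Omega> K"
abbreviation stiff :: "matrix_field \<Rightarrow> matrix_field" where "stiff N x \<equiv> N x + K *\<^sub>R mat 1"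
abbreviation TH :: tensor4 where "TH \<equiv> H_tensor h la mu"
abbreviation Th :: tensor4 where "Th \<equiv> h_tensor h la mu"
abbreviation TH' :: tensor4 where "TH' \<equiv> H_bar h la mu"
abbreviation Th' :: tensor4 where "Th' \<equiv> h_bar h la mu"

lemma H_bar_iso: "TH' = iso_tensor memb.inv_a memb.inv_b"
  unfolding H_bar_def H_tensor_iso by (rule memb.tensor_inv_iso)

lemma h_bar_iso: "Th' = iso_tensor bend.inv_a bend.inv_b"
  unfolding h_bar_def h_tensor_iso by (rule bend.tensor_inv_iso)

definition inverse_integral :: "matrix_field \<Rightarrow> vector_field \<Rightarrow> ennreal" where
  "inverse_integral N Q = (\<integral>\<^sup>+x. ennreal (Q x \<bullet> (matrix_inv (stiff N x) *v Q x)) \<partial>\<mu>)"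

text \<open>The value of the Lagrangian on its effective domain, with the residuals written in terms of the
  Hessian and the symmetric gradient. Outside this domain \<open>enn2real\<close> replaces the infinite inverse
  integral by zero.\<close>

definition lagrangian :: "matrix_field \<Rightarrow> vector_field \<Rightarrow> matrix_field \<Rightarrow> scalar_field \<Rightarrow>
    vector_field \<Rightarrow> scalar_field \<Rightarrow> real" where
  "lagrangian N Q M z v w =
    - form_int Th' (shift M z) (shift M z) / 2
    - enn2real (inverse_integral N Q) / 2 - form_int TH' N N / 2
    + Fz z
    + (pairing M (hess w) + pairing Q (grad w) - pairing P w)
    + (pairing N (sym_grad v) - pairing p v)"

text \<open>What remains of the Lagrangian when the terms in each dual variable are replaced by their upper
  bound from Fenchel's inequality. The coupling through \<open>N + K \<delta>\<close> splits into the nonlinear part of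
  the membrane strain and the term with the factor \<open>K / 2\<close>.\<close>

definition primal_bound :: "scalar_field \<Rightarrow> displacement \<Rightarrow> real" where
  "primal_bound z u = Jp u + K / 2 * (\<integral>x. (norm (grad (snd u) x))\<^sup>2 \<partial>\<mu>)
     - (\<integral>x. (z x *\<^sub>R mat 1) \<bullet> hess (snd u) x \<partial>\<mu>) + Fz z"

lemma B_starD:
  assumes "(N, Q, M) \<in> \<B>"
  shows "N \<in> L2_sym \<Omega>" "N \<in> \<L>" "Q \<in> \<L>" "M \<in> \<L>" "AE x in \<mu>. N x \<in> sym_mat" "AE x in \<mu>. M x \<in> sym_mat"
    "AE x in \<mu>. pos_def (stiff N x)"
  using assms by (auto simp: B_star_def L2_sym_def)

lemma J_star_finite:
  assumes "inverse_integral N Q < \<infinity>"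
  shows "dual (N, Q, M) z = ereal
    (- form_int Th' (shift M z) (shift M z) / 2
    - enn2real (inverse_integral N Q) / 2 - form_int TH' N N / 2
    + Fz z)"
proof -
  obtain r where r: "r \<ge> 0" "inverse_integral N Q = ennreal r"
    using assms by (cases "inverse_integral N Q") auto
  have "enn2ereal (\<integral>\<^sup>+x. ennreal (Q x \<bullet> (matrix_inv (stiff N x) *v Q x)) \<partial>\<mu>) = ereal r"
    using r by (simp add: inverse_integral_def)
  then show ?thesis
    using r by (simp add: J_star_def G2_star_def G1_star_def)
qed

lemma J_star_infinite:
  assumes "\<not> inverse_integral N Q < \<infinity>"
  shows "dual (N, Q, M) z = - \<infinity>"
proof -
  have "inverse_integral N Q = \<infinity>" using assms by (simp add: not_less top_unique)
  then have "enn2ereal (\<integral>\<^sup>+x. ennreal (Q x \<bullet> (matrix_inv (stiff N x) *v Q x)) \<partial>\<mu>) = \<infinity>"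
    by (simp add: inverse_integral_def)
  then show ?thesis
    by (simp add: J_star_def G2_star_def G1_star_def)
qed

lemma J3_star_eq:
  assumes v: "(N, Q, M) \<in> \<B>" and u: "(v, w) \<in> \<U>"
  shows "J3_star \<Omega> h la mu K P p (N, Q, M) z (v, w) =
    (if inverse_integral N Q < \<infinity> then ereal (lagrangian N Q M z v w) else - \<infinity>)"
proof -
  have s: "(\<Sum>\<alpha>\<in>UNIV. IR (N, Q, M) \<alpha> (\<lambda>x. v x $ \<alpha>))
      = pairing p v - pairing N (sym_grad v)"
    by (rule inplane_residual_sum[OF B_starD(1)[OF v] U_spaceD(2)[OF u]])
  show ?thesis
    unfolding J3_star_def prod.case s
    by (simp add: J_star_finite J_star_infinite transverse_residual_eq lagrangian_def)
qed

lemma F_star_eq: "Fz z = square_int (grad z) / (2 * K)"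
  by (simp add: F_star_def)

lemma inverse_integral_inv_apply:
  assumes "(N, Q, M) \<in> \<B>"
  shows "inverse_integral N Q = (\<integral>\<^sup>+x. ennreal (Q x \<bullet> inv_apply (stiff N x) (Q x)) \<partial>\<mu>)"
  unfolding inverse_integral_def
proof (rule nn_integral_cong_AE)
  show "AE x in \<mu>. ennreal (Q x \<bullet> (matrix_inv (stiff N x) *v Q x))
      = ennreal (Q x \<bullet> inv_apply (stiff N x) (Q x))"
    using B_starD(7)[OF assms]
  proof eventually_elim
    case (elim x)
    then show ?case using pos_def_entries(4)[OF elim] by (simp add: matrix_inv_apply)
  qed
qed

lemma inverse_integral_lower_bound:
  assumes v: "(N, Q, M) \<in> \<B>" "inverse_integral N Q < \<infinity>" and r: "integrable \<mu> r"
    and le: "AE x in \<mu>. r x \<le> Q x \<bullet> inv_apply (stiff N x) (Q x)"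
  shows "(\<integral>x. r x \<partial>\<mu>) \<le> enn2real (inverse_integral N Q)"
proof -
  have "(\<integral>x. r x \<partial>\<mu>) \<le> enn2real (\<integral>\<^sup>+x. ennreal (r x) \<partial>\<mu>)"
    using real_lebesgue_integral_def[OF r] by simp
  also have "(\<integral>\<^sup>+x. ennreal (r x) \<partial>\<mu>) \<le> inverse_integral N Q"
    unfolding inverse_integral_inv_apply[OF v(1)]
    using le by (intro nn_integral_mono_AE) (auto elim!: eventually_mono intro: ennreal_leI)
  then have "enn2real (\<integral>\<^sup>+x. ennreal (r x) \<partial>\<mu>) \<le> enn2real (inverse_integral N Q)"
    using v(2) by (intro enn2real_mono) auto
  finally show ?thesis by simp
qed

lemma matrix_plus_identity_form: "y \<bullet> ((N + K *\<^sub>R mat 1) *v y) = N \<bullet> outer y y + K * (norm y)\<^sup>2"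
  by (simp add: inner_outer inner_vec2 matrix_vector_2 power2_norm_eq_inner mat_def algebra_simps)

lemma gamma_pairing:
  assumes N: "N \<in> \<L>" and u: "(v, w) \<in> \<U>"
  shows "pairing (strain (v, w)) N =
    pairing N (sym_grad v) + pairing N (grad_outer w) / 2"
proof -
  have "integrable \<mu> (\<lambda>x. N x \<bullet> sym_grad v x)" "integrable \<mu> (\<lambda>x. N x \<bullet> grad_outer w x)"
    using N U_spaceD[OF u] by (auto intro!: inner_field_integrable)
  then show ?thesis
    by (simp add: gamma_eq inner_simps inner_commute[of _ "N _"])
qed

lemma grad_form_integral:
  assumes N: "N \<in> \<L>" and u: "(v, w) \<in> \<U>"
  shows "integrable \<mu> (\<lambda>x. grad w x \<bullet> ((stiff N x) *v grad w x))"
    "(\<integral>x. grad w x \<bullet> ((stiff N x) *v grad w x) \<partial>\<mu>) =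
    pairing N (grad_outer w) + K * square_int (grad w)"
proof -
  have "integrable \<mu> (\<lambda>x. (norm (grad w x))\<^sup>2)" "integrable \<mu> (\<lambda>x. N x \<bullet> grad_outer w x)"
    using N U_spaceD[OF u] by (auto intro!: inner_field_integrable norm_square_integrable)
  then show "integrable \<mu> (\<lambda>x. grad w x \<bullet> ((stiff N x) *v grad w x))"
    "(\<integral>x. grad w x \<bullet> ((stiff N x) *v grad w x) \<partial>\<mu>) =
    pairing N (grad_outer w) + K * square_int (grad w)"
    unfolding matrix_plus_identity_form by simp_all
qed

lemma shift_L2:
  assumes "M \<in> \<L>" "z \<in> \<L>"
  shows "(\<lambda>x. M x + z x *\<^sub>R (mat 1 :: real^2^2)) \<in> \<L>"
  using L2_field_lincomb[OF assms(1) identity_field_L2[OF assms(2)], of 1] by simp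

lemma shift_pairing:
  assumes M: "M \<in> \<L>" and z: "z \<in> \<L>" and u: "(v, w) \<in> \<U>"
  shows "pairing (hess w) (shift M z)
    = pairing M (hess w) + (\<integral>x. (z x *\<^sub>R mat 1) \<bullet> hess w x \<partial>\<mu>)"
proof -
  have "integrable \<mu> (\<lambda>x. M x \<bullet> hess w x)" "integrable \<mu> (\<lambda>x. (z x *\<^sub>R mat 1) \<bullet> hess w x)"
    by (intro inner_field_integrable identity_field_L2 M z U_spaceD[OF u])+
  then show ?thesis
    by (simp only: inner_add_right inner_commute[of "hess _ _"] Bochner_Integration.integral_add)
qed

lemma identity_sym: "c *\<^sub>R mat 1 \<in> sym_mat"
  by (simp add: sym_mat_iff mat_def)

lemma sym_mat_add: "A \<in> sym_mat \<Longrightarrow> B \<in> sym_mat \<Longrightarrow> A + B \<in> sym_mat"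
  by (simp add: sym_mat_iff)

text \<open>Three Fenchel inequalities, one for each quadratic energy: bending, membrane and the coupling
  through \<open>N + K \<delta>\<close>.\<close>

lemma lagrangian_le_primal_bound:
  assumes v: "(N, Q, M) \<in> \<B>" and fin: "inverse_integral N Q < \<infinity>"
    and z: "z \<in> \<L>" and u: "(v, w) \<in> \<U>"
  shows "lagrangian N Q M z v w \<le> primal_bound z (v, w)"
proof -
  note V = B_starD[OF v] and U = U_spaceD[OF u]
  have S: "(\<lambda>x. M x + z x *\<^sub>R (mat 1 :: real^2^2)) \<in> \<L>" by (rule shift_L2[OF V(4) z])
  have "pairing (hess w) (shift M z)
      \<le> (\<integral>x. tensor_form Th (hess w x) (hess w x) / 2
          + tensor_form Th' (shift M z x) (shift M z x) / 2 \<partial>\<mu>)"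
  proof (rule integral_mono_AE)
    show "integrable \<mu> (\<lambda>x. hess w x \<bullet> (shift M z x))"
      by (rule inner_field_integrable[OF U(11) S])
    show "integrable \<mu> (\<lambda>x. tensor_form Th (hess w x) (hess w x) / 2
          + tensor_form Th' (shift M z x) (shift M z x) / 2)"
      using tensor_form_integrable[OF U(11) U(11)] tensor_form_integrable[OF S S] by simp
    show "AE x in \<mu>. hess w x \<bullet> (shift M z x) \<le> tensor_form Th (hess w x) (hess w x) / 2
          + tensor_form Th' (shift M z x) (shift M z x) / 2"
      using V(6) by eventually_elim
        (unfold h_tensor_iso h_bar_iso, intro bend.iso_fenchel sym_mat_add identity_sym)
  qed
  then have i1: "pairing M (hess w) + (\<integral>x. (z x *\<^sub>R mat 1) \<bullet> hess w x \<partial>\<mu>)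
      \<le> form_int Th (hess w) (hess w) / 2
        + form_int Th' (shift M z) (shift M z) / 2"
    using tensor_form_integrable[OF U(11) U(11)] tensor_form_integrable[OF S S]
    by (simp add: shift_pairing[OF V(4) z u])
  have "pairing (strain (v, w)) N
      \<le> (\<integral>x. tensor_form TH (strain (v, w) x) (strain (v, w) x) / 2 + tensor_form TH' (N x) (N x) / 2 \<partial>\<mu>)"
  proof (rule integral_mono_AE)
    show "integrable \<mu> (\<lambda>x. strain (v, w) x \<bullet> N x)"
      by (rule inner_field_integrable[OF U(13) V(2)])
    show "integrable \<mu> (\<lambda>x. tensor_form TH (strain (v, w) x) (strain (v, w) x) / 2 + tensor_form TH' (N x) (N x) / 2)"
      using tensor_form_integrable[OF U(13) U(13)] tensor_form_integrable[OF V(2) V(2)] by simp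
    show "AE x in \<mu>. strain (v, w) x \<bullet> N x
        \<le> tensor_form TH (strain (v, w) x) (strain (v, w) x) / 2 + tensor_form TH' (N x) (N x) / 2"
      using V(5) by eventually_elim (unfold H_tensor_iso H_bar_iso, intro memb.iso_fenchel)
  qed
  then have i2: "pairing N (sym_grad v) + pairing N (grad_outer w) / 2
      \<le> form_int TH (strain (v, w)) (strain (v, w)) / 2
        + form_int TH' N N / 2"
    using tensor_form_integrable[OF U(13) U(13)] tensor_form_integrable[OF V(2) V(2)]
    by (simp add: gamma_pairing[OF V(2) u])
  have "(\<integral>x. 2 * (Q x \<bullet> grad w x) - grad w x \<bullet> ((stiff N x) *v grad w x) \<partial>\<mu>)
      \<le> enn2real (inverse_integral N Q)"
  proof (rule inverse_integral_lower_bound[OF v fin])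
    show "integrable \<mu> (\<lambda>x. 2 * (Q x \<bullet> grad w x) - grad w x \<bullet> ((stiff N x) *v grad w x))"
      using inner_field_integrable[OF V(3) U(10)] grad_form_integral(1)[OF V(2) u] by simp
    show "AE x in \<mu>. 2 * (Q x \<bullet> grad w x) - grad w x \<bullet> ((stiff N x) *v grad w x)
        \<le> Q x \<bullet> inv_apply (stiff N x) (Q x)"
      using V(7) by eventually_elim (rule inverse_form_fenchel)
  qed
  then have i3: "2 * pairing Q (grad w)
      - (pairing N (grad_outer w) + K * square_int (grad w))
      \<le> enn2real (inverse_integral N Q)"
    using inner_field_integrable[OF V(3) U(10)] grad_form_integral[OF V(2) u] by simp
  show ?thesis
    using i1 i2 i3 unfolding lagrangian_def primal_bound_def J_eq snd_conv by simp
qed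

lemma lagrangian_eq_primal_bound:
  assumes v: "(N, Q, M) \<in> \<B>"
    and z: "z \<in> \<L>" and u: "(v, w) \<in> \<U>"
    and M: "AE x in \<mu>. tensor_apply Th' (shift M z x) = sym_part (hess w x)"
    and N: "AE x in \<mu>. tensor_apply TH' (N x) = strain (v, w) x"
    and Q: "AE x in \<mu>. inv_apply (stiff N x) (Q x) = grad w x"
  shows "lagrangian N Q M z v w = primal_bound z (v, w)"
proof -
  note V = B_starD[OF v] and U = U_spaceD[OF u]
  have S: "(\<lambda>x. M x + z x *\<^sub>R (mat 1 :: real^2^2)) \<in> \<L>" by (rule shift_L2[OF V(4) z])
  have m: "AE x in \<mu>. tensor_form Th (hess w x) (hess w x) = hess w x \<bullet> (shift M z x) \<and>
      tensor_form Th' (shift M z x) (shift M z x) = hess w x \<bullet> (shift M z x)"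
    using V(6) M
  proof eventually_elim
    case (elim x)
    have s: "shift M z x \<in> sym_mat" using elim by (intro sym_mat_add identity_sym)
    show ?case
      using bend.iso_fenchel_equality[OF s elim(2)[unfolded h_bar_iso]]
      unfolding h_tensor_iso h_bar_iso by (simp add: inner_commute)
  qed
  have sp: "sym_part (strain (v, w) x) = strain (v, w) x" for x
    using gamma_sym[of "(v, w)" x] by (simp add: mat2_eq_iff sym_mat_iff)
  have n: "AE x in \<mu>. tensor_form TH (strain (v, w) x) (strain (v, w) x) = strain (v, w) x \<bullet> N x \<and>
      tensor_form TH' (N x) (N x) = strain (v, w) x \<bullet> N x"
    using V(5) N
  proof eventually_elim
    case (elim x)
    show ?case
      using memb.iso_fenchel_equality[OF elim(1), of "strain (v, w) x"] elim(2)
      unfolding H_tensor_iso H_bar_iso by (simp add: inner_commute sp)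
  qed
  have q: "AE x in \<mu>. Q x \<bullet> inv_apply (stiff N x) (Q x) = Q x \<bullet> grad w x \<and> 0 \<le> Q x \<bullet> grad w x
      \<and> Q x \<bullet> grad w x = grad w x \<bullet> ((stiff N x) *v grad w x)"
    using V(7) Q
  proof eventually_elim
    case (elim x)
    then show ?case using inv_apply_form[OF elim(1), of "Q x"] by simp
  qed
  have e1: "form_int Th (hess w) (hess w) = pairing (hess w) (shift M z)"
    "form_int Th' (shift M z) (shift M z) = pairing (hess w) (shift M z)"
    using m tensor_form_integrable[OF U(11) U(11)] tensor_form_integrable[OF S S] inner_field_integrable[OF U(11) S]
    by (auto intro!: integral_cong_AE borel_measurable_integrable)
  have e2: "form_int TH (strain (v, w)) (strain (v, w)) = pairing (strain (v, w)) N"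
    "form_int TH' N N = pairing (strain (v, w)) N"
    using n tensor_form_integrable[OF U(13) U(13)] tensor_form_integrable[OF V(2) V(2)] inner_field_integrable[OF U(13) V(2)]
    by (auto intro!: integral_cong_AE borel_measurable_integrable)
  have qi: "integrable \<mu> (\<lambda>x. Q x \<bullet> grad w x)" by (rule inner_field_integrable[OF V(3) U(10)])
  have "inverse_integral N Q = (\<integral>\<^sup>+x. ennreal (Q x \<bullet> grad w x) \<partial>\<mu>)"
    unfolding inverse_integral_inv_apply[OF v] using q by (intro nn_integral_cong_AE) auto
  also have "\<dots> = ennreal (pairing Q (grad w))"
    using q qi by (intro nn_integral_eq_integral) auto
  finally have e3: "enn2real (inverse_integral N Q) = pairing Q (grad w)"
    using q by (simp add: integral_nonneg_AE)
  have "pairing Q (grad w) = (\<integral>x. grad w x \<bullet> ((stiff N x) *v grad w x) \<partial>\<mu>)"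
    using q qi grad_form_integral(1)[OF V(2) u] by (auto intro!: integral_cong_AE borel_measurable_integrable)
  then have e4: "pairing Q (grad w) = pairing N (grad_outer w) + K * square_int (grad w)"
    by (simp add: grad_form_integral(2)[OF V(2) u])
  show ?thesis
    using e4 unfolding lagrangian_def primal_bound_def J_eq snd_conv e1 e2 e3
      shift_pairing[OF V(4) z u] gamma_pairing[OF V(2) u]
    by (simp add: field_simps)
qed

text \<open>If \<open>\<nabla> z = - K \<nabla> w\<^sub>0\<close>, completing the square in \<open>\<nabla> w\<close> turns the bound into the regularized primal
  energy.\<close>

lemma primal_bound_regularized:
  assumes z: "z \<in> W1" and w0: "w0 \<in> W1" and u: "(v, w) \<in> \<U>"
    and gz: "AE x in \<mu>. grad z x = - K *\<^sub>R grad w0 x"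
  shows "primal_bound z (v, w) = Jp (v, w) + K / 2 * square_int (\<lambda>x. grad w x - grad w0 x)"
proof -
  have gL: "grad z \<in> \<L>" "grad w0 \<in> \<L>" "grad w \<in> \<L>"
    using z w0 U_spaceD[OF u] grad2_L2 by auto
  have gz': "AE x in \<mu>. grad z x = line (\<lambda>x. 0) (grad w0) (- K) x" using gz by simp
  have "pairing (grad w) (grad z) = - K * pairing (grad w) (grad w0)"
    using pairing_line[OF gL(3) L2_zero gL(2,1) gz'] by simp
  then have a: "(\<integral>x. (z x *\<^sub>R mat 1) \<bullet> hess w x \<partial>\<mu>) = K * pairing (grad w) (grad w0)"
    unfolding identity_inner_hess_by_parts[OF z U_spaceD(5)[OF u]] by (simp add: pairing_commute[of "grad z"])
  have b: "Fz z = K / 2 * square_int (grad w0)"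
    using square_int_line[OF L2_zero gL(2,1) gz'] K_pos by (simp add: F_star_eq power2_eq_square)
  have c: "square_int (\<lambda>x. grad w x - grad w0 x)
      = square_int (grad w) - 2 * pairing (grad w) (grad w0) + square_int (grad w0)"
    using square_int_line[OF gL(3,2) L2_field_lincomb[OF gL(3,2), of "- 1"], of "- 1"] by simp
  show ?thesis
    unfolding primal_bound_def snd_conv a b c by (simp add: algebra_simps)
qed

end

section \<open>Consequences of stationarity\<close>

text \<open>A one-sided affine bound suffices to identify a derivative. For concave functionals this avoids
  differentiating under the integral sign.\<close>

lemma stationary_slope_eq_0:
  fixes f :: "real \<Rightarrow> real"
  assumes d: "(f has_real_derivative 0) (at 0)" and e: "e > 0"
    and le: "\<And>t. \<bar>t\<bar> < e \<Longrightarrow> f t \<le> f 0 + t * L"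
  shows "L = 0"
proof -
  have "((\<lambda>t. f t - t * L) has_real_derivative 0 - L) (at 0)"
    by (auto intro!: derivative_eq_intros d)
  then have "0 - L = 0"
    by (rule DERIV_local_max[OF _ e]) (use le in force)
  then show ?thesis by simp
qed

context plate
begin

definition stationary :: "matrix_field \<Rightarrow> vector_field \<Rightarrow> matrix_field \<Rightarrow> scalar_field \<Rightarrow>
    vector_field \<Rightarrow> scalar_field \<Rightarrow> bool" where
  "stationary N Q M z v w \<longleftrightarrow> (N, Q, M) \<in> \<B> \<and> z \<in> W2\<^sub>0 \<and> (v, w) \<in> \<U> \<and>
    has_first_variation (\<B> \<times> W2\<^sub>0 \<times> \<U>)
      (\<lambda>(v, z, u). J3_star \<Omega> h la mu K P p v z u) ((N, Q, M), z, (v, w)) (\<lambda>_. 0)"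

lemma stationaryD:
  assumes "stationary N Q M z v w"
  shows "(N, Q, M) \<in> \<B>" "z \<in> W2\<^sub>0" "(v, w) \<in> \<U>" "inverse_integral N Q < \<infinity>"
proof -
  show B: "(N, Q, M) \<in> \<B>" "z \<in> W2\<^sub>0" and u: "(v, w) \<in> \<U>"
    using assms by (auto simp: stationary_def)
  have "\<bar>J3_star \<Omega> h la mu K P p (N, Q, M) z (v, w)\<bar> \<noteq> \<infinity>"
    using assms by (simp add: stationary_def has_first_variation_def Let_def)
  then show "inverse_integral N Q < \<infinity>"
    by (auto simp: J3_star_eq[OF B(1) u] split: if_splits)
qed

lemma stationary_derivative:
  assumes s: "stationary N Q M z v w" and e: "e > 0"
    and adm: "\<And>t. \<bar>t\<bar> < e \<Longrightarrow> (line N dN t, line Q dQ t, line M dM t) \<in> \<B>"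
      "\<And>t. \<bar>t\<bar> < e \<Longrightarrow> inverse_integral (line N dN t) (line Q dQ t) < \<infinity>"
      "\<And>t. (\<lambda>x. z x + t * dz x) \<in> W2\<^sub>0"
      "\<And>t. (line v dv t, \<lambda>x. w x + t * dw x) \<in> \<U>"
  shows "((\<lambda>t. lagrangian (line N dN t) (line Q dQ t) (line M dM t)
      (\<lambda>x. z x + t * dz x) (line v dv t) (\<lambda>x. w x + t * dw x)) has_real_derivative 0) (at 0)"
proof -
  let ?f = "\<lambda>(v, z, u). J3_star \<Omega> h la mu K P p v z u"
  let ?x = "((N, Q, M), z, (v, w))" and ?\<eta> = "((dN, dQ, dM), dz, (dv, dw))"
  let ?l = "\<lambda>t. lagrangian (line N dN t) (line Q dQ t) (line M dM t)
      (\<lambda>x. z x + t * dz x) (line v dv t) (\<lambda>x. w x + t * dw x)"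
  have line: "?x + t *\<^sub>R ?\<eta> = ((line N dN t, line Q dQ t, line M dM t),
      \<lambda>x. z x + t * dz x, (line v dv t, \<lambda>x. w x + t * dw x))" for t
    by (simp add: plus_fun_def scaleR_fun_def)
  have val: "?f (?x + t *\<^sub>R ?\<eta>) = ereal (?l t)" if "\<bar>t\<bar> < e" for t
    unfolding line using that adm by (simp add: J3_star_eq)
  have mem: "?x + t *\<^sub>R ?\<eta> \<in> \<B> \<times> W2\<^sub>0 \<times> \<U>" if "\<bar>t\<bar> < e" for t
    unfolding line using that adm by simp
  have "\<forall>\<eta>. (\<exists>e>0. \<forall>t. \<bar>t\<bar> < e \<longrightarrow> ?x + t *\<^sub>R \<eta> \<in> {y \<in> \<B> \<times> W2\<^sub>0 \<times> \<U>. \<bar>?f y\<bar> \<noteq> \<infinity>}) \<longrightarrow>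
      ((\<lambda>t. real_of_ereal (?f (?x + t *\<^sub>R \<eta>))) has_real_derivative 0) (at 0)"
    using s unfolding stationary_def has_first_variation_def Let_def by blast
  moreover have "?x + t *\<^sub>R ?\<eta> \<in> {y \<in> \<B> \<times> W2\<^sub>0 \<times> \<U>. \<bar>?f y\<bar> \<noteq> \<infinity>}" if "\<bar>t\<bar> < e" for t
    using mem[OF that] val[OF that] by simp
  ultimately have "((\<lambda>t. real_of_ereal (?f (?x + t *\<^sub>R ?\<eta>))) has_real_derivative 0) (at 0)"
    using e by blast
  then show ?thesis
    by (rule has_field_derivative_transform_within_open[where S = "{-e<..<e}"])
      (use e val in \<open>auto simp: abs_less_iff\<close>)
qed

text \<open>The Lagrangian is affine in the displacement, so its variation is the pair of residuals.\<close>

lemma stationary_residuals: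
  assumes s: "stationary N Q M z v w" and u: "(v', w') \<in> \<U>"
  shows "TR (N, Q, M) w'
    - (\<Sum>\<alpha>\<in>UNIV. IR (N, Q, M) \<alpha> (\<lambda>x. v' x $ \<alpha>)) = 0"
proof -
  note S = stationaryD[OF s] and B = B_starD[OF stationaryD(1)[OF s]]
    and U = U_spaceD[OF stationaryD(3)[OF s]] and U' = U_spaceD[OF u]
  let ?R = "\<lambda>v w. TR (N, Q, M) w
    - (\<Sum>\<alpha>\<in>UNIV. IR (N, Q, M) \<alpha> (\<lambda>x. v x $ \<alpha>))"
  let ?l = "\<lambda>t. lagrangian N Q M z (line v v' t) (\<lambda>x. w x + t * w' x)"
  have R: "lagrangian N Q M z f g = lagrangian N Q M z v w - ?R v w + ?R f g" if "(f, g) \<in> \<U>" for f g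
    unfolding inplane_residual_sum[OF B(1) U(2)] inplane_residual_sum[OF B(1) U_spaceD(2)[OF that]]
      transverse_residual_eq lagrangian_def by simp
  have lin: "?R (line v v' t) (\<lambda>x. w x + t * w' x) = ?R v w + t * ?R v' w'" for t
  proof -
    have "IR (N, Q, M) \<alpha> (\<lambda>x. (v x + t *\<^sub>R v' x) $ \<alpha>)
        = IR (N, Q, M) \<alpha> (\<lambda>x. v x $ \<alpha>) + t * IR (N, Q, M) \<alpha> (\<lambda>x. v' x $ \<alpha>)"
      for \<alpha>
      using inplane_residual_lincomb[OF B(2) U(2)[of \<alpha>] U'(2)[of \<alpha>], where c = t] by simp
    then show ?thesis
      using transverse_residual_lincomb[OF B(4,3) U(6) U'(6), of N t]
      by (simp add: sum.distrib sum_distrib_left[symmetric] right_diff_distrib)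
  qed
  have eq: "?l t = lagrangian N Q M z v w + t * ?R v' w'" for t
    using R[OF U_space_lincomb[OF S(3) u, of t]] lin[of t] by simp
  have "(?l has_real_derivative 0) (at 0)"
    using stationary_derivative[OF s zero_less_one, of "\<lambda>_. 0" "\<lambda>_. 0" "\<lambda>_. 0" "\<lambda>_. 0" v' w'] S
      U_space_lincomb[OF S(3) u] by simp
  then show ?thesis
    unfolding eq by (intro stationary_slope_eq_0[OF _ zero_less_one]) auto
qed

lemma U_space_transverse: "w \<in> W2\<^sub>0 \<Longrightarrow> (\<lambda>x. 0, w) \<in> \<U>"
  by (simp add: U_space_def test_fun_W12_0 test_fun_zero)

lemma inplane_residual_zero:
  assumes "N \<in> \<L>"
  shows "IR (N, Q, M) \<alpha> (\<lambda>x. 0) = 0"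
  using inplane_residual_lincomb[OF assms test_fun_W12[OF test_fun_zero] test_fun_W12[OF test_fun_zero], of Q M \<alpha> 1]
  by simp

lemma transverse_residual_zero:
  assumes "M \<in> \<L>" "Q \<in> \<L>"
  shows "TR (N, Q, M) (\<lambda>x. 0) = 0"
  using transverse_residual_lincomb[OF assms test_fun_W22[OF test_fun_zero] test_fun_W22[OF test_fun_zero], of N 1]
  by simp

lemma stationary_A_star:
  assumes s: "stationary N Q M z v w"
  shows "(N, Q, M) \<in> \<A>"
proof -
  note B = B_starD[OF stationaryD(1)[OF s]]
  have "TR (N, Q, M) \<phi> = 0" if "\<phi> \<in> \<T>" for \<phi>
    using stationary_residuals[OF s U_space_transverse[OF test_fun_W22_0[OF that]]]
    by (simp add: inplane_residual_zero[OF B(2)])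
  moreover have "IR (N, Q, M) \<alpha> \<phi> = 0" if \<phi>: "\<phi> \<in> \<T>" for \<alpha> \<phi>
  proof -
    have c: "(\<lambda>x. axis \<alpha> (\<phi> x) $ \<beta>) = (if \<beta> = \<alpha> then \<phi> else (\<lambda>x. 0))" for \<beta>
      by (auto simp: axis_def)
    have "(\<lambda>x. axis \<alpha> (\<phi> x), \<lambda>x. 0) \<in> \<U>"
      using \<phi> by (simp add: U_space_def c test_fun_W12_0 test_fun_zero W22_0_zero)
    from stationary_residuals[OF s this]
    have "(\<Sum>\<beta>\<in>UNIV. IR (N, Q, M) \<beta> (if \<beta> = \<alpha> then \<phi> else (\<lambda>x. 0))) = 0"
      by (simp add: c transverse_residual_zero[OF B(4) B(3)])
    moreover have "(\<Sum>\<beta>\<in>UNIV. IR (N, Q, M) \<beta> (if \<beta> = \<alpha> then \<phi> else (\<lambda>x. 0)))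
        = (\<Sum>\<beta>\<in>UNIV. if \<beta> = \<alpha> then IR (N, Q, M) \<beta> \<phi> else 0)"
      by (intro sum.cong) (auto simp: inplane_residual_zero[OF B(2)])
    ultimately show ?thesis by simp
  qed
  ultimately show ?thesis
    using stationaryD(1)[OF s] by (simp add: A_star_def A1_star_def A2_star_def)
qed

text \<open>On admissible fields both residuals vanish, so the Lagrangian does not depend on the
  displacement.\<close>

lemma J_star_A_star:
  assumes v: "(N, Q, M) \<in> \<A>" and u: "(v, w) \<in> \<U>"
  shows "dual (N, Q, M) z
    = (if inverse_integral N Q < \<infinity> then ereal (lagrangian N Q M z v w) else - \<infinity>)"
proof -
  have B: "(N, Q, M) \<in> \<B>" and
    t: "\<And>\<phi>. \<phi> \<in> \<T> \<Longrightarrow> TR (N, Q, M) \<phi> = 0" and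
    i: "\<And>\<alpha> \<phi>. \<phi> \<in> \<T> \<Longrightarrow> IR (N, Q, M) \<alpha> \<phi> = 0"
    using v by (auto simp: A_star_def A1_star_def A2_star_def)
  note B' = B_starD[OF B] and U = U_spaceD[OF u]
  have "TR (N, Q, M) w = 0"
    by (rule transverse_residual_eq_0[OF B'(4,3) t U(5)])
  moreover have "IR (N, Q, M) \<alpha> (\<lambda>x. v x $ \<alpha>) = 0" for \<alpha>
    by (rule inplane_residual_eq_0[OF B'(2) i U(1)])
  ultimately have "J3_star \<Omega> h la mu K P p (N, Q, M) z (v, w) = dual (N, Q, M) z + ereal 0"
    by (simp add: J3_star_def)
  then show ?thesis
    using J3_star_eq[OF B u, of z] by simp
qed

subsection \<open>Variation of the dual variable\<close>

lemma quadratic_form_perturb: "y \<bullet> ((A + t *\<^sub>R B) *v y) = y \<bullet> (A *v y) + t * (B \<bullet> outer y y)"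
  by (simp add: inner_outer inner_vec2 matrix_vector_2 algebra_simps)

lemma inverse_integrand_measurable:
  assumes "N \<in> borel_measurable \<mu>" "Q \<in> borel_measurable \<mu>"
  shows "(\<lambda>x. inv_apply (stiff N x) (Q x)) \<in> borel_measurable \<mu>"
    "(\<lambda>x. eig_bound (stiff N x)) \<in> borel_measurable \<mu>"
proof -
  have [measurable]: "\<And>i j. (\<lambda>x. N x $ i $ j) \<in> borel_measurable \<mu>" "\<And>i. (\<lambda>x. Q x $ i) \<in> borel_measurable \<mu>"
    using assms by (simp_all add: borel_measurable_vec_iff)
  have [measurable]: "(\<lambda>x. (stiff N x) $ i $ j) \<in> borel_measurable \<mu>" for i j
    by simp
  have "(\<lambda>x. inv_apply (stiff N x) (Q x) $ i) \<in> borel_measurable \<mu>" for i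
    using exhaust_2[of i] unfolding det2_def inv_apply_nth by (elim disjE) (simp_all add: det2_def)
  then show "(\<lambda>x. inv_apply (stiff N x) (Q x)) \<in> borel_measurable \<mu>"
    by (simp add: borel_measurable_vec_iff)
  show "(\<lambda>x. eig_bound (stiff N x)) \<in> borel_measurable \<mu>"
    unfolding eig_bound_def det2_def by measurable
qed

lemma form_int_line_lower:
  assumes S: "S \<in> \<L>" and D: "D \<in> \<L>" "AE x in \<mu>. D x \<in> sym_mat"
    and T: "T = iso_tensor a b" and nonneg: "\<And>A. A \<in> sym_mat \<Longrightarrow> tensor_form T A A \<ge> 0"
  shows "form_int T S S + 2 * t * pairing (\<lambda>x. tensor_apply T (S x)) D \<le> form_int T (line S D t) (line S D t)"
proof -
  have "0 \<le> form_int T D D"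
    using D(2) by (intro integral_nonneg_AE) (auto elim!: eventually_mono intro: nonneg)
  moreover have "form_int T S D = pairing (\<lambda>x. tensor_apply T (S x)) D"
    by (simp add: T tensor_form_iso)
  ultimately show ?thesis
    using form_int_line[OF S D(1) L2_field_lincomb[OF S D(1)] T, of t t] by simp
qed

text \<open>Concavity of the Lagrangian in the dual variable in the form of a tangent bound. Fenchel's inequality
  with the fixed vector \<open>y = (N + K \<delta>)\<^sup>-\<^sup>1 Q\<close> bounds the inverse integral from below by a functional that is
  affine along the line.\<close>

lemma lagrangian_line_le:
  assumes B: "(N, Q, M) \<in> \<B>" "inverse_integral N Q < \<infinity>"
    and Bt: "(line N dN t, line Q dQ t, line M dM t) \<in> \<B>" "inverse_integral (line N dN t) (line Q dQ t) < \<infinity>"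
    and z: "z \<in> \<L>" and u: "(v, w) \<in> \<U>"
    and dL: "dN \<in> \<L>" "dQ \<in> \<L>" "dM \<in> \<L>"
    and ds: "AE x in \<mu>. dN x \<in> sym_mat" "AE x in \<mu>. dM x \<in> sym_mat"
    and y: "\<And>x. y x = inv_apply (stiff N x) (Q x)" "y \<in> borel_measurable \<mu>"
    and yi: "integrable \<mu> (\<lambda>x. dN x \<bullet> outer (y x) (y x))" "integrable \<mu> (\<lambda>x. dQ x \<bullet> y x)"
  shows "lagrangian (line N dN t) (line Q dQ t) (line M dM t) z v w \<le> lagrangian N Q M z v w
      + t * (pairing dM (hess w) - pairing (\<lambda>x. tensor_apply Th' (shift M z x)) dM
        + (pairing dQ (grad w) - pairing dQ y)
        + (pairing dN (sym_grad v) + pairing dN (\<lambda>x. outer (y x) (y x)) / 2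
          - pairing (\<lambda>x. tensor_apply TH' (N x)) dN))"
proof -
  note V = B_starD[OF B(1)] and U = U_spaceD[OF u]
  have [measurable]: "Q \<in> borel_measurable \<mu>" "y \<in> borel_measurable \<mu>" using V L2_measurable y(2) by auto
  have Qy: "AE x in \<mu>. 0 \<le> Q x \<bullet> y x \<and> Q x \<bullet> y x = y x \<bullet> (stiff N x *v y x)"
    using V(7) by eventually_elim (use inv_apply_form in \<open>auto simp: y\<close>)
  have inv: "inverse_integral N Q = (\<integral>\<^sup>+x. ennreal (Q x \<bullet> y x) \<partial>\<mu>)"
    unfolding inverse_integral_inv_apply[OF B(1)] y ..
  have Qyi: "integrable \<mu> (\<lambda>x. Q x \<bullet> y x)"
    by (rule integrableI_nonneg) (use Qy B(2) inv in auto)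
  have inv': "enn2real (inverse_integral N Q) = pairing Q y"
    unfolding inv using Qy Qyi by (subst nn_integral_eq_integral) (auto simp: integral_nonneg_AE)
  have "form_int Th' (shift M z) (shift M z) + 2 * t * pairing (\<lambda>x. tensor_apply Th' (shift M z x)) dM
      \<le> form_int Th' (line (shift M z) dM t) (line (shift M z) dM t)"
    by (rule form_int_line_lower[OF shift_L2[OF V(4) z] dL(3) ds(2) h_bar_iso])
      (use bend.inverse_form_nonneg in \<open>auto simp: h_bar_iso\<close>)
  moreover have "line (shift M z) dM t x = shift (line M dM t) z x" for x by simp
  ultimately have p1: "form_int Th' (shift M z) (shift M z) + 2 * t * pairing (\<lambda>x. tensor_apply Th' (shift M z x)) dM
      \<le> form_int Th' (shift (line M dM t) z) (shift (line M dM t) z)"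
    by (simp only:)
  have p2: "form_int TH' N N + 2 * t * pairing (\<lambda>x. tensor_apply TH' (N x)) dN
      \<le> form_int TH' (line N dN t) (line N dN t)"
    by (rule form_int_line_lower[OF V(2) dL(1) ds(1) H_bar_iso])
      (use memb.inverse_form_nonneg in \<open>auto simp: H_bar_iso\<close>)
  have "(\<integral>x. Q x \<bullet> y x + t * (2 * (dQ x \<bullet> y x) - dN x \<bullet> outer (y x) (y x)) \<partial>\<mu>)
      \<le> enn2real (inverse_integral (line N dN t) (line Q dQ t))"
  proof (rule inverse_integral_lower_bound[OF Bt])
    show "integrable \<mu> (\<lambda>x. Q x \<bullet> y x + t * (2 * (dQ x \<bullet> y x) - dN x \<bullet> outer (y x) (y x)))"
      using Qyi yi by simp
    show "AE x in \<mu>. Q x \<bullet> y x + t * (2 * (dQ x \<bullet> y x) - dN x \<bullet> outer (y x) (y x))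
        \<le> line Q dQ t x \<bullet> inv_apply (stiff (line N dN t) x) (line Q dQ t x)"
      using B_starD(7)[OF Bt(1)] Qy
    proof eventually_elim
      case (elim x)
      have "stiff (line N dN t) x = stiff N x + t *\<^sub>R dN x" by simp
      then have "y x \<bullet> (stiff (line N dN t) x *v y x) = Q x \<bullet> y x + t * (dN x \<bullet> outer (y x) (y x))"
        using elim(2) quadratic_form_perturb[of "y x" "stiff N x" t "dN x"] by (simp only:)
      then show ?case
        using inverse_form_fenchel[OF elim(1), of "line Q dQ t x" "y x"] by (simp add: inner_add_left algebra_simps)
    qed
  qed
  then have p3: "enn2real (inverse_integral N Q) + t * (2 * pairing dQ y - pairing dN (\<lambda>x. outer (y x) (y x)))
      \<le> enn2real (inverse_integral (line N dN t) (line Q dQ t))"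
    using Qyi yi by (simp add: inv')
  have l: "pairing (line M dM t) (hess w) = pairing M (hess w) + t * pairing dM (hess w)"
    "pairing (line Q dQ t) (grad w) = pairing Q (grad w) + t * pairing dQ (grad w)"
    "pairing (line N dN t) (sym_grad v) = pairing N (sym_grad v) + t * pairing dN (sym_grad v)"
    using V U dL by (simp_all add: inner_add_left inner_field_integrable)
  show ?thesis
    using p1 p2 p3 unfolding lagrangian_def l by (simp add: field_simps)
qed

text \<open>The three Euler-Lagrange equations of the dual variable. The variation of \<open>M\<close> is the residual
  of the first equation itself. The variations of \<open>N\<close> and \<open>Q\<close> are the residuals \<open>X\<close> and \<open>R\<close> of the
  other two, scaled to be bounded and multiplied by a positive weight \<open>m\<close>. The weight lies below the
  eigenvalues of \<open>N + K \<delta>\<close>, which keeps the perturbed matrix positive definite and the inverse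
  integral finite, although \<open>N + K \<delta>\<close> need not be uniformly positive definite. Along this direction the slope
  of the Lagrangian is the integral of \<open>|Z|\<^sup>2 + m |R|\<^sup>2 / (1 + |R|) + m |X|\<^sup>2 / (1 + |X|)\<close>.\<close>

lemma stationary_dual_equations:
  assumes s: "stationary N Q M z v w"
  shows "AE x in \<mu>. tensor_apply Th' (shift M z x) = sym_part (hess w x)"
    and "AE x in \<mu>. tensor_apply TH' (N x) = strain (v, w) x"
    and "AE x in \<mu>. inv_apply (stiff N x) (Q x) = grad w x"
proof -
  note S = stationaryD[OF s] and V = B_starD[OF stationaryD(1)[OF s]] and U = U_spaceD[OF stationaryD(3)[OF s]]
  have zL: "z \<in> \<L>" using S(2) W22_0_W22 W22_W12 W12_L2 by blast
  define A where "A x = stiff N x" for x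
  define y where "y x = inv_apply (A x) (Q x)" for x
  define g where "g = grad w"
  define e where "e = sym_grad v"
  define X where "X x = e x + (1 / 2) *\<^sub>R outer (y x) (y x) - tensor_apply TH' (N x)" for x
  define R where "R x = g x - y x" for x
  define Sh where "Sh x = M x + z x *\<^sub>R (mat 1 :: real^2^2)" for x
  define Z where "Z x = sym_part (hess w x) - tensor_apply Th' (Sh x)" for x
  \<comment> \<open>The denominator bounds \<open>m |y|\<^sup>2\<close>, since \<open>|y|\<^sup>2\<close> need not be integrable; the maximum with zero
    matters only on the null set where \<open>N + K \<delta>\<close> fails to be positive definite.\<close>
  define m where "m x = max 0 (min 1 (eig_bound (A x))) / (1 + (norm (y x))\<^sup>2)" for x
  define C where "C x = (1 / (1 + norm (X x))) *\<^sub>R X x" for x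
  define \<xi> where "\<xi> x = (1 / (1 + norm (R x))) *\<^sub>R R x" for x
  define dN where "dN x = m x *\<^sub>R C x" for x
  define dQ where "dQ x = m x *\<^sub>R \<xi> x" for x

  have posA: "AE x in \<mu>. pos_def (A x)" using V(7) by (simp add: A_def)
  have gL: "g \<in> \<L>" and eL: "e \<in> \<L>" and ShL: "Sh \<in> \<L>"
    using U shift_L2[OF V(4) zL] by (auto simp: g_def e_def Sh_def[abs_def])
  have [measurable]: "N \<in> borel_measurable \<mu>" "Q \<in> borel_measurable \<mu>" "g \<in> borel_measurable \<mu>" "e \<in> borel_measurable \<mu>"
    "(\<lambda>x. tensor_apply TH' (N x)) \<in> borel_measurable \<mu>"
    using V gL eL tensor_apply_L2[OF V(2)] L2_measurable by auto
  have [measurable]: "y \<in> borel_measurable \<mu>" "(\<lambda>x. eig_bound (A x)) \<in> borel_measurable \<mu>"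
    unfolding y_def[abs_def] A_def by (intro inverse_integrand_measurable; measurable)+
  have yc: "(\<lambda>x. y x $ i) \<in> borel_measurable \<mu>" for i
    using \<open>y \<in> borel_measurable \<mu>\<close> by (simp add: borel_measurable_vec_iff)
  have [measurable]: "(\<lambda>x. outer (y x) (y x)) \<in> borel_measurable \<mu>"
    using yc by (simp add: borel_measurable_vec_iff outer_def)
  have [measurable]: "m \<in> borel_measurable \<mu>" "X \<in> borel_measurable \<mu>" "R \<in> borel_measurable \<mu>"
    unfolding m_def[abs_def] X_def[abs_def] R_def[abs_def] by measurable
  have [measurable]: "C \<in> borel_measurable \<mu>" "\<xi> \<in> borel_measurable \<mu>"
    unfolding C_def[abs_def] \<xi>_def[abs_def] by measurable
  have [measurable]: "dN \<in> borel_measurable \<mu>" "dQ \<in> borel_measurable \<mu>"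
    unfolding dN_def[abs_def] dQ_def[abs_def] by measurable

  have m0: "0 \<le> m x" and m1: "m x \<le> 1" and my: "m x * norm (y x) \<le> 1" and myy: "m x * (norm (y x))\<^sup>2 \<le> 1" for x
  proof -
    define c where "c = max 0 (min 1 (eig_bound (A x)))"
    have c: "0 \<le> c" "c \<le> 1" by (auto simp: c_def)
    have m: "m x = c / (1 + (norm (y x))\<^sup>2)" by (simp add: m_def c_def)
    have p: "1 + (norm (y x))\<^sup>2 > 0" by (simp add: add_pos_nonneg)
    have k: "m x * k \<le> 1" if "0 \<le> k" "k \<le> 1 + (norm (y x))\<^sup>2" for k
      using mult_mono[OF c(2) that(2) zero_le_one that(1)] p by (simp add: m)
    show "0 \<le> m x" using c p by (simp add: m)
    show "m x \<le> 1" using k[of 1] by simp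
    show "m x * (norm (y x))\<^sup>2 \<le> 1" using k[of "(norm (y x))\<^sup>2"] by simp
    have "2 * norm (y x) \<le> 1 + (norm (y x))\<^sup>2" using sum_squares_bound[of 1 "norm (y x)"] by simp
    then show "m x * norm (y x) \<le> 1" using k[of "norm (y x)"] norm_ge_zero[of "y x"] by linarith
  qed
  have mpos: "AE x in \<mu>. 0 < m x \<and> m x \<le> eig_bound (A x)"
    using posA
  proof eventually_elim
    case (elim x)
    have e: "eig_bound (A x) > 0" by (rule eig_bound[OF elim])
    have p: "1 + (norm (y x))\<^sup>2 > 0" by (simp add: add_pos_nonneg)
    have "m x \<le> max 0 (min 1 (eig_bound (A x)))"
      unfolding m_def using p by (simp add: divide_le_eq mult_le_cancel_left1)
    then show ?case
      using e p by (auto simp: m_def)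
  qed
  have nC: "norm (C x) \<le> 1" and n\<xi>: "norm (\<xi> x) \<le> 1" for x
    by (simp_all add: C_def \<xi>_def divide_le_eq add_pos_nonneg)
  have cC: "\<bar>C x $ i $ j\<bar> \<le> 1" for x i j
    using nC[of x] Finite_Cartesian_Product.norm_nth_le[of "C x" i] component_le_norm_cart[of "C x $ i" j] by linarith
  have Xs: "AE x in \<mu>. X x \<in> sym_mat"
  proof (rule AE_I2)
    fix x
    show "X x \<in> sym_mat"
      using tensor_apply_iso_sym[of memb.inv_a memb.inv_b "N x"] sym_grad_sym[of v x]
      by (simp add: X_def e_def sym_mat_iff outer_def mult.commute H_bar_iso)
  qed
  have Zs: "Z x \<in> sym_mat" for x
    using tensor_apply_iso_sym[of bend.inv_a bend.inv_b "Sh x"]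
    by (simp add: Z_def sym_mat_iff h_bar_iso add.commute)
  have Cs: "AE x in \<mu>. C x \<in> sym_mat" using Xs by eventually_elim (simp add: C_def sym_mat_iff)
  then have dNs: "AE x in \<mu>. dN x \<in> sym_mat" by eventually_elim (simp add: dN_def sym_mat_iff)
  have dNL: "dN \<in> \<L>"
    by (rule bounded_field_L2[of _ 1]) (use m0 m1 nC in \<open>auto simp: dN_def intro: mult_le_one\<close>)
  have dQL: "dQ \<in> \<L>"
    by (rule bounded_field_L2[of _ 1]) (use m0 m1 n\<xi> in \<open>auto simp: dQ_def intro: mult_le_one\<close>)
  have sp: "sym_part H = tensor_apply (iso_tensor 0 (1 / 2)) H" for H
    by (simp add: mat2_eq_iff tensor_apply_iso)
  have ZL: "Z \<in> \<L>"
    using L2_field_lincomb[OF tensor_apply_L2[OF U(11)] tensor_apply_L2[OF ShL], of "iso_tensor 0 (1 / 2)" "- 1" Th']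
    by (simp add: Z_def[abs_def] sp)

  have pert: "N x + t *\<^sub>R dN x + K *\<^sub>R mat 1 = A x + (t * m x) *\<^sub>R C x"
    and pertQ: "Q x + t *\<^sub>R dQ x = Q x + m x *\<^sub>R (t *\<^sub>R \<xi> x)" for t x
    by (simp_all add: A_def dN_def dQ_def)
  have adm: "(line N dN t, line Q dQ t, line M Z t) \<in> \<B>" if t: "\<bar>t\<bar> < 1 / 4" for t
  proof -
    have "AE x in \<mu>. N x + t *\<^sub>R dN x \<in> sym_mat" "AE x in \<mu>. M x + t *\<^sub>R Z x \<in> sym_mat"
      using V(5,6) dNs Zs by (auto simp: sym_mat_iff)
    moreover have "AE x in \<mu>. pos_def (N x + t *\<^sub>R dN x + K *\<^sub>R mat 1)"
      using posA Cs mpos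
    proof eventually_elim
      case (elim x)
      then show ?case unfolding pert using t by (intro pos_def_perturb(1) cC) auto
    qed
    ultimately show ?thesis
      using V dNL dQL ZL by (simp add: B_star_def L2_sym_def L2_field_lincomb)
  qed
  have y0: "inverse_integral N Q = (\<integral>\<^sup>+x. ennreal (Q x \<bullet> y x) \<partial>\<mu>)"
    unfolding inverse_integral_inv_apply[OF S(1)] y_def A_def ..
  have Qy: "AE x in \<mu>. 0 \<le> Q x \<bullet> y x \<and> Q x \<bullet> y x = y x \<bullet> (A x *v y x)"
    using posA by eventually_elim (use inv_apply_form in \<open>auto simp: y_def\<close>)
  have Qyi: "integrable \<mu> (\<lambda>x. Q x \<bullet> y x)"
    by (rule integrableI_nonneg) (use Qy S(4) y0 in auto)
  have fin: "inverse_integral (line N dN t) (line Q dQ t) < \<infinity>" if t: "\<bar>t\<bar> < 1 / 4" for t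
  proof -
    have "inverse_integral (line N dN t) (line Q dQ t) \<le> (\<integral>\<^sup>+x. ennreal (4 * (Q x \<bullet> y x) + 4) \<partial>\<mu>)"
      unfolding inverse_integral_inv_apply[OF adm[OF t]]
    proof (rule nn_integral_mono_AE)
      show "AE x in \<mu>. ennreal ((Q x + t *\<^sub>R dQ x) \<bullet> inv_apply (N x + t *\<^sub>R dN x + K *\<^sub>R mat 1) (Q x + t *\<^sub>R dQ x))
          \<le> ennreal (4 * (Q x \<bullet> y x) + 4)"
        using posA Cs mpos
      proof eventually_elim
        case (elim x)
        let ?q = "Q x + m x *\<^sub>R (t *\<^sub>R \<xi> x)"
        have "?q \<bullet> inv_apply (A x + (t * m x) *\<^sub>R C x) ?q \<le> 2 * (?q \<bullet> inv_apply (A x) ?q)"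
          using elim t by (intro pos_def_perturb(2) cC) auto
        moreover have "?q \<bullet> inv_apply (A x) ?q
            \<le> 2 * (Q x \<bullet> y x) + 2 * ((m x *\<^sub>R (t *\<^sub>R \<xi> x)) \<bullet> inv_apply (A x) (m x *\<^sub>R (t *\<^sub>R \<xi> x)))"
          unfolding y_def by (rule inverse_form_square_add_le[OF elim(1)])
        moreover have "(m x *\<^sub>R (t *\<^sub>R \<xi> x)) \<bullet> inv_apply (A x) (m x *\<^sub>R (t *\<^sub>R \<xi> x)) \<le> (norm (t *\<^sub>R \<xi> x))\<^sup>2"
          using elim m1 by (intro inverse_form_bound) auto
        moreover have "norm (t *\<^sub>R \<xi> x) \<le> 1" using t n\<xi>[of x] by (simp add: mult_le_one)
        then have "(norm (t *\<^sub>R \<xi> x))\<^sup>2 \<le> 1" by (rule power_le_one[OF norm_ge_zero])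
        ultimately show ?case
          unfolding pert pertQ by (intro ennreal_leI) linarith
      qed
    qed
    also have "\<dots> < \<infinity>"
    proof -
      have "integrable \<mu> (\<lambda>x. 4 * (Q x \<bullet> y x) + 4)" using Qyi by simp
      then have "(\<integral>\<^sup>+x. ennreal (4 * (Q x \<bullet> y x) + 4) \<partial>\<mu>) = ennreal (\<integral>x. 4 * (Q x \<bullet> y x) + 4 \<partial>\<mu>)"
        using Qy by (intro nn_integral_eq_integral) auto
      then show ?thesis by simp
    qed
    finally show ?thesis .
  qed

  have oi: "integrable \<mu> (\<lambda>x. dN x \<bullet> outer (y x) (y x))"
  proof (rule dom.integrable_const_bound[of _ 1])
    show "AE x in \<mu>. norm (dN x \<bullet> outer (y x) (y x)) \<le> 1"
    proof (rule AE_I2)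
      fix x
      have "\<bar>dN x \<bullet> outer (y x) (y x)\<bar> \<le> norm (dN x) * norm (outer (y x) (y x))" by (rule Cauchy_Schwarz_ineq2)
      also have "\<dots> = norm (C x) * (m x * (norm (y x))\<^sup>2)"
        using m0[of x] by (simp add: dN_def norm_outer power2_eq_square)
      also have "\<dots> \<le> 1" by (rule mult_le_one[OF nC _ myy]) (use m0[of x] in simp)
      finally show "norm (dN x \<bullet> outer (y x) (y x)) \<le> 1" by simp
    qed
  qed measurable
  have yi: "integrable \<mu> (\<lambda>x. dQ x \<bullet> y x)"
  proof (rule dom.integrable_const_bound[of _ 1])
    show "AE x in \<mu>. norm (dQ x \<bullet> y x) \<le> 1"
    proof (rule AE_I2)
      fix x
      have "\<bar>dQ x \<bullet> y x\<bar> \<le> norm (dQ x) * norm (y x)" by (rule Cauchy_Schwarz_ineq2)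
      also have "\<dots> = norm (\<xi> x) * (m x * norm (y x))" using m0[of x] by (simp add: dQ_def)
      also have "\<dots> \<le> 1" by (rule mult_le_one[OF n\<xi> _ my]) (use m0[of x] in simp)
      finally show "norm (dQ x \<bullet> y x) \<le> 1" by simp
    qed
  qed measurable
  note ints = oi yi inner_field_integrable[OF dQL gL] inner_field_integrable[OF dNL eL]
    inner_field_integrable[OF tensor_apply_L2[OF V(2), of TH'] dNL] inner_field_integrable[OF tensor_apply_L2[OF ShL, of Th'] ZL]
    inner_field_integrable[OF ZL U(11)] inner_field_integrable[OF V(4) U(11)] inner_field_integrable[OF V(3) gL]
    inner_field_integrable[OF V(2) eL]
  define L where "L = pairing Z (hess w) - pairing (\<lambda>x. tensor_apply Th' (Sh x)) Z
    + (pairing dQ g - pairing dQ y)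
    + (pairing dN e + pairing dN (\<lambda>x. outer (y x) (y x)) / 2 - pairing (\<lambda>x. tensor_apply TH' (N x)) dN)"
  let ?S = "\<lambda>x. Z x \<bullet> Z x + m x / (1 + norm (R x)) * (R x \<bullet> R x) + m x / (1 + norm (X x)) * (X x \<bullet> X x)"
  let ?D = "\<lambda>x. (Z x \<bullet> hess w x - tensor_apply Th' (Sh x) \<bullet> Z x) + (dQ x \<bullet> g x - dQ x \<bullet> y x)
    + (dN x \<bullet> e x + dN x \<bullet> outer (y x) (y x) / 2 - tensor_apply TH' (N x) \<bullet> dN x)"
  have "L = 0"
  proof (rule stationary_slope_eq_0)
    show "((\<lambda>t. lagrangian (line N dN t) (line Q dQ t) (line M Z t) z v w) has_real_derivative 0) (at 0)"
      using stationary_derivative[OF s, of "1 / 4" dN dQ Z "\<lambda>_. 0" "\<lambda>_. 0" "\<lambda>_. 0"] adm fin S by simp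
    fix t :: real assume t: "\<bar>t\<bar> < 1 / 4"
    have "lagrangian (line N dN t) (line Q dQ t) (line M Z t) z v w \<le> lagrangian N Q M z v w + t * L"
      unfolding L_def Sh_def g_def e_def
      by (rule lagrangian_line_le[OF S(1,4) adm[OF t] fin[OF t] zL S(3) dNL dQL ZL dNs AE_I2[OF Zs] _ _ oi yi])
        (simp_all only: y_def A_def \<open>y \<in> borel_measurable \<mu>\<close>[unfolded y_def[abs_def] A_def])
    then show "lagrangian (line N dN t) (line Q dQ t) (line M Z t) z v w
        \<le> lagrangian (line N dN 0) (line Q dQ 0) (line M Z 0) z v w + t * L"
      by simp
  qed simp
  moreover have "L = (\<integral>x. ?D x \<partial>\<mu>)" and Di: "integrable \<mu> ?D"
    unfolding L_def using ints by simp_all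
  moreover have D: "?D x = ?S x" for x
  proof -
    have "Z x \<bullet> hess w x = Z x \<bullet> sym_part (hess w x)"
      using Zs[of x] by (simp add: inner_mat2 sym_mat_iff field_simps)
    then have "Z x \<bullet> hess w x - tensor_apply Th' (Sh x) \<bullet> Z x = Z x \<bullet> Z x"
      by (simp add: Z_def inner_diff_right inner_commute)
    moreover have "dQ x \<bullet> g x - dQ x \<bullet> y x = dQ x \<bullet> R x" by (simp add: R_def inner_diff_right)
    moreover have "dN x \<bullet> e x + dN x \<bullet> outer (y x) (y x) / 2 - tensor_apply TH' (N x) \<bullet> dN x = dN x \<bullet> X x"
      by (simp add: X_def inner_simps inner_commute)
    ultimately show ?thesis by (simp add: dQ_def \<xi>_def dN_def C_def)
  qed
  ultimately have I0: "(\<integral>x. ?S x \<partial>\<mu>) = 0" by (simp only: D)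
  have Ii: "integrable \<mu> ?S" using Di by (simp only: D)
  have nn: "0 \<le> Z x \<bullet> Z x" "0 \<le> m x / (1 + norm (R x)) * (R x \<bullet> R x)" "0 \<le> m x / (1 + norm (X x)) * (X x \<bullet> X x)" for x
    using m0 by (auto intro!: mult_nonneg_nonneg divide_nonneg_pos add_pos_nonneg)
  have "AE x in \<mu>. ?S x = 0"
    using I0 by (subst (asm) integral_nonneg_eq_0_iff_AE[OF Ii]) (use nn in \<open>auto intro!: add_nonneg_nonneg\<close>)
  then have eqs: "AE x in \<mu>. Z x = 0 \<and> R x = 0 \<and> X x = 0"
    using mpos
  proof eventually_elim
    case (elim x)
    have "Z x \<bullet> Z x = 0" "m x / (1 + norm (R x)) * (R x \<bullet> R x) = 0" "m x / (1 + norm (X x)) * (X x \<bullet> X x) = 0"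
      using elim(1) nn[of x] by linarith+
    moreover have "1 + norm (R x) > 0" "1 + norm (X x) > 0" by (simp_all add: add_pos_nonneg)
    ultimately show ?case using elim(2) by auto
  qed
  show "AE x in \<mu>. tensor_apply Th' (shift M z x) = sym_part (hess w x)"
    using eqs by eventually_elim (simp add: Z_def Sh_def)
  show "AE x in \<mu>. tensor_apply TH' (N x) = strain (v, w) x"
    using eqs by eventually_elim (simp add: X_def R_def gamma_eq e_def g_def)
  show "AE x in \<mu>. inv_apply (stiff N x) (Q x) = grad w x"
    using eqs by eventually_elim (simp add: R_def y_def A_def g_def)
qed

subsection \<open>Variation of the scalar dual variable\<close>

lemma quadratic_stationary:
  fixes c0 c1 c2 :: real
  assumes "((\<lambda>t. c0 + t * c1 + t\<^sup>2 * c2) has_real_derivative 0) (at 0)"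
  shows "c1 = 0"
proof -
  have "((\<lambda>t. c0 + t * c1 + t\<^sup>2 * c2) has_real_derivative c1) (at 0)"
    by (auto intro!: derivative_eq_intros)
  then show ?thesis using assms DERIV_unique by blast
qed

text \<open>The first dual equation turns the variation in \<open>z\<close> into orthogonality of \<open>\<nabla> z + K \<nabla> w\<close> to all
  gradients; the choice \<open>z + K w\<close> of the test field makes it a square.\<close>

lemma stationary_gradient:
  assumes s: "stationary N Q M z v w"
  shows "AE x in \<mu>. grad z x = - K *\<^sub>R grad w x"
proof -
  note S = stationaryD[OF s] and V = B_starD[OF stationaryD(1)[OF s]] and U = U_spaceD[OF stationaryD(3)[OF s]]
  have z: "z \<in> W2" "z \<in> W1" "z \<in> \<L>" using S(2) W22_0_W22 W22_W12 W12_L2 by blast+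
  define \<zeta> where "\<zeta> x = z x + K * w x" for x
  have \<zeta>0: "\<zeta> \<in> W2\<^sub>0" unfolding \<zeta>_def[abs_def] by (rule W22_0_lincomb[OF S(2) U(5)])
  then have \<zeta>: "\<zeta> \<in> W1" "\<zeta> \<in> \<L>" using W22_0_W22 W22_W12 W12_L2 by blast+
  define Sh where "Sh x = M x + z x *\<^sub>R (mat 1 :: real^2^2)" for x
  define D where "D x = \<zeta> x *\<^sub>R (mat 1 :: real^2^2)" for x
  have ShL: "Sh \<in> \<L>" and DL: "D \<in> \<L>"
    using shift_L2[OF V(4) z(3)] identity_field_L2[OF \<zeta>(2)] by (simp_all add: Sh_def[abs_def] D_def[abs_def])
  have g: "grad z \<in> \<L>" "grad \<zeta> \<in> \<L>" using z \<zeta> grad2_L2 by auto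
  have G: "form_int Th' (shift M (\<lambda>x. z x + t * \<zeta> x)) (shift M (\<lambda>x. z x + t * \<zeta> x))
      = form_int Th' Sh Sh + 2 * t * form_int Th' Sh D + t\<^sup>2 * form_int Th' D D" for t
    by (rule form_int_line[OF ShL DL shift_L2[OF V(4) W12_L2[OF W12_lincomb[OF z(2) \<zeta>(1)]]] h_bar_iso])
      (simp add: Sh_def D_def algebra_simps)
  have F: "Fz (\<lambda>x. z x + t * \<zeta> x)
      = (square_int (grad z) + 2 * t * pairing (grad z) (grad \<zeta>) + t\<^sup>2 * square_int (grad \<zeta>)) / (2 * K)" for t
    using square_int_line[OF g grad2_L2[OF W12_lincomb[OF z(2) \<zeta>(1)]] grad2_lincomb[OF z(2) \<zeta>(1)]]
    by (simp add: F_star_eq)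
  define c1 where "c1 = (\<integral>x. grad z x \<bullet> grad \<zeta> x \<partial>\<mu>) / K - form_int Th' Sh D"
  define c2 where "c2 = (\<integral>x. (norm (grad \<zeta> x))\<^sup>2 \<partial>\<mu>) / (2 * K) - form_int Th' D D / 2"
  have "lagrangian N Q M (\<lambda>x. z x + t * \<zeta> x) v w = lagrangian N Q M z v w + t * c1 + t\<^sup>2 * c2" for t
    unfolding lagrangian_def G F c1_def c2_def F_star_eq
    using K_pos by (simp add: Sh_def field_simps)
  moreover have "((\<lambda>t. lagrangian N Q M (\<lambda>x. z x + t * \<zeta> x) v w) has_real_derivative 0) (at 0)"
    using stationary_derivative[OF s zero_less_one, of "\<lambda>_. 0" "\<lambda>_. 0" "\<lambda>_. 0" \<zeta> "\<lambda>_. 0" "\<lambda>_. 0"] S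
      W22_0_lincomb[OF S(2) \<zeta>0] by simp
  ultimately have "c1 = 0" by (simp add: quadratic_stationary)
  have "form_int Th' Sh D = (\<integral>x. (\<zeta> x *\<^sub>R mat 1) \<bullet> hess w x \<partial>\<mu>)"
  proof (rule integral_cong_AE)
    show "AE x in \<mu>. tensor_form Th' (Sh x) (D x) = (\<zeta> x *\<^sub>R mat 1) \<bullet> hess w x"
      using stationary_dual_equations(1)[OF s]
    proof eventually_elim
      case (elim x)
      have "tensor_form Th' (Sh x) (D x) = tensor_apply Th' (Sh x) \<bullet> D x" by (simp add: h_bar_iso tensor_form_iso)
      also have "\<dots> = sym_part (hess w x) \<bullet> D x" using elim by (simp add: Sh_def)
      also have "\<dots> = (\<zeta> x *\<^sub>R mat 1) \<bullet> hess w x" by (simp add: D_def inner_mat2 mat_def algebra_simps)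
      finally show ?case .
    qed
    show "(\<lambda>x. tensor_form Th' (Sh x) (D x)) \<in> borel_measurable \<mu>" by (intro borel_measurable_integrable tensor_form_integrable ShL DL)
    show "(\<lambda>x. (\<zeta> x *\<^sub>R mat 1) \<bullet> hess w x) \<in> borel_measurable \<mu>"
      by (intro borel_measurable_integrable inner_field_integrable identity_field_L2 \<zeta> U)
  qed
  also have "\<dots> = - (\<integral>x. grad \<zeta> x \<bullet> grad w x \<partial>\<mu>)"
    by (rule identity_inner_hess_by_parts[OF \<zeta>(1) U(5)])
  finally have "(\<integral>x. grad z x \<bullet> grad \<zeta> x \<partial>\<mu>) + K * (\<integral>x. grad \<zeta> x \<bullet> grad w x \<partial>\<mu>) = 0"
    using \<open>c1 = 0\<close> K_pos by (simp add: c1_def field_simps)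
  moreover have "pairing (grad \<zeta>) (grad \<zeta>) = pairing (grad \<zeta>) (grad z) + K * pairing (grad \<zeta>) (grad w)"
    using grad2_lincomb[OF z(2) U(7), of K, folded \<zeta>_def]
    by (intro pairing_line g U(10))
  ultimately have "square_int (grad \<zeta>) = 0"
    by (simp add: power2_norm_eq_inner pairing_commute[of "grad z"])
  then have "AE x in \<mu>. (norm (grad \<zeta> x))\<^sup>2 = 0"
    by (subst (asm) integral_nonneg_eq_0_iff_AE[OF norm_square_integrable[OF g(2)]]) auto
  then show ?thesis
    using grad2_lincomb[OF z(2) U(7), of K, folded \<zeta>_def]
    by eventually_elim (simp add: eq_neg_iff_add_eq_0)
qed

section \<open>The primal functional along lines\<close>

lemma J_line_polynomial:
  assumes u: "(v, w) \<in> \<U>" and u': "(v', w') \<in> \<U>"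
  obtains c1 c2 c3 c4 where "\<And>t. Jp (line v v' t, \<lambda>x. w x + t * w' x)
    = Jp (v, w) + t * c1 + t\<^sup>2 * c2 + t^3 * c3 + t^4 * c4"
proof -
  note U = U_spaceD[OF u] and U' = U_spaceD[OF u']
  define G where "G = strain (v, w)"
  define B where "B = line (sym_grad v') (line (\<lambda>x. outer (grad w x) (grad w' x)) (\<lambda>x. outer (grad w' x) (grad w x)) 1) (1 / 2)"
  define C where "C = line (\<lambda>x. 0) (grad_outer w') (1 / 2)"
  have L: "G \<in> \<L>" "B \<in> \<L>" "C \<in> \<L>"
    unfolding G_def B_def C_def by (intro U U' L2_field_lincomb L2_zero outer_grad_L2)+
  note Ut = U_spaceD[OF U_space_lincomb[OF u u']]
  have \<gamma>: "AE x in \<mu>. strain (line v v' t, \<lambda>x. w x + t * w' x) x = line G (line B C t) t x" for t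
    using sym_grad_lincomb[OF U(2) U'(2), of t] grad2_lincomb[OF U(7) U'(7), of t]
    by eventually_elim
      (simp add: gamma_eq G_def B_def C_def mat2_eq_iff outer_def field_simps power2_eq_square)
  have m: "form_int TH (strain (line v v' t, \<lambda>x. w x + t * w' x)) (strain (line v v' t, \<lambda>x. w x + t * w' x))
      = form_int TH G G + 2 * t * (form_int TH G B + t * form_int TH G C)
        + t\<^sup>2 * (form_int TH B B + 2 * t * form_int TH B C + t\<^sup>2 * form_int TH C C)" for t
    using form_int_line[OF L(1) L2_field_lincomb[OF L(2,3)] Ut(13) H_tensor_iso \<gamma>]
    unfolding form_int_line_right[OF L H_tensor_iso]
      form_int_line[OF L(2,3) L2_field_lincomb[OF L(2,3)] H_tensor_iso AE_I2[OF refl]] .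
  have b: "form_int Th (hess (\<lambda>x. w x + t * w' x)) (hess (\<lambda>x. w x + t * w' x))
      = form_int Th (hess w) (hess w) + 2 * t * form_int Th (hess w) (hess w') + t\<^sup>2 * form_int Th (hess w') (hess w')" for t
    by (rule form_int_line[OF U(11) U'(11) Ut(11) h_tensor_iso hess_lincomb[OF U(6) U'(6)]])
  have l: "pairing P (\<lambda>x. w x + t * w' x) = pairing P w + t * pairing P w'"
    "pairing p (line v v' t) = pairing p v + t * pairing p v'" for t
    by (rule pairing_line; use P_L2 p_L2 U U' Ut in simp)+
  show ?thesis
    by (rule that[of "form_int Th (hess w) (hess w') + form_int TH G B - pairing P w' - pairing p v'"
        "form_int Th (hess w') (hess w') / 2 + (2 * form_int TH G C + form_int TH B B) / 2"
        "form_int TH B C" "form_int TH C C / 2"])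
      (unfold J_eq b m l G_def[symmetric], simp add: field_simps power2_eq_square power3_eq_cube power4_eq_xxxx)
qed

lemma U_space_direction:
  assumes u: "u \<in> \<U>" and "s \<noteq> 0" and us: "u + s *\<^sub>R \<eta> \<in> \<U>"
  shows "\<eta> \<in> \<U>"
proof -
  obtain v w v' w' where eq: "u = (v, w)" "\<eta> = (v', w')" by (metis surj_pair)
  have us': "(\<lambda>x. v x + s *\<^sub>R v' x, \<lambda>x. w x + s * w' x) \<in> \<U>"
    using us by (simp add: eq plus_fun_def scaleR_fun_def)
  have d: "(\<lambda>x. s *\<^sub>R v' x, \<lambda>x. s * w' x) \<in> \<U>"
    using U_space_lincomb[OF us' u[unfolded eq(1)], of "- 1"] by simp
  have "(\<lambda>x. 0, \<lambda>x. 0) \<in> \<U>" by (rule U_space_transverse[OF W22_0_zero])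
  from U_space_lincomb[OF this d, of "1 / s"] show ?thesis
    using \<open>s \<noteq> 0\<close> by (simp add: eq)
qed

text \<open>A minimizer of \<open>J\<close> plus a nonnegative quadratic term that vanishes at the minimizer is a critical
  point of \<open>J\<close>.\<close>

lemma minimizer_first_variation:
  assumes u: "(v, w) \<in> \<U>"
    and min: "\<And>v' w'. (v', w') \<in> \<U> \<Longrightarrow> Jp (v, w)
      \<le> Jp (v', w') + K / 2 * (\<integral>x. (norm (grad w' x - grad w x))\<^sup>2 \<partial>\<mu>)"
  shows "has_first_variation (\<U>) (\<lambda>u. ereal (Jp u)) (v, w) (\<lambda>_. 0)"
  unfolding has_first_variation_def Let_def
proof (intro conjI allI impI)
  show "(v, w) \<in> {y \<in> \<U>. \<bar>ereal (Jp y)\<bar> \<noteq> \<infinity>}" using u by simp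
  fix \<eta> :: displacement
  assume "\<exists>e>0. \<forall>t. \<bar>t\<bar> < e \<longrightarrow> (v, w) + t *\<^sub>R \<eta> \<in> {y \<in> \<U>. \<bar>ereal (Jp y)\<bar> \<noteq> \<infinity>}"
  then obtain e where e: "e > 0" "\<And>t. \<bar>t\<bar> < e \<Longrightarrow> (v, w) + t *\<^sub>R \<eta> \<in> \<U>" by auto
  have "\<eta> \<in> \<U>" by (rule U_space_direction[OF u, of "e / 2"]) (use e in auto)
  then obtain v' w' where \<eta>: "\<eta> = (v', w')" and u': "(v', w') \<in> \<U>" by (metis surj_pair)
  note U = U_spaceD[OF u] and U' = U_spaceD[OF u']
  let ?J = "\<lambda>t. Jp (line v v' t, \<lambda>x. w x + t * w' x)"
  obtain c1 c2 c3 c4 where poly: "\<And>t. ?J t = Jp (v, w) + t * c1 + t\<^sup>2 * c2 + t^3 * c3 + t^4 * c4"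
    using J_line_polynomial[OF u u'] by blast
  define q where "q = K / 2 * square_int (grad w')"
  have "square_int (\<lambda>x. grad (\<lambda>x. w x + t * w' x) x - grad w x) = t\<^sup>2 * square_int (grad w')" for t
  proof -
    have L: "grad w \<in> \<L>" "grad w' \<in> \<L>" "grad (\<lambda>x. w x + t * w' x) \<in> \<L>"
      using U U' U_spaceD(10)[OF U_space_lincomb[OF u u']] by auto
    have "AE x in \<mu>. grad (\<lambda>x. w x + t * w' x) x - grad w x = line (\<lambda>x. 0) (grad w') t x"
      using grad2_lincomb[OF U(7) U'(7), of t] by eventually_elim simp
    then show ?thesis
      using square_int_line[OF L2_zero L(2) L2_field_lincomb[OF L(3,1), of "- 1"]] by simp
  qed
  then have Jt: "Jp (v, w) \<le> ?J t + t\<^sup>2 * q" for t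
    using min[OF U_space_lincomb[OF u u', of t]] by (simp add: q_def mult.left_commute mult.assoc)
  have le: "0 \<le> t * c1 + t\<^sup>2 * (c2 + q) + t^3 * c3 + t^4 * c4" for t
    using Jt[of t] unfolding poly by (simp add: algebra_simps)
  have "((\<lambda>t. t * c1 + t\<^sup>2 * (c2 + q) + t^3 * c3 + t^4 * c4) has_real_derivative c1) (at 0)"
    by (auto intro!: derivative_eq_intros)
  then have "c1 = 0"
    by (rule DERIV_local_min[OF _ zero_less_one]) (use le in simp)
  have "((\<lambda>t. Jp (v, w) + t * c1 + t\<^sup>2 * c2 + t^3 * c3 + t^4 * c4) has_real_derivative c1) (at 0)"
    by (auto intro!: derivative_eq_intros)
  then have "(?J has_real_derivative 0) (at 0)"
    unfolding poly by (simp add: \<open>c1 = 0\<close>)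
  then show "((\<lambda>t. real_of_ereal (ereal (Jp ((v, w) + t *\<^sub>R \<eta>)))) has_real_derivative 0) (at 0)"
    by (simp add: \<eta> plus_fun_def scaleR_fun_def)
qed

section \<open>The compatibility term\<close>

text \<open>At a stationary point the strain \<open>h_bar (M + z \<delta>)\<close> is a Hessian, so it satisfies the
  compatibility equation and the additional term vanishes.\<close>

lemma stationary_L_op:
  assumes s: "stationary N Q M z v w" and f: "f \<in> W2\<^sub>0"
  shows "L_op \<Omega> h la mu (N, Q, M) z f = 0"
proof -
  note S = stationaryD[OF s] and V = B_starD[OF stationaryD(1)[OF s]] and U = U_spaceD[OF stationaryD(3)[OF s]]
  have zL: "z \<in> \<L>" using S(2) W22_0_W22 W22_W12 W12_L2 by blast
  have L: "wd2 \<alpha> \<beta> w \<in> \<L>" "wd2 \<alpha> \<beta> f \<in> \<L>" for \<alpha> \<beta>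
    using U(6) W22_0_W22[OF f] W22_wpd2_L2 by auto
  have T: "(\<lambda>x. tensor_apply Th' (shift M z x) $ \<alpha> $ \<beta>) \<in> \<L>" for \<alpha> \<beta>
    using tensor_apply_L2[OF shift_L2[OF V(4) zL]] by (simp add: L2_vec_iff)
  have "(\<integral>x. tensor_apply Th' (shift M z x) $ \<alpha> $ \<alpha> * wd2 \<beta> \<beta> f x \<partial>\<mu>)
      = (\<integral>x. wd2 \<alpha> \<alpha> w x * wd2 \<beta> \<beta> f x \<partial>\<mu>)" for \<alpha> \<beta>
  proof (rule integral_cong_AE)
    show "AE x in \<mu>. tensor_apply Th' (shift M z x) $ \<alpha> $ \<alpha> * wd2 \<beta> \<beta> f x = wd2 \<alpha> \<alpha> w x * wd2 \<beta> \<beta> f x"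
      using stationary_dual_equations(1)[OF s] by eventually_elim (simp add: hess_def)
  qed (intro borel_measurable_integrable L2_mult_integrable L T)+
  then show ?thesis
    using W22_0_hessian_minor[OF U(5) f] by (simp add: L_op_def)
qed

lemma wpd2_zero: "AE x in \<mu>. wd2 \<alpha> \<beta> (\<lambda>x. 0) x = 0"
  using wpd2_lincomb[OF test_fun_W22[OF test_fun_zero] test_fun_W22[OF test_fun_zero], of \<alpha> \<beta> 1] by simp

lemma stationary_J1_star:
  assumes s: "stationary N Q M z v w"
  shows "J1_star \<Omega> h la mu K eps3 (N, Q, M) z = dual (N, Q, M) z"
proof -
  let ?L = "L_op \<Omega> h la mu (N, Q, M) z"
  have "(\<integral>x. wd2 \<alpha> \<alpha> (\<lambda>x. 0) x * wd2 \<beta> \<beta> \<phi> x \<partial>\<mu>) = 0" for \<alpha> \<beta> \<phi>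
    using wpd2_zero[of \<alpha> \<alpha>] by (intro integral_eq_zero_AE) auto
  then have "plate_op \<Omega> h la mu (\<lambda>x. 0) \<phi> = 0" for \<phi>
    by (simp add: plate_op_def)
  then have "(\<lambda>x. 0) \<in> W2\<^sub>0 \<and> (\<forall>\<phi>\<in>\<T>. plate_op \<Omega> h la mu (\<lambda>x. 0) \<phi> = ?L \<phi>)"
    using stationary_L_op[OF s test_fun_W22_0] W22_0_zero by simp
  then have "\<exists>w. w \<in> W2\<^sub>0 \<and> (\<forall>\<phi>\<in>\<T>. plate_op \<Omega> h la mu w \<phi> = ?L \<phi>)"
    by blast
  then have "(SOME w. w \<in> W2\<^sub>0 \<and> (\<forall>\<phi>\<in>\<T>. plate_op \<Omega> h la mu w \<phi> = ?L \<phi>)) \<in> W2\<^sub>0"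
    by (rule someI_ex[THEN conjunct1])
  then have "C0 \<Omega> h la mu eps3 ?L \<in> W2\<^sub>0"
    unfolding C0_def scaleR_fun_def by (simp add: W22_0_cmult)
  then show ?thesis
    by (simp add: J1_star_def stationary_L_op[OF s])
qed

section \<open>Strong duality at a stationary point\<close>

lemma stationary_duality:
  assumes s: "stationary N0 Q0 M0 z0 v0 w0"
  shows "has_first_variation (\<U>) (\<lambda>u. ereal (Jp u)) (v0, w0) (\<lambda>_. 0)"
    and "ereal (Jp (v0, w0))
        = (INF u\<in>\<U>. ereal (Jp u
             + K / 2 * (\<integral>x. (norm (grad (snd u) x - grad w0 x))\<^sup>2 \<partial>\<mu>)))"
    and "ereal (Jp (v0, w0)) = dual (N0, Q0, M0) z0"
    and "dual (N0, Q0, M0) z0 = (SUP v\<in>\<A>. dual v z0)"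
proof -
  note S = stationaryD[OF s] and U = U_spaceD[OF stationaryD(3)[OF s]]
  have z: "z0 \<in> W1" "z0 \<in> \<L>" using S(2) W22_0_W22 W22_W12 W12_L2 by blast+
  let ?E = "\<lambda>u. Jp u + K / 2 * (\<integral>x. (norm (grad (snd u) x - grad w0 x))\<^sup>2 \<partial>\<mu>)"
  have reg: "primal_bound z0 (v, w) = ?E (v, w)" if "(v, w) \<in> \<U>" for v w
    using primal_bound_regularized[OF z(1) U(7) that stationary_gradient[OF s]] by simp
  have dual: "dual (N0, Q0, M0) z0 = ereal (lagrangian N0 Q0 M0 z0 v w)" if "(v, w) \<in> \<U>" for v w
    using J_star_A_star[OF stationary_A_star[OF s] that] S(4) by simp
  have "lagrangian N0 Q0 M0 z0 v0 w0 = ?E (v0, w0)"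
    using lagrangian_eq_primal_bound[OF S(1) z(2) S(3) stationary_dual_equations[OF s]] reg[OF S(3)] by simp
  then show eq: "ereal (Jp (v0, w0)) = dual (N0, Q0, M0) z0"
    using dual[OF S(3)] by simp
  have le: "Jp (v0, w0) \<le> ?E (v, w)" if "(v, w) \<in> \<U>" for v w
  proof -
    have "ereal (Jp (v0, w0)) = ereal (lagrangian N0 Q0 M0 z0 v w)"
      using eq dual[OF that] by simp
    then show ?thesis
      using lagrangian_le_primal_bound[OF S(1) S(4) z(2) that] reg[OF that] by simp
  qed
  then show "has_first_variation (\<U>) (\<lambda>u. ereal (Jp u)) (v0, w0) (\<lambda>_. 0)"
    using minimizer_first_variation[OF S(3)] by simp
  show "ereal (Jp (v0, w0)) = (INF u\<in>\<U>. ereal (?E u))"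
  proof (rule antisym)
    show "ereal (Jp (v0, w0)) \<le> (INF u\<in>\<U>. ereal (?E u))"
      by (rule INF_greatest) (use le in auto)
    have "(INF u\<in>\<U>. ereal (?E u)) \<le> ereal (?E (v0, w0))"
      by (rule INF_lower[OF S(3)])
    then show "(INF u\<in>\<U>. ereal (?E u)) \<le> ereal (Jp (v0, w0))"
      by simp
  qed
  show "dual (N0, Q0, M0) z0 = (SUP v\<in>\<A>. dual v z0)"
  proof (rule antisym)
    show "dual (N0, Q0, M0) z0 \<le> (SUP v\<in>\<A>. dual v z0)"
      by (rule SUP_upper[OF stationary_A_star[OF s]])
    show "(SUP v\<in>\<A>. dual v z0) \<le> dual (N0, Q0, M0) z0"
    proof (rule SUP_least)
      fix x assume x: "x \<in> \<A>"
      obtain N Q M where eqx: "x = (N, Q, M)" by (metis surj_pair)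
      have B: "(N, Q, M) \<in> \<B>" using x by (simp add: eqx A_star_def A1_star_def)
      have "lagrangian N Q M z0 v0 w0 \<le> Jp (v0, w0)" if "inverse_integral N Q < \<infinity>"
        using lagrangian_le_primal_bound[OF B that z(2) S(3)] reg[OF S(3)] by simp
      then show "dual x z0 \<le> dual (N0, Q0, M0) z0"
        unfolding eqx J_star_A_star[OF x[unfolded eqx] S(3)] eq[symmetric] by simp
    qed
  qed
qed

end

section \<open>The duality principle\<close>

theorem theorem3p1:
  fixes \<Omega> :: "(real^2) set" and h la mu K eps3 :: real
    and P :: scalar_field and p :: vector_field
    and N0 :: matrix_field and Q0 :: vector_field and M0 :: matrix_field
    and z0 :: scalar_field and v0 :: vector_field and w0 :: scalar_field
  assumes "open \<Omega>" "bounded \<Omega>" "connected \<Omega>" "lipschitz_boundary \<Omega>"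
    and "h > 0" "la > 0" "mu > 0" "K > 0"
    and "P \<in> L2 \<Omega>" "p \<in> L2 \<Omega>"
    and "0 < eps3" "eps3 < 1"
    and "\<And>z. z \<in> W22_0 \<Omega> \<Longrightarrow> ext_concave_on (B_star \<Omega> K) (\<lambda>v. J1_star \<Omega> h la mu K eps3 v z)"
    and "((N0, Q0, M0), z0, (v0, w0)) \<in> B_star \<Omega> K \<times> W22_0 \<Omega> \<times> U_space \<Omega>"
    and "has_first_variation (B_star \<Omega> K \<times> W22_0 \<Omega> \<times> U_space \<Omega>)
           (\<lambda>(v, z, u). J3_star \<Omega> h la mu K P p v z u) ((N0, Q0, M0), z0, (v0, w0)) (\<lambda>_. 0)"
  shows "has_first_variation (U_space \<Omega>) (\<lambda>u. ereal (J \<Omega> h la mu P p u)) (v0, w0) (\<lambda>_. 0)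
    \<and> (N0, Q0, M0) \<in> A_star \<Omega> K P p
    \<and> ereal (J \<Omega> h la mu P p (v0, w0))
        = (INF u\<in>U_space \<Omega>. ereal (J \<Omega> h la mu P p u
             + K / 2 * (\<integral>x. (norm (grad2 \<Omega> (snd u) x - grad2 \<Omega> w0 x))\<^sup>2 \<partial>lebesgue_on \<Omega>)))
    \<and> ereal (J \<Omega> h la mu P p (v0, w0)) = J_star \<Omega> h la mu K (N0, Q0, M0) z0
    \<and> J_star \<Omega> h la mu K (N0, Q0, M0) z0 = (SUP v\<in>A_star \<Omega> K P p. J_star \<Omega> h la mu K v z0)
    \<and> J_star \<Omega> h la mu K (N0, Q0, M0) z0 = J1_star \<Omega> h la mu K eps3 (N0, Q0, M0) z0"
proof -
  interpret plate \<Omega> h la mu K P p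
    by unfold_locales (use assms in auto)
  have s: "stationary N0 Q0 M0 z0 v0 w0"
    using assms(14,15) by (simp add: stationary_def)
  show ?thesis
    using stationary_duality[OF s] stationary_A_star[OF s] stationary_J1_star[OF s] by simp
qed

end
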